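(* For any integer $p\ge1$ there exists a random vector $(X_i)_{1\le i\le p}$ such that for any pairwise distinct nonzero real numbers $x_1,x_2,\dots,x_p$ we have the convergence in distribution $$\big(W_n(x_i)\big)_{1\le i\le p}\xrightarrow[n\to\infty]{(d)}(X_i)_{1\le i\le p}.$$ The random variables $X_1,\dots,X_p$ and the differences $X_i-X_j$, $i\ne j$, all have the same distribution, namely the distribution on $\mathbb{R}$ with density $e^{-2|x|}$, $x\in\mathbb{R}$.
   Context: A two-sided Brownian motion is a process $(B(t))_{t\in\mathbb{R}}$ with $B(t)=B_+(t)$ for $t\ge 0$ and $B(t)=B_-(-t)$ for $t\le 0$, where $B_+,B_-$ are independent standard one-dimensional Brownian motions started from $0$. Let $B_1,B_2,\dots$ be a sequence of independent two-sided Brownian motions and, for $n\ge1$ and $t\in\mathbb{R}$, let $W_n(t)=B_n(B_{n-1}(\cdots B_2(B_1(t))\cdots))$. *)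

theory Defs
  imports "HOL-Probability.Probability"
begin

(* Standard one-dimensional Brownian motion started from 0, with time set {0..}; the values B t for
   t < 0 are irrelevant.  The starting point and the continuity of paths are required for every
   outcome rather than almost surely, so that a composition of such processes is again a family of
   random variables, without completing the probability space. *)
locale brownian_motion = prob_space M for M :: "'a measure" +
  fixes B :: "real \<Rightarrow> 'a \<Rightarrow> real"
  assumes start: "\<omega> \<in> space M \<Longrightarrow> B 0 \<omega> = 0"
    and random_variable: "0 \<le> t \<Longrightarrow> B t \<in> borel_measurable M"
    and continuous_paths: "\<omega> \<in> space M \<Longrightarrow> continuous_on {0..} (\<lambda>t. B t \<omega>)"
    and normal_increments: "0 \<le> s \<Longrightarrow> s < t \<Longrightarrow>
      distributed M lborel (\<lambda>\<omega>. B t \<omega> - B s \<omega>) (\<lambda>x. ennreal (normal_density 0 (sqrt (t - s)) x))"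
    and indep_increments: "0 \<le> \<tau> 0 \<Longrightarrow> (\<And>k. k < m \<Longrightarrow> \<tau> k \<le> \<tau> (Suc k)) \<Longrightarrow>
      indep_vars (\<lambda>_. borel) (\<lambda>k \<omega>. B (\<tau> (Suc k)) \<omega> - B (\<tau> k) \<omega>) {..<m::nat}"

definition two_sided_brownian_motion :: "'a measure \<Rightarrow> (real \<Rightarrow> 'a \<Rightarrow> real) \<Rightarrow> bool" where
  "two_sided_brownian_motion M B \<longleftrightarrow>
    (\<exists>Bp Bm. brownian_motion M Bp \<and> brownian_motion M Bm \<and>
      prob_space.indep_var M
        (Pi\<^sub>M {0..} (\<lambda>_. borel)) (\<lambda>\<omega>. \<lambda>t\<in>{0..}. Bp t \<omega>)
        (Pi\<^sub>M {0..} (\<lambda>_. borel)) (\<lambda>\<omega>. \<lambda>t\<in>{0..}. Bm t \<omega>) \<and>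
      (\<forall>\<omega>\<in>space M. (\<forall>t\<ge>0. B t \<omega> = Bp t \<omega>) \<and> (\<forall>t\<le>0. B t \<omega> = Bm (- t) \<omega>)))"

(* The sequence starts at index 1; B 0 plays no role. *)
definition indep_two_sided_brownian_motions ::
    "'a measure \<Rightarrow> (nat \<Rightarrow> real \<Rightarrow> 'a \<Rightarrow> real) \<Rightarrow> bool" where
  "indep_two_sided_brownian_motions M B \<longleftrightarrow>
    (\<forall>n\<ge>1. two_sided_brownian_motion M (B n)) \<and>
    prob_space.indep_vars M (\<lambda>_. Pi\<^sub>M UNIV (\<lambda>_. borel)) (\<lambda>n \<omega> t. B n t \<omega>) {1..}"

primrec iterated_process :: "(nat \<Rightarrow> real \<Rightarrow> 'a \<Rightarrow> real) \<Rightarrow> nat \<Rightarrow> real \<Rightarrow> 'a \<Rightarrow> real" where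
  "iterated_process B 0 t \<omega> = t"
| "iterated_process B (Suc n) t \<omega> = B (Suc n) (iterated_process B n t \<omega>) \<omega>"

(* The library's weak_conv_m only covers measures on the real line. *)
definition converges_in_distribution ::
    "'a measure \<Rightarrow> (nat \<Rightarrow> 'a \<Rightarrow> 'b::topological_space) \<Rightarrow> 'c measure \<Rightarrow> ('c \<Rightarrow> 'b) \<Rightarrow> bool" where
  "converges_in_distribution M Y N X \<longleftrightarrow>
    (\<forall>n. Y n \<in> borel_measurable M) \<and> X \<in> borel_measurable N \<and>
    (\<forall>f :: 'b \<Rightarrow> real. continuous_on UNIV f \<longrightarrow> bounded (range f) \<longrightarrow>
      (\<lambda>n. \<integral>\<omega>. f (Y n \<omega>) \<partial>M) \<longlonglongrightarrow> (\<integral>\<omega>. f (X \<omega>) \<partial>N))"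

end

theory Submission
  imports Defs
begin

text \<open>
  The vector \<open>(W\<^sub>n(x\<^sub>i))\<^sub>i\<close> is a Markov chain on \<open>\<real>\<^sup>p\<close>: conditionally on \<open>W\<^sub>n = y\<close>, the next state is a
  two-sided Brownian motion read off at the points \<open>y\<^sub>i\<close>.  Since \<open>B(s) - B(t)\<close> is distributed as
  \<open>\<bar>s - t\<bar>\<^sup>1\<^sup>/\<^sup>2 Z\<close> with \<open>Z\<close> standard normal, one step halves \<open>ln \<bar>y\<^sub>i\<bar>\<close> and \<open>ln \<bar>y\<^sub>i - y\<^sub>j\<bar>\<close> up to an additive
  integrable error; hence the sum \<open>V\<close> of the absolute values of these logarithms satisfies
  \<open>E[V(W\<^sub>n\<^sub>+\<^sub>1) | W\<^sub>n] \<le> V(W\<^sub>n) / 2 + c\<close>.  Where \<open>V\<close> is bounded, the gaps between the points are bounded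
  above and below, so the transition laws have a common part, a multiple of the uniform law on the
  unit cube.  Harris' theorem then gives a limit law that does not depend on the starting point.  Both
  \<open>W\<^sub>n(x\<^sub>i)\<close> and \<open>W\<^sub>n(x\<^sub>i) - W\<^sub>n(x\<^sub>j)\<close> are themselves chains with the transition law of a single point, for
  which characteristic functions show that the law with density \<open>e\<^sup>-\<^sup>2\<^sup>|\<^sup>x\<^sup>|\<close> is invariant.
\<close>

section \<open>Harris' theorem for Markov kernels\<close>

text \<open>All estimates are uniform over measurable test functions bounded by 1, that is, in total
  variation. Hence the limit can be tested on indicators, and its marginals are identified set by
  set. The chain lives on \<open>separated\<close> because the other configurations are traps: B(0)
  = 0, and coordinates that have met stay equal. The energy therefore has to be large near zeros and
  coincidences as well as near infinity, and the logarithm is the scale on which a Brownian step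
  contracts all of these at the same rate. Two obstacles shape the probabilistic part. Independence
  of increments is given along increasing times in each half separately, whereas the coordinates of
  a state have arbitrary order and signs. So sets of times are built up from {0} by adding points
  outward; each new value is the value at the old extreme point plus an independent normal variable.
  Moreover, every step uses a different motion: that the transition laws agree has to be derived
  from the definition, and W_n has to be exhibited as a function of the first n paths alone.\<close>

definition kernel_op :: "('b \<Rightarrow> 'b measure) \<Rightarrow> ('b \<Rightarrow> real) \<Rightarrow> 'b \<Rightarrow> real" where
  "kernel_op K f y = (\<integral>z. f z \<partial>K y)"

section \<open>Bounded functions under Markov kernels\<close>

lemma (in prob_space) integrable_bounded:
  fixes f :: "'a \<Rightarrow> real"
  assumes "f \<in> borel_measurable M" "\<And>x. x \<in> space M \<Longrightarrow> \<bar>f x\<bar> \<le> C"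
  shows "integrable M f"
  by (rule integrable_const_bound[of _ C]) (use assms in auto)

lemma (in prob_space) abs_integral_bounded:
  fixes f :: "'a \<Rightarrow> real"
  assumes "f \<in> borel_measurable M" "\<And>x. x \<in> space M \<Longrightarrow> \<bar>f x\<bar> \<le> C"
  shows "\<bar>\<integral>x. f x \<partial>M\<bar> \<le> C"
proof -
  have "\<bar>\<integral>x. f x \<partial>M\<bar> \<le> (\<integral>x. C \<partial>M)"
    by (rule order_trans[OF integral_abs_bound], intro integral_mono integrable_abs
        integrable_bounded[OF assms]) (use assms in auto)
  then show ?thesis by (simp add: prob_space)
qed

lemma
  fixes f :: "'b \<Rightarrow> real"
  assumes K: "K \<in> S \<rightarrow>\<^sub>M prob_algebra S'" and y: "y \<in> space S"
  shows kernel_prob_space: "prob_space (K y)"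
    and kernel_sets: "sets (K y) = sets S'"
    and kernel_space: "space (K y) = space S'"
    and kernel_measurable: "f \<in> borel_measurable S' \<Longrightarrow> f \<in> borel_measurable (K y)"
proof -
  have *: "K y \<in> space (prob_algebra S')" using measurable_space[OF K y] .
  show "prob_space (K y)" and s: "sets (K y) = sets S'" using * by (auto simp: space_prob_algebra)
  show "space (K y) = space S'" using sets_eq_imp_space_eq[OF s] .
  show "f \<in> borel_measurable S' \<Longrightarrow> f \<in> borel_measurable (K y)"
    using measurable_cong_sets[OF s refl] by auto
qed

lemma kernel_op_measurable:
  fixes f :: "'b \<Rightarrow> real"
  assumes "K \<in> S \<rightarrow>\<^sub>M prob_algebra S" "f \<in> borel_measurable S"
  shows "kernel_op K f \<in> borel_measurable S"
proof -
  note [measurable] = measurable_prob_algebraD[OF assms(1)] assms(2)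
  have "(\<lambda>y. integral\<^sup>L (K y) f) \<in> borel_measurable S"
    by measurable
  then show ?thesis by (simp add: kernel_op_def[abs_def])
qed

lemma kernel_op_bounded:
  assumes "K \<in> S \<rightarrow>\<^sub>M prob_algebra S" "f \<in> borel_measurable S" "\<And>x. x \<in> space S \<Longrightarrow> \<bar>f x\<bar> \<le> C" "y \<in> space S"
  shows "\<bar>kernel_op K f y\<bar> \<le> C"
  unfolding kernel_op_def
  using prob_space.abs_integral_bounded[OF kernel_prob_space[OF assms(1,4)]
      kernel_measurable[OF assms(1,4,2)] assms(3)] kernel_space[OF assms(1,4)] by simp

text \<open>Adding the bound \<open>C\<close> makes \<open>f\<close> nonnegative, so that the rule
  for \<open>nn_integral\<close> and \<open>bind\<close> applies. All measures involved have mass 1,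
  so both sides grow by exactly \<open>C\<close>, which is removed at the end.\<close>

lemma integral_bind_bounded:
  fixes f :: "'c \<Rightarrow> real"
  assumes N: "N \<in> space (prob_algebra S)" and K: "K \<in> S \<rightarrow>\<^sub>M prob_algebra T"
    and f[measurable]: "f \<in> borel_measurable T" and C: "\<And>x. x \<in> space T \<Longrightarrow> \<bar>f x\<bar> \<le> C"
  shows "(\<integral>x. f x \<partial>(N \<bind> K)) = (\<integral>y. (\<integral>z. f z \<partial>K y) \<partial>N)"
proof -
  interpret N: prob_space N using N by (simp add: space_prob_algebra)
  have sN[measurable_cong]: "sets N = sets S" using N by (simp add: space_prob_algebra)
  have sp: "space N = space S" using sets_eq_imp_space_eq[OF sN] .
  interpret NK: prob_space "N \<bind> K" by (rule prob_space_bind'[OF N K])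
  have sNK[measurable_cong]: "sets (N \<bind> K) = sets T" by (rule sets_bind'[OF N K])
  note [measurable] = measurable_prob_algebraD[OF K]
  define g where "g x = f x + C" for x
  have g[measurable]: "g \<in> borel_measurable T" unfolding g_def by measurable
  have g0: "0 \<le> g x" "\<bar>g x\<bar> \<le> 2 * C" if "x \<in> space T" for x using C[OF that] by (auto simp: g_def)
  have spK: "space (K y) = space T" if "y \<in> space N" for y
    using kernel_space[OF K] that by (simp add: sp)
  have spNK: "space (N \<bind> K) = space T" using sets_eq_imp_space_eq[OF sNK] .
  have b: "\<bar>\<integral>z. f z \<partial>K y\<bar> \<le> C" if "y \<in> space N" for y
    using prob_space.abs_integral_bounded[OF kernel_prob_space[OF K] kernel_measurable[OF K _ f] C] that
    by (auto simp: sp kernel_space[OF K])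
  have ig: "integrable (N \<bind> K) g"
    by (rule NK.integrable_bounded[OF _ g0(2)]) (auto simp: spNK)
  have fN: "integrable N (\<lambda>y. \<integral>z. f z \<partial>K y)"
    by (rule N.integrable_const_bound[of _ C]) (use b in auto)
  have fK: "integrable (K y) f" if "y \<in> space N" for y
    using prob_space.integrable_bounded[OF kernel_prob_space[OF K] kernel_measurable[OF K _ f] C] that
    by (auto simp: sp kernel_space[OF K])
  have gK: "(\<integral>z. g z \<partial>K y) = (\<integral>z. f z \<partial>K y) + C" if "y \<in> space N" for y
  proof -
    interpret Ky: prob_space "K y" using kernel_prob_space[OF K] that by (simp add: sp)
    show ?thesis unfolding g_def using fK[OF that] by (simp add: Ky.prob_space)
  qed
  have gK': "(\<integral>\<^sup>+z. ennreal (g z) \<partial>K y) = ennreal (\<integral>z. g z \<partial>K y)" if "y \<in> space N" for y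
  proof (rule nn_integral_eq_integral)
    interpret Ky: prob_space "K y" using kernel_prob_space[OF K] that by (simp add: sp)
    show "integrable (K y) g" unfolding g_def using fK[OF that] by simp
    show "AE z in K y. 0 \<le> g z" by (rule AE_I2) (use g0 spK[OF that] in auto)
  qed
  have gN: "integrable N (\<lambda>y. \<integral>z. g z \<partial>K y)"
    using fN by (subst Bochner_Integration.integrable_cong[OF refl gK]) auto
  have "ennreal (\<integral>x. g x \<partial>(N \<bind> K)) = (\<integral>\<^sup>+x. ennreal (g x) \<partial>(N \<bind> K))"
    by (rule nn_integral_eq_integral[symmetric, OF ig], rule AE_I2) (use g0 spNK in auto)
  also have "\<dots> = (\<integral>\<^sup>+y. (\<integral>\<^sup>+z. ennreal (g z) \<partial>K y) \<partial>N)"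
    by (rule nn_integral_bind[where B=T]) measurable
  also have "\<dots> = (\<integral>\<^sup>+y. ennreal (\<integral>z. g z \<partial>K y) \<partial>N)"
    by (rule nn_integral_cong) (rule gK')
  also have "\<dots> = ennreal (\<integral>y. (\<integral>z. g z \<partial>K y) \<partial>N)"
    by (rule nn_integral_eq_integral[OF gN], rule AE_I2, rule integral_nonneg_AE, rule AE_I2) (use g0 spK in auto)
  finally have "(\<integral>x. g x \<partial>(N \<bind> K)) = (\<integral>y. (\<integral>z. g z \<partial>K y) \<partial>N)"
    by (subst (asm) ennreal_inj) (use g0 spK spNK in \<open>auto intro!: integral_nonneg_AE AE_I2\<close>)
  moreover have "(\<integral>x. g x \<partial>(N \<bind> K)) = (\<integral>x. f x \<partial>(N \<bind> K)) + C"
  proof -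
    have "integrable (N \<bind> K) f" by (rule NK.integrable_bounded[OF _ C]) (auto simp: spNK)
    then show ?thesis unfolding g_def by (simp add: NK.prob_space)
  qed
  moreover have "(\<integral>y. (\<integral>z. g z \<partial>K y) \<partial>N) = (\<integral>y. (\<integral>z. f z \<partial>K y) \<partial>N) + C"
    using fN by (subst Bochner_Integration.integral_cong[OF refl gK]) (auto simp: N.prob_space)
  ultimately show ?thesis by simp
qed

lemma geometric_Cauchy_bound:
  fixes a :: "nat \<Rightarrow> real"
  assumes \<alpha>: "0 < \<alpha>" "\<alpha> < 1" and step: "\<And>n. \<bar>a (Suc n) - a n\<bar> \<le> D * \<alpha> ^ n"
  shows "convergent a" "\<bar>a n - lim a\<bar> \<le> D / (1 - \<alpha>) * \<alpha> ^ n"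
proof -
  have D: "0 \<le> D" using step[of 0] by auto
  \<comment> \<open>The exact partial geometric sum, with its factor
    \<open>1 - \<alpha> ^ k\<close>, is what the induction on \<open>k\<close> reproduces; the
    factor is bounded by 1 afterwards.\<close>
  have close: "\<bar>a (n + k) - a n\<bar> \<le> D / (1 - \<alpha>) * \<alpha> ^ n * (1 - \<alpha> ^ k)" for n k
  proof (induction k)
    case (Suc k)
    have "\<bar>a (n + Suc k) - a n\<bar> \<le> \<bar>a (Suc (n + k)) - a (n + k)\<bar> + \<bar>a (n + k) - a n\<bar>" by simp
    also have "\<dots> \<le> D * \<alpha> ^ (n + k) + D / (1 - \<alpha>) * \<alpha> ^ n * (1 - \<alpha> ^ k)"
      using step[of "n + k"] Suc by linarith
    also have "\<dots> = D / (1 - \<alpha>) * \<alpha> ^ n * (1 - \<alpha> ^ Suc k)"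
      using \<alpha> by (simp add: field_simps power_add)
    finally show ?case .
  qed simp
  have le: "\<bar>a (n + k) - a n\<bar> \<le> D / (1 - \<alpha>) * \<alpha> ^ n" for n k
  proof -
    have "D / (1 - \<alpha>) * \<alpha> ^ n * (1 - \<alpha> ^ k) \<le> D / (1 - \<alpha>) * \<alpha> ^ n * 1"
      using \<alpha> D by (intro mult_left_mono) auto
    then show ?thesis using close[of n k] by linarith
  qed
  have t0: "(\<lambda>n. D / (1 - \<alpha>) * \<alpha> ^ n) \<longlonglongrightarrow> D / (1 - \<alpha>) * 0"
    by (intro tendsto_mult tendsto_const LIMSEQ_power_zero) (use \<alpha> in auto)
  have "Cauchy a"
  proof (rule metric_CauchyI)
    fix e :: real assume "0 < e"
    then obtain N where N: "D / (1 - \<alpha>) * \<alpha> ^ N < e / 2"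
      using order_tendstoD(2)[OF t0, of "e / 2"] by (auto simp: eventually_sequentially)
    have "dist (a m) (a n) < e" if "m \<ge> N" "n \<ge> N" for m n
    proof -
      have "\<bar>a m - a N\<bar> < e / 2" "\<bar>a n - a N\<bar> < e / 2"
        using le[of N "m - N", THEN order.strict_trans1, OF N] le[of N "n - N", THEN order.strict_trans1, OF N] that
        by simp_all
      then show ?thesis unfolding dist_real_def by linarith
    qed
    then show "\<exists>M. \<forall>m\<ge>M. \<forall>n\<ge>M. dist (a m) (a n) < e" by blast
  qed
  then show c: "convergent a" by (simp add: Cauchy_convergent_iff)
  have "(\<lambda>k. \<bar>a (k + n) - a n\<bar>) \<longlonglongrightarrow> \<bar>lim a - a n\<bar>"
    using LIMSEQ_ignore_initial_segment[OF c[unfolded convergent_LIMSEQ_iff], of n]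
    by (intro tendsto_intros)
  then have "\<bar>lim a - a n\<bar> \<le> D / (1 - \<alpha>) * \<alpha> ^ n"
    by (rule LIMSEQ_le_const2) (use le[of n] in \<open>auto simp: add.commute[of _ n]\<close>)
  then show "\<bar>a n - lim a\<bar> \<le> D / (1 - \<alpha>) * \<alpha> ^ n" by (simp add: abs_minus_commute)
qed

text \<open>\<open>G\<close> is a set that the chain almost surely does not leave; drift and
  minorization are required only for starts in \<open>G\<close>. The factor 1/2 in the drift is the
  halving of logarithms. Minorization is assumed on every sublevel set of \<open>V\<close>, so the
  level can be chosen later in terms of \<open>c\<close>; \<epsilon> and \<nu> may depend on that
  level.\<close>

locale harris_kernel =
  fixes S :: "'b measure" and K :: "'b \<Rightarrow> 'b measure" and G :: "'b set" and V :: "'b \<Rightarrow> real"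
    and c :: real
  assumes K: "K \<in> S \<rightarrow>\<^sub>M prob_algebra S"
    and G: "G \<subseteq> space S" "G \<noteq> {}"
    and stays: "y \<in> G \<Longrightarrow> AE z in K y. z \<in> G"
    and V[measurable]: "V \<in> borel_measurable S" and V_nonneg: "0 \<le> V y"
    and c: "0 \<le> c"
    and integrable_V: "y \<in> G \<Longrightarrow> integrable (K y) V"
    and drift: "y \<in> G \<Longrightarrow> (\<integral>z. V z \<partial>K y) \<le> V y / 2 + c"
    and minorization: "\<exists>\<epsilon>>0. \<exists>\<nu>. prob_space \<nu> \<and> sets \<nu> = sets S \<and>
      (\<forall>y\<in>G. V y \<le> R \<longrightarrow> (\<forall>h\<in>borel_measurable S.
        ennreal \<epsilon> * (\<integral>\<^sup>+z. h z \<partial>\<nu>) \<le> (\<integral>\<^sup>+z. h z \<partial>K y)))"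
begin

text \<open>Here \<open>h\<close> is nonnegative only on \<open>G\<close>, and nothing says
  beforehand that \<open>\<nu>\<close> lives on \<open>G\<close>. Minorization applied to the
  indicator of \<open>{z. h z < 0}\<close> shows that \<open>\<nu>\<close> does not charge this set;
  the passage from \<open>nn_integral\<close> to real integrals is then legitimate.\<close>

lemma minorization_integral:
  fixes h :: "'b \<Rightarrow> real"
  assumes \<epsilon>: "0 < \<epsilon>" and sets: "sets \<nu> = sets S" and y: "y \<in> G"
    and minor: "\<forall>h\<in>borel_measurable S. ennreal \<epsilon> * (\<integral>\<^sup>+z. h z \<partial>\<nu>) \<le> (\<integral>\<^sup>+z. h z \<partial>K y)"
    and h[measurable]: "h \<in> borel_measurable S" and nonneg: "\<And>z. z \<in> G \<Longrightarrow> 0 \<le> h z"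
    and int: "integrable (K y) h"
  shows "integrable \<nu> h" "\<epsilon> * (\<integral>z. h z \<partial>\<nu>) \<le> (\<integral>z. h z \<partial>K y)" 
proof -
  note [measurable_cong] = sets
  have y': "y \<in> space S" using y G by auto
  note [measurable_cong] = kernel_sets[OF K y']
  have AK: "AE z in K y. 0 \<le> h z" using stays[OF y] by eventually_elim (rule nonneg)
  have "(\<integral>\<^sup>+z. indicator {z. h z < 0} z \<partial>K y) = (\<integral>\<^sup>+z. 0 \<partial>K y)"
    using AK by (intro nn_integral_cong_AE) (auto simp: indicator_def)
  moreover have "(\<lambda>z. indicator {z. h z < 0} z :: ennreal) \<in> borel_measurable S" by measurable
  ultimately have "ennreal \<epsilon> * (\<integral>\<^sup>+z. indicator {z. h z < 0} z \<partial>\<nu>) = 0"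
    using minor by fastforce
  then have "(\<integral>\<^sup>+z. indicator {z. h z < 0} z \<partial>\<nu>) = 0" using \<epsilon> by simp
  then have "AE z in \<nu>. indicator {z. h z < 0} z = (0::ennreal)"
    by (subst (asm) nn_integral_0_iff_AE) auto
  then have A\<nu>: "AE z in \<nu>. 0 \<le> h z"
    by eventually_elim (auto simp: indicator_def not_less split: if_splits)
  have "ennreal \<epsilon> * (\<integral>\<^sup>+z. ennreal (h z) \<partial>\<nu>) \<le> (\<integral>\<^sup>+z. ennreal (h z) \<partial>K y)"
    using minor by simp
  also have K1: "(\<integral>\<^sup>+z. ennreal (h z) \<partial>K y) = ennreal (\<integral>z. h z \<partial>K y)"
    by (rule nn_integral_eq_integral[OF int AK])
  finally have *: "ennreal \<epsilon> * (\<integral>\<^sup>+z. ennreal (h z) \<partial>\<nu>) \<le> ennreal (\<integral>z. h z \<partial>K y)" .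
  then have "(\<integral>\<^sup>+z. ennreal (h z) \<partial>\<nu>) < \<infinity>"
    using \<epsilon> by (cases "(\<integral>\<^sup>+z. ennreal (h z) \<partial>\<nu>) = \<infinity>")
      (auto simp: ennreal_mult_eq_top_iff less_top top_unique)
  then show i: "integrable \<nu> h"
    using A\<nu> by (intro integrableI_nonneg) auto
  have "ennreal \<epsilon> * ennreal (\<integral>z. h z \<partial>\<nu>) \<le> ennreal (\<integral>z. h z \<partial>K y)"
    using * nn_integral_eq_integral[OF i A\<nu>] by simp
  then show "\<epsilon> * (\<integral>z. h z \<partial>\<nu>) \<le> (\<integral>z. h z \<partial>K y)"
    using \<epsilon> AK A\<nu> by (simp add: ennreal_mult[symmetric] integral_nonneg_AE)
qed

section \<open>A weighted oscillation seminorm and its contraction\<close>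

definition weight :: "real \<Rightarrow> 'b \<Rightarrow> real" where
  "weight \<beta> y = 1 + \<beta> * V y"

lemma weight_measurable[measurable]: "weight \<beta> \<in> borel_measurable S"
  unfolding weight_def[abs_def] by measurable

lemma weight_ge_1: "0 \<le> \<beta> \<Longrightarrow> 1 \<le> weight \<beta> y"
  using V_nonneg[of y] by (simp add: weight_def)

lemma weight_integral:
  assumes y: "y \<in> G" and \<beta>: "0 \<le> \<beta>"
  shows "integrable (K y) (weight \<beta>)"
    "(\<integral>z. weight \<beta> z \<partial>K y) \<le> 1 + \<beta> * (V y / 2 + c)"
proof -
  interpret prob_space "K y" using kernel_prob_space[OF K] y G by auto
  show "integrable (K y) (weight \<beta>)"
    unfolding weight_def[abs_def] using integrable_V[OF y] by simp
  show "(\<integral>z. weight \<beta> z \<partial>K y) \<le> 1 + \<beta> * (V y / 2 + c)"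
    unfolding weight_def using integrable_V[OF y] drift[OF y] \<beta>
    by (simp add: prob_space mult_left_mono)
qed

text \<open>The hypothesis says that every value of \<open>f - w\<close> lies below every value of
  \<open>f + w\<close>, so a constant fits in between; the supremum of \<open>f - w\<close> is one.
  Thus an oscillation bound becomes a weighted sup-norm bound for \<open>f - a\<close>.\<close>

lemma centering:
  fixes f :: "'b \<Rightarrow> real"
  assumes f: "\<And>x y. x \<in> G \<Longrightarrow> y \<in> G \<Longrightarrow> f x - f y \<le> w x + w y"
  obtains a where "\<And>x. x \<in> G \<Longrightarrow> f x - a \<le> w x" "\<And>x. x \<in> G \<Longrightarrow> a - f x \<le> w x"
proof -
  define a where "a = (SUP x\<in>G. f x - w x)"
  obtain y0 where "y0 \<in> G" using G by auto
  then have bdd: "bdd_above ((\<lambda>x. f x - w x) ` G)"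
    by (intro bdd_aboveI2[where M="f y0 + w y0"]) (use f in force)
  have 1: "f x - a \<le> w x" if "x \<in> G" for x
    using cSUP_upper[OF that bdd] by (simp add: a_def)
  have 2: "a - f y \<le> w y" if "y \<in> G" for y
  proof -
    have "a \<le> f y + w y" unfolding a_def
      by (rule cSUP_least) (use G f[OF _ that] in \<open>auto simp: algebra_simps\<close>)
    then show ?thesis by simp
  qed
  show ?thesis using that 1 2 by blast
qed

text \<open>The seminorm of Hairer and Mattingly: \<open>f x - f y\<close> is measured against the sum of two
  weights.  Far out, the drift condition alone makes it contract; in the region where \<open>V\<close> is small,
  the common part \<open>\<epsilon> \<nu>\<close> of the two transition laws cancels.\<close>

lemma contraction:
  obtains \<beta> \<alpha> where "0 < \<beta>" "0 < \<alpha>" "\<alpha> < 1"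
    "\<And>f C L x y. f \<in> borel_measurable S \<Longrightarrow> (\<And>z. z \<in> space S \<Longrightarrow> \<bar>f z\<bar> \<le> C) \<Longrightarrow> 0 \<le> L \<Longrightarrow>
      (\<And>x y. x \<in> G \<Longrightarrow> y \<in> G \<Longrightarrow> f x - f y \<le> L * (weight \<beta> x + weight \<beta> y)) \<Longrightarrow>
      x \<in> G \<Longrightarrow> y \<in> G \<Longrightarrow>
      kernel_op K f x - kernel_op K f y \<le> \<alpha> * L * (weight \<beta> x + weight \<beta> y)"
proof -
  \<comment> \<open>For two points with energies summing to \<open>s \<ge> R\<close>, the drift
    constant \<open>2 * c\<close> is at most \<open>s / 4\<close>, so that the mean energy after one
    step is at most \<open>3 / 4 * s\<close>. The summand 1 keeps \<open>R\<close> positive for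
    \<open>c = 0\<close>.\<close>
  define R where "R = 8 * c + 1"
  obtain \<epsilon> \<nu> where \<epsilon>0: "0 < \<epsilon>" and \<nu>: "prob_space \<nu>" "sets \<nu> = sets S"
    and minor: "\<And>y. y \<in> G \<Longrightarrow> V y \<le> R \<Longrightarrow> \<forall>h\<in>borel_measurable S.
      ennreal \<epsilon> * (\<integral>\<^sup>+z. h z \<partial>\<nu>) \<le> (\<integral>\<^sup>+z. h z \<partial>K y)"
    using minorization[of R] by blast
  interpret \<nu>: prob_space \<nu> by fact
  define \<epsilon>' where "\<epsilon>' = min \<epsilon> 1"
  have \<epsilon>: "0 < \<epsilon>'" "\<epsilon>' \<le> 1" "\<epsilon>' \<le> \<epsilon>" using \<epsilon>0 by (auto simp: \<epsilon>'_def)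
  \<comment> \<open>The weight of the energy is so small that the drift costs at most
    \<open>\<beta> * (2 * c) \<le> \<epsilon>'\<close>, half of the gain
    \<open>2 * \<epsilon>'\<close> that the common part brings.\<close>
  define \<beta> where "\<beta> = \<epsilon>' / (2 * c + 1)"
  have \<beta>: "0 < \<beta>" "\<beta> * (2 * c) \<le> \<epsilon>'"
    using \<epsilon> c by (auto simp: \<beta>_def field_simps)
  \<comment> \<open>The quotient \<open>(2 + 3 / 4 * \<beta> * s) / (2 + \<beta> * s)\<close>
    decreases in \<open>s\<close>; its value at \<open>s = R\<close> is the contraction factor far
    out.\<close>
  define \<alpha>1 where "\<alpha>1 = (2 + 3 / 4 * \<beta> * R) / (2 + \<beta> * R)"
  define \<alpha> where "\<alpha> = max \<alpha>1 (1 - \<epsilon>' / 2)"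
  have R: "0 < R" "8 * c \<le> R" using c by (auto simp: R_def)
  have bR: "0 < \<beta> * R" using \<beta> R by (intro mult_pos_pos) auto
  have \<alpha>1: "\<alpha>1 < 1" unfolding \<alpha>1_def using bR by (subst divide_less_eq_1_pos) (auto simp: mult.commute)
  have \<alpha>: "0 < \<alpha>" "\<alpha> < 1" using \<alpha>1 \<epsilon> unfolding \<alpha>_def by linarith+
  have far: "2 + \<beta> * (s / 2 + 2 * c) \<le> \<alpha> * (2 + \<beta> * s)" if s: "R \<le> s" for s
  proof -
    have bs: "\<beta> * R \<le> \<beta> * s" using s \<beta> by simp
    have "\<beta> * (s / 2 + 2 * c) \<le> \<beta> * (3 / 4 * s)"
      using s R \<beta> by (intro mult_left_mono) auto
    then have "2 + \<beta> * (s / 2 + 2 * c) \<le> 2 + 3 / 4 * (\<beta> * s)" by simp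
    also have "\<dots> \<le> \<alpha>1 * (2 + \<beta> * s)"
    proof -
      have "(2 + 3 / 4 * (\<beta> * s)) * (2 + \<beta> * R) \<le> (2 + 3 / 4 * \<beta> * R) * (2 + \<beta> * s)"
      proof -
        have "(2 + 3 / 4 * u) * (2 + r) \<le> (2 + 3 / 4 * r) * (2 + u)" if "r \<le> u" for u r :: real
          using that by (simp add: algebra_simps add_divide_distrib)
        from this[OF bs] show ?thesis by (simp add: mult.assoc)
      qed
      then show ?thesis
        unfolding \<alpha>1_def using bR by (subst times_divide_eq_left, subst pos_le_divide_eq) (auto simp: mult.commute)
    qed
    also have "\<dots> \<le> \<alpha> * (2 + \<beta> * s)"
      using bs bR by (intro mult_right_mono) (auto simp: \<alpha>_def)
    finally show ?thesis .
  qed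
  have near: "2 - 2 * \<epsilon>' + \<beta> * (s / 2 + 2 * c) \<le> \<alpha> * (2 + \<beta> * s)" if s: "0 \<le> s" for s
  proof -
    have bs: "0 \<le> \<beta> * s" using s \<beta> by simp
    have "\<beta> * s * (1 / 2) \<le> \<beta> * s * (1 - \<epsilon>' / 2)"
      using bs \<epsilon> by (intro mult_left_mono) auto
    then have "2 - 2 * \<epsilon>' + \<beta> * (s / 2 + 2 * c) \<le> (1 - \<epsilon>' / 2) * (2 + \<beta> * s)"
      using \<beta> by (simp add: algebra_simps)
    also have "\<dots> \<le> \<alpha> * (2 + \<beta> * s)"
      using bs by (intro mult_right_mono) (auto simp: \<alpha>_def)
    finally show ?thesis .
  qed
  show ?thesis
  proof (rule that[OF \<beta>(1) \<alpha>])
    fix f :: "'b \<Rightarrow> real" and C L x y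
    assume f[measurable]: "f \<in> borel_measurable S" and C: "\<And>z. z \<in> space S \<Longrightarrow> \<bar>f z\<bar> \<le> C"
      and L: "0 \<le> L" and x: "x \<in> G" and y: "y \<in> G"
      and osc: "\<And>x y. x \<in> G \<Longrightarrow> y \<in> G \<Longrightarrow> f x - f y \<le> L * (weight \<beta> x + weight \<beta> y)"
    obtain a where a: "\<And>x. x \<in> G \<Longrightarrow> f x - a \<le> L * weight \<beta> x" "\<And>x. x \<in> G \<Longrightarrow> a - f x \<le> L * weight \<beta> x"
      by (rule centering[of f "\<lambda>x. L * weight \<beta> x"]) (use osc in \<open>auto simp: algebra_simps\<close>)
    have K': "prob_space (K z)" "integrable (K z) f" "integrable (K z) (weight \<beta>)"
      "(\<integral>u. (L * weight \<beta> u - (f u - a)) \<partial>K z) = L * (\<integral>u. weight \<beta> u \<partial>K z) - (kernel_op K f z - a)"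
      "(\<integral>u. (L * weight \<beta> u + (f u - a)) \<partial>K z) = L * (\<integral>u. weight \<beta> u \<partial>K z) + (kernel_op K f z - a)"
      if z: "z \<in> G" for z
    proof -
      have z': "z \<in> space S" using z G by auto
      show "prob_space (K z)" by (rule kernel_prob_space[OF K z'])
      then interpret Kz: prob_space "K z" .
      show i: "integrable (K z) f"
        by (rule Kz.integrable_const_bound[of _ C])
          (use C kernel_space[OF K z'] kernel_measurable[OF K z' f] in auto)
      show i': "integrable (K z) (weight \<beta>)" using weight_integral(1)[OF z] \<beta> by simp
      show "(\<integral>u. (L * weight \<beta> u - (f u - a)) \<partial>K z) = L * (\<integral>u. weight \<beta> u \<partial>K z) - (kernel_op K f z - a)"
        "(\<integral>u. (L * weight \<beta> u + (f u - a)) \<partial>K z) = L * (\<integral>u. weight \<beta> u \<partial>K z) + (kernel_op K f z - a)"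
        using i i' by (simp_all add: kernel_op_def Kz.prob_space)
    qed
    let ?s = "V x + V y"
    let ?w = "\<lambda>z. \<integral>u. weight \<beta> u \<partial>K z"
    have w: "?w x + ?w y \<le> 2 + \<beta> * (?s / 2 + 2 * c)"
      using weight_integral(2)[OF x, of \<beta>] weight_integral(2)[OF y, of \<beta>] \<beta>
      by (simp add: algebra_simps add_divide_distrib)
    have "kernel_op K f x - kernel_op K f y \<le> L * (\<alpha> * (2 + \<beta> * ?s))"
    proof (cases "R \<le> ?s")
      case True
      have "0 \<le> (\<integral>u. (L * weight \<beta> u - (f u - a)) \<partial>K x)"
        by (rule integral_nonneg_AE) (use stays[OF x] a in \<open>auto elim!: eventually_mono\<close>)
      moreover have "0 \<le> (\<integral>u. (L * weight \<beta> u + (f u - a)) \<partial>K y)"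
        by (rule integral_nonneg_AE) (use stays[OF y] a in \<open>auto elim!: eventually_mono simp: algebra_simps\<close>)
      ultimately have "kernel_op K f x - kernel_op K f y \<le> L * (?w x + ?w y)"
        using K'(5)[OF y] K'(4)[OF x] by (simp add: algebra_simps)
      also have "\<dots> \<le> L * (\<alpha> * (2 + \<beta> * ?s))"
        using w far[OF True] L by (intro mult_left_mono) auto
      finally show ?thesis .
    next
      case False
      then have V: "V x \<le> R" "V y \<le> R" using V_nonneg[of x] V_nonneg[of y] by auto
      \<comment> \<open>In the sum of the two functions the constant \<open>a\<close> cancels and
        \<open>2 * L * weight \<beta> \<ge> 2 * L\<close> remains. Integrated against the measure
        \<open>\<nu>\<close> that both starts share, this saves at least
        \<open>2 * \<epsilon>' * L\<close>.\<close>
      let ?h1 = "\<lambda>u. L * weight \<beta> u - (f u - a)" and ?h2 = "\<lambda>u. L * weight \<beta> u + (f u - a)"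
      have h: "?h1 \<in> borel_measurable S" "?h2 \<in> borel_measurable S" by measurable
      have i: "integrable (K x) ?h1" "integrable (K y) ?h2"
        using K'(1-3)[OF x] K'(1-3)[OF y] by (simp_all add: prob_space_def finite_measure.integrable_const)
      have p: "0 \<le> ?h1 z" "0 \<le> ?h2 z" if "z \<in> G" for z using a[OF that] by (auto simp: algebra_simps)
      have m1: "integrable \<nu> ?h1" "\<epsilon> * (\<integral>u. ?h1 u \<partial>\<nu>) \<le> (\<integral>u. ?h1 u \<partial>K x)"
        by (rule minorization_integral[OF \<epsilon>0 \<nu>(2) x minor[OF x V(1)] h(1) _ i(1)], erule p)+
      have m2: "integrable \<nu> ?h2" "\<epsilon> * (\<integral>u. ?h2 u \<partial>\<nu>) \<le> (\<integral>u. ?h2 u \<partial>K y)"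
        by (rule minorization_integral[OF \<epsilon>0 \<nu>(2) y minor[OF y V(2)] h(2) _ i(2)], erule p)+
      have "integrable \<nu> (\<lambda>u. ?h1 u + ?h2 u)"
        using m1(1) m2(1) by (rule Bochner_Integration.integrable_add)
      then have iw: "integrable \<nu> (\<lambda>u. 2 * (L * weight \<beta> u))" by simp
      have "2 * L \<le> (\<integral>u. 2 * (L * weight \<beta> u) \<partial>\<nu>)"
      proof -
        have "(\<integral>u. 2 * (L * 1) \<partial>\<nu>) \<le> (\<integral>u. 2 * (L * weight \<beta> u) \<partial>\<nu>)"
          using iw weight_ge_1[of \<beta>] \<beta> L by (intro integral_mono mult_left_mono) auto
        then show ?thesis by (simp add: \<nu>.prob_space)
      qed
      also have "\<dots> = (\<integral>u. ?h1 u \<partial>\<nu>) + (\<integral>u. ?h2 u \<partial>\<nu>)"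
        by (subst Bochner_Integration.integral_add[OF m1(1) m2(1), symmetric])
            (rule Bochner_Integration.integral_cong, simp_all)
      finally have "\<epsilon>' * (2 * L) \<le> \<epsilon> * ((\<integral>u. ?h1 u \<partial>\<nu>) + (\<integral>u. ?h2 u \<partial>\<nu>))"
        using \<epsilon> L \<epsilon>0 by (intro mult_mono) auto
      also have "\<dots> \<le> (\<integral>u. ?h1 u \<partial>K x) + (\<integral>u. ?h2 u \<partial>K y)"
        using m1(2) m2(2) by (simp add: distrib_left)
      finally have "kernel_op K f x - kernel_op K f y \<le> L * (?w x + ?w y - 2 * \<epsilon>')"
        using K'(5)[OF y] K'(4)[OF x] by (simp add: algebra_simps)
      also have "\<dots> \<le> L * (\<alpha> * (2 + \<beta> * ?s))"
        using w near[of ?s] V_nonneg[of x] V_nonneg[of y] L by (intro mult_left_mono) auto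
      finally show ?thesis .
    qed
    then show "kernel_op K f x - kernel_op K f y \<le> \<alpha> * L * (weight \<beta> x + weight \<beta> y)"
      by (simp add: weight_def algebra_simps)
  qed
qed

lemma iterates_bounded:
  assumes f: "f \<in> borel_measurable S" "\<And>z. z \<in> space S \<Longrightarrow> \<bar>f z\<bar> \<le> C"
  shows "(kernel_op K ^^ n) f \<in> borel_measurable S"
    and "z \<in> space S \<Longrightarrow> \<bar>(kernel_op K ^^ n) f z\<bar> \<le> C"
proof -
  have "(kernel_op K ^^ n) f \<in> borel_measurable S \<and> (\<forall>z\<in>space S. \<bar>(kernel_op K ^^ n) f z\<bar> \<le> C)"
  proof (induction n)
    case (Suc n)
    then show ?case
      using kernel_op_measurable[OF K] kernel_op_bounded[OF K] by simp
  qed (use f in auto)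
  then show "(kernel_op K ^^ n) f \<in> borel_measurable S"
    and "z \<in> space S \<Longrightarrow> \<bar>(kernel_op K ^^ n) f z\<bar> \<le> C" by auto
qed

text \<open>The uniformity in \<open>f\<close> is what makes the limit of the laws countably additive.\<close>

lemma geometric_ergodicity:
  obtains \<alpha> D where "0 < \<alpha>" "\<alpha> < 1"
    "\<And>f n x. f \<in> borel_measurable S \<Longrightarrow> (\<And>z. z \<in> space S \<Longrightarrow> \<bar>f z\<bar> \<le> 1) \<Longrightarrow> x \<in> G \<Longrightarrow>
      \<bar>(kernel_op K ^^ Suc n) f x - (kernel_op K ^^ n) f x\<bar> \<le> D x * \<alpha> ^ n"
    "\<And>f n x y. f \<in> borel_measurable S \<Longrightarrow> (\<And>z. z \<in> space S \<Longrightarrow> \<bar>f z\<bar> \<le> 1) \<Longrightarrow> x \<in> G \<Longrightarrow> y \<in> G \<Longrightarrow>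
      (kernel_op K ^^ n) f x - (kernel_op K ^^ n) f y \<le> (D x + D y) * \<alpha> ^ n"
proof (rule contraction)
  fix \<beta> \<alpha> :: real
  assume \<beta>: "0 < \<beta>" and \<alpha>: "0 < \<alpha>" "\<alpha> < 1"
    and contr: "\<And>f C L x y. f \<in> borel_measurable S \<Longrightarrow> (\<And>z. z \<in> space S \<Longrightarrow> \<bar>f z\<bar> \<le> C) \<Longrightarrow> 0 \<le> L \<Longrightarrow>
      (\<And>x y. x \<in> G \<Longrightarrow> y \<in> G \<Longrightarrow> f x - f y \<le> L * (weight \<beta> x + weight \<beta> y)) \<Longrightarrow>
      x \<in> G \<Longrightarrow> y \<in> G \<Longrightarrow>
      kernel_op K f x - kernel_op K f y \<le> \<alpha> * L * (weight \<beta> x + weight \<beta> y)"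
  \<comment> \<open>The weight at \<open>x\<close> plus the drift bound for the mean weight after
    one step from \<open>x\<close>. This controls the change from \<open>n\<close> to
    \<open>Suc n\<close>, and since it dominates the weight it also serves in the comparison of two
    starts.\<close>
  define D where "D x = weight \<beta> x + (1 + \<beta> * (V x / 2 + c))" for x
  have DG: "weight \<beta> x \<le> D x" for x
    using \<beta> c V_nonneg[of x] by (simp add: D_def)
  have osc: "(kernel_op K ^^ n) f x - (kernel_op K ^^ n) f y \<le> \<alpha> ^ n * (weight \<beta> x + weight \<beta> y)"
    if f: "f \<in> borel_measurable S" "\<And>z. z \<in> space S \<Longrightarrow> \<bar>f z\<bar> \<le> 1" and xy: "x \<in> G" "y \<in> G" for f n x y
    using xy
  proof (induction n arbitrary: x y)
    case 0
    \<comment> \<open>Both weights are at least 1, so a function bounded by 1 starts with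
      \<open>L = 1\<close>.\<close>
    have "f x - f y \<le> 1 + 1"
      using f(2)[of x] f(2)[of y] 0 G(1) by force
    also have "\<dots> \<le> weight \<beta> x + weight \<beta> y"
      using weight_ge_1[of \<beta>] \<beta> by (intro add_mono) auto
    finally show ?case by simp
  next
    case (Suc n)
    show ?case
      using contr[OF iterates_bounded[where n=n, OF f] _ Suc.IH Suc.prems] \<alpha> by simp
  qed
  show ?thesis
  proof (rule that[OF \<alpha>])
    fix f :: "'b \<Rightarrow> real" and n x y
    assume f: "f \<in> borel_measurable S" "\<And>z. z \<in> space S \<Longrightarrow> \<bar>f z\<bar> \<le> 1" and x: "x \<in> G"
    show "(kernel_op K ^^ n) f x - (kernel_op K ^^ n) f y \<le> (D x + D y) * \<alpha> ^ n" if y: "y \<in> G"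
    proof -
      have "(weight \<beta> x + weight \<beta> y) * \<alpha> ^ n \<le> (D x + D y) * \<alpha> ^ n"
        using DG[of x] DG[of y] \<alpha> by (intro mult_right_mono add_mono) auto
      then show ?thesis using osc[OF f x y, of n] by (simp add: mult.commute)
    qed
    define g where "g = (kernel_op K ^^ n) f"
    have x': "x \<in> space S" using x G by auto
    interpret Kx: prob_space "K x" by (rule kernel_prob_space[OF K x'])
    have g: "integrable (K x) g"
    proof (rule Kx.integrable_bounded)
      show "g \<in> borel_measurable (K x)"
        unfolding g_def using f by (intro kernel_measurable[OF K x'] iterates_bounded(1))
      show "\<bar>g z\<bar> \<le> 1" if "z \<in> space (K x)" for z
        unfolding g_def using f that by (intro iterates_bounded(2)) (auto simp: kernel_space[OF K x'])
    qed
    \<comment> \<open>One further step averages \<open>g\<close> over the first transition from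
      \<open>x\<close>; the change is thus a mean of oscillations between \<open>x\<close> and the
      point reached.\<close>
    have "kernel_op K g x - g x = (\<integral>z. g z - g x \<partial>K x)"
      unfolding kernel_op_def using g
      by (subst Bochner_Integration.integral_diff) (auto simp: Kx.prob_space)
    also have "\<bar>\<dots>\<bar> \<le> (\<integral>z. \<bar>g z - g x\<bar> \<partial>K x)" by (rule integral_abs_bound)
    also have "\<dots> \<le> (\<integral>z. \<alpha> ^ n * (weight \<beta> z + weight \<beta> x) \<partial>K x)"
    proof (rule integral_mono_AE)
      show "AE z in K x. \<bar>g z - g x\<bar> \<le> \<alpha> ^ n * (weight \<beta> z + weight \<beta> x)"
        using stays[OF x]
      proof eventually_elim
        case (elim z)
        then show ?case using osc[OF f x elim, of n] osc[OF f elim x, of n]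
          unfolding g_def by (simp add: add.commute abs_le_iff)
      qed
    qed (use g weight_integral(1)[OF x] \<beta> in auto)
    also have "\<dots> = \<alpha> ^ n * ((\<integral>z. weight \<beta> z \<partial>K x) + weight \<beta> x)"
      using weight_integral(1)[OF x] \<beta> by (simp add: Kx.prob_space)
    also have "\<dots> \<le> \<alpha> ^ n * D x"
      using weight_integral(2)[OF x] \<beta> \<alpha> by (intro mult_left_mono) (auto simp: D_def)
    finally show "\<bar>(kernel_op K ^^ Suc n) f x - g x\<bar> \<le> D x * \<alpha> ^ n"
      by (simp add: mult.commute g_def)
  qed
qed

section \<open>Laws of the chain and their limit\<close>

primrec chain_law :: "'b \<Rightarrow> nat \<Rightarrow> 'b measure" where
  "chain_law x 0 = return S x"
| "chain_law x (Suc n) = chain_law x n \<bind> K"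

lemma chain_law_space: "x \<in> space S \<Longrightarrow> chain_law x n \<in> space (prob_algebra S)"
proof (induction n)
  case 0
  then show ?case by (simp add: space_prob_algebra prob_space_return)
next
  case (Suc n)
  then show ?case
    using prob_space_bind'[OF _ K] sets_bind'[OF _ K] by (simp add: space_prob_algebra)
qed

lemma integral_chain_law:
  assumes x: "x \<in> space S" and f: "f \<in> borel_measurable S" "\<And>z. z \<in> space S \<Longrightarrow> \<bar>f z\<bar> \<le> C"
  shows "(\<integral>z. f z \<partial>chain_law x n) = (kernel_op K ^^ n) f x"
  using f
proof (induction n arbitrary: f)
  case 0
  then show ?case using x by (simp add: integral_return)
next
  case (Suc n)
  have "(\<integral>z. f z \<partial>chain_law x (Suc n)) = (\<integral>z. kernel_op K f z \<partial>chain_law x n)"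
    unfolding chain_law.simps kernel_op_def[abs_def]
    using Suc.prems by (rule integral_bind_bounded[OF chain_law_space[OF x] K])
  also have "\<dots> = (kernel_op K ^^ n) (kernel_op K f) x"
    by (rule Suc.IH) (use kernel_op_measurable[OF K Suc.prems(1)] kernel_op_bounded[OF K Suc.prems] in auto)
  finally show ?case by (simp add: funpow_Suc_right del: funpow.simps)
qed

text \<open>From one fixed start the laws are Cauchy uniformly over all measurable sets, so their
  limits \<open>P A\<close> form a measure. Integrals of bounded functions follow by rounding to
  finitely many values, and other starts by the oscillation bound, which tends to 0.\<close>

theorem limit_law_exists:
  obtains \<mu> where "prob_space \<mu>" "sets \<mu> = sets S"
    "\<And>f C x. f \<in> borel_measurable S \<Longrightarrow> (\<And>z. z \<in> space S \<Longrightarrow> \<bar>f z\<bar> \<le> C) \<Longrightarrow> x \<in> G \<Longrightarrow>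
      (\<lambda>n. (kernel_op K ^^ n) f x) \<longlonglongrightarrow> (\<integral>z. f z \<partial>\<mu>)"
proof (rule geometric_ergodicity)
  fix \<alpha> D
  assume \<alpha>: "0 < \<alpha>" "\<alpha> < 1"
    and step: "\<And>f n x. f \<in> borel_measurable S \<Longrightarrow> (\<And>z. z \<in> space S \<Longrightarrow> \<bar>f z\<bar> \<le> 1) \<Longrightarrow> x \<in> G \<Longrightarrow>
      \<bar>(kernel_op K ^^ Suc n) f x - (kernel_op K ^^ n) f x\<bar> \<le> D x * \<alpha> ^ n"
    and osc: "\<And>f n x y. f \<in> borel_measurable S \<Longrightarrow> (\<And>z. z \<in> space S \<Longrightarrow> \<bar>f z\<bar> \<le> 1) \<Longrightarrow> x \<in> G \<Longrightarrow> y \<in> G \<Longrightarrow>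
      (kernel_op K ^^ n) f x - (kernel_op K ^^ n) f y \<le> (D x + D y) * \<alpha> ^ n"
  obtain x0 where x0: "x0 \<in> G" using G by auto
  then have x0S: "x0 \<in> space S" using G by auto
  define m where "m = chain_law x0"
  have mp: "prob_space (m n)" and ms: "sets (m n) = sets S" for n
    using chain_law_space[OF x0S, of n] by (auto simp: m_def space_prob_algebra)
  have msp: "space (m n) = space S" for n using sets_eq_imp_space_eq[OF ms] .
  define L where "L f = lim (\<lambda>n. \<integral>z. f z \<partial>m n)" for f :: "'b \<Rightarrow> real"
  define E where "E = D x0 / (1 - \<alpha>)"
  have unif: "convergent (\<lambda>n. \<integral>z. f z \<partial>m n)" "\<bar>(\<integral>z. f z \<partial>m n) - L f\<bar> \<le> E * \<alpha> ^ n"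
    if f: "f \<in> borel_measurable S" "\<And>z. z \<in> space S \<Longrightarrow> \<bar>f z\<bar> \<le> 1" for f n
  proof -
    have eq: "(kernel_op K ^^ n) f x0 = (\<integral>z. f z \<partial>m n)" for n
      unfolding m_def by (rule integral_chain_law[OF x0S f, symmetric])
    have "\<bar>(\<integral>z. f z \<partial>m (Suc n)) - (\<integral>z. f z \<partial>m n)\<bar> \<le> D x0 * \<alpha> ^ n" for n
      using step[OF f x0, of n] by (simp only: eq)
    note * = geometric_Cauchy_bound[OF \<alpha> this]
    show "convergent (\<lambda>n. \<integral>z. f z \<partial>m n)" "\<bar>(\<integral>z. f z \<partial>m n) - L f\<bar> \<le> E * \<alpha> ^ n"
      using * by (simp_all only: L_def E_def)
  qed
  define P where "P A = L (indicator A)" for A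
  have lim: "(\<lambda>n. measure (m n) A) \<longlonglongrightarrow> P A" and P: "\<bar>measure (m n) A - P A\<bar> \<le> E * \<alpha> ^ n"
    if "A \<in> sets S" for A n
  proof -
    have i: "(\<lambda>z. indicator A z :: real) \<in> borel_measurable S" "\<And>z. \<bar>indicator A z :: real\<bar> \<le> 1"
      using that by auto
    have e: "(\<integral>z. indicator A z \<partial>m n) = measure (m n) A" for n
      using sets.sets_into_space[OF that] by (simp add: msp Int_absorb2)
    show "(\<lambda>n. measure (m n) A) \<longlonglongrightarrow> P A"
      using unif(1)[OF i] unfolding convergent_LIMSEQ_iff P_def L_def e .
    show "\<bar>measure (m n) A - P A\<bar> \<le> E * \<alpha> ^ n"
      using unif(2)[OF i, of n] unfolding P_def e .
  qed
  have P0: "0 \<le> P A" if "A \<in> sets S" for A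
    by (rule LIMSEQ_le_const[OF lim[OF that]]) auto
  have "(\<lambda>n. E * \<alpha> ^ n) \<longlonglongrightarrow> E * 0"
    by (intro tendsto_mult tendsto_const LIMSEQ_power_zero) (use \<alpha> in auto)
  then have E_lim: "(\<lambda>n. E * \<alpha> ^ n) \<longlonglongrightarrow> 0" by simp
  have E0: "\<exists>n. E * \<alpha> ^ n < e" if "0 < e" for e
    using order_tendstoD(2)[OF E_lim that] by (auto simp: eventually_sequentially)
  define \<mu> where "\<mu> = measure_of (space S) (sets S) (\<lambda>A. ennreal (P A))"
  have sets[simp]: "sets \<mu> = sets S" and space[simp]: "space \<mu> = space S"
    by (simp_all add: \<mu>_def sets.space_closed)
  have Pempty: "P {} = 0" using lim[of "{}"] by (simp add: LIMSEQ_const_iff)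
  have pos: "positive (sets S) (\<lambda>A. ennreal (P A))"
    by (simp add: positive_def Pempty)
  have Padd: "P (A \<union> B) = P A + P B" if "A \<in> sets S" "B \<in> sets S" "A \<inter> B = {}" for A B
  proof (rule LIMSEQ_unique)
    show "(\<lambda>n. measure (m n) (A \<union> B)) \<longlonglongrightarrow> P (A \<union> B)" using that by (intro lim) auto
    have "measure (m n) (A \<union> B) = measure (m n) A + measure (m n) B" for n
    proof -
      interpret mn: prob_space "m n" by (rule mp)
      show ?thesis using that by (intro mn.finite_measure_Union) (auto simp: ms)
    qed
    then show "(\<lambda>n. measure (m n) (A \<union> B)) \<longlonglongrightarrow> P A + P B"
      using tendsto_add[OF lim lim] that by simp
  qed
  have add: "additive (sets S) (\<lambda>A. ennreal (P A))"
    using Padd P0 by (auto simp: additive_def ennreal_plus[symmetric] simp del: ennreal_plus)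
  have ca: "countably_additive (sets S) (\<lambda>A. ennreal (P A))"
  proof (rule sets.empty_continuous_imp_countably_additive[OF pos add])
    fix A :: "nat \<Rightarrow> 'b set"
    assume A: "range A \<subseteq> sets S" "decseq A" "(\<Inter>i. A i) = {}"
    have "(\<lambda>i. P (A i)) \<longlonglongrightarrow> 0"
    proof (rule LIMSEQ_I)
      fix e :: real assume "0 < e"
      \<comment> \<open>The error between \<open>measure (m n)\<close> and \<open>P\<close> is below
        \<open>e / 2\<close> for all sets \<open>A i\<close> at once; continuity from above is then
        needed only for the single measure \<open>m n\<close>.\<close>
      then obtain n where n: "E * \<alpha> ^ n < e / 2" using E0[of "e / 2"] by auto
      interpret mn: prob_space "m n" by (rule mp)
      have "(\<lambda>i. measure (m n) (A i)) \<longlonglongrightarrow> measure (m n) (\<Inter>i. A i)"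
        using A by (intro mn.finite_Lim_measure_decseq) (auto simp: ms)
      then have "(\<lambda>i. measure (m n) (A i)) \<longlonglongrightarrow> 0" by (simp add: A(3))
      from order_tendstoD(2)[OF this half_gt_zero[OF \<open>0 < e\<close>]]
      obtain N where N: "\<And>i. i \<ge> N \<Longrightarrow> measure (m n) (A i) < e / 2"
        by (auto simp: eventually_sequentially)
      show "\<exists>N. \<forall>i\<ge>N. norm (P (A i) - 0) < e"
      proof (intro exI allI impI)
        fix i assume "i \<ge> N"
        have "A i \<in> sets S" using A by auto
        then show "norm (P (A i) - 0) < e"
          using P[of "A i" n] P0[of "A i"] N[OF \<open>i \<ge> N\<close>] n by auto
      qed
    qed
    then show "(\<lambda>i. ennreal (P (A i))) \<longlonglongrightarrow> 0"
      using tendsto_ennrealI by fastforce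
  qed auto
  have em: "emeasure \<mu> A = ennreal (P A)" if "A \<in> sets S" for A
    unfolding \<mu>_def by (rule emeasure_measure_of_sigma[OF sets.sigma_algebra_axioms pos ca that])
  have me: "measure \<mu> A = P A" if "A \<in> sets S" for A
    using em[OF that] P0[OF that] by (simp add: measure_def)
  have \<mu>: "prob_space \<mu>"
  proof
    have "measure (m n) (space S) = 1" for n
      using prob_space.prob_space[OF mp, of n] by (simp add: msp)
    then have "P (space S) = 1"
      using lim[of "space S"] by (simp add: LIMSEQ_const_iff)
    then show "emeasure \<mu> (space \<mu>) = 1" by (simp add: em)
  qed
  interpret \<mu>: prob_space \<mu> by (rule \<mu>)
  have L: "L f = (\<integral>z. f z \<partial>\<mu>)"
    if f[measurable]: "f \<in> borel_measurable S" and f1: "\<And>z. z \<in> space S \<Longrightarrow> \<bar>f z\<bar> \<le> 1" for f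
  proof -
    have "\<bar>L f - (\<integral>z. f z \<partial>\<mu>)\<bar> \<le> e" if e: "0 < e" for e
    proof -
      \<comment> \<open>Rounding \<open>f\<close> down to multiples of \<open>1 / k\<close> leaves
        finitely many level sets, on which convergence is known. The choice of \<open>k\<close> pays
        for two rounding errors, one under the laws \<open>m n\<close> and one under
        \<open>\<mu>\<close>.\<close>
      obtain k :: nat where k: "2 / e < real k" using reals_Archimedean2 by blast
      have k0: "0 < k" using k e by (cases k) (auto simp: not_less[symmetric])
      define g where "g z = real_of_int \<lfloor>real k * f z\<rfloor> / real k" for z
      have g[measurable]: "g \<in> borel_measurable S" unfolding g_def by measurable
      have fg: "\<bar>f z - g z\<bar> \<le> 1 / k" for z
      proof -
        have "real k * \<bar>f z - g z\<bar> = \<bar>real k * (f z - g z)\<bar>" by (simp add: abs_mult)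
        also have "\<dots> = \<bar>real k * f z - real_of_int \<lfloor>real k * f z\<rfloor>\<bar>"
          using k0 by (simp add: g_def right_diff_distrib)
        also have "\<dots> \<le> 1" by linarith
        finally show ?thesis using k0 by (simp add: field_simps)
      qed
      let ?I = "{- int k .. int k}"
      have fl: "\<lfloor>real k * f z\<rfloor> \<in> ?I" if "z \<in> space S" for z
      proof -
        have "\<bar>real k * f z\<bar> \<le> real k * 1"
          unfolding abs_mult using f1[OF that] by (intro mult_mono) auto
        then show ?thesis by (auto simp: le_floor_iff floor_le_iff abs_le_iff)
      qed
      have gsum: "g z = (\<Sum>i\<in>?I. (i / k) * indicator {z\<in>space S. \<lfloor>real k * f z\<rfloor> = i} z)" if "z \<in> space S" for z
      proof -
        have "(\<Sum>i\<in>?I. (i / k) * indicator {z\<in>space S. \<lfloor>real k * f z\<rfloor> = i} z)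
          = (\<Sum>i\<in>?I. if i = \<lfloor>real k * f z\<rfloor> then i / k else 0)"
          using that by (intro sum.cong) (auto simp: indicator_def)
        then show ?thesis using fl[OF that] by (simp add: g_def)
      qed
      have int_g: "(\<integral>z. g z \<partial>N) = (\<Sum>i\<in>?I. (i / k) * measure N {z\<in>space S. \<lfloor>real k * f z\<rfloor> = i})"
        if N: "prob_space N" "sets N = sets S" for N
      proof -
        interpret N: prob_space N by fact
        note [measurable_cong] = N(2)
        have sp: "space N = space S" using sets_eq_imp_space_eq[OF N(2)] .
        have "(\<integral>z. g z \<partial>N) = (\<integral>z. (\<Sum>i\<in>?I. (i / k) * indicator {z\<in>space S. \<lfloor>real k * f z\<rfloor> = i} z) \<partial>N)"
          by (rule Bochner_Integration.integral_cong[OF refl gsum]) (simp add: sp)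
        also have "\<dots> = (\<Sum>i\<in>?I. (i / k) * measure N ({z\<in>space S. \<lfloor>real k * f z\<rfloor> = i} \<inter> space N))"
          by (subst Bochner_Integration.integral_sum)
            (auto intro!: integrable_mult_right integrable_real_indicator simp: N(2) N.emeasure_eq_measure)
        finally show ?thesis by (simp add: sp Int_absorb2 Collect_conj_eq[symmetric] Int_def conj_ac)
      qed
      have close: "\<bar>(\<integral>z. f z \<partial>N) - (\<integral>z. g z \<partial>N)\<bar> \<le> 1 / k"
        if N: "prob_space N" "sets N = sets S" for N
      proof -
        interpret N: prob_space N by fact
        note [measurable_cong] = N(2)
        have sp: "space N = space S" using sets_eq_imp_space_eq[OF N(2)] .
        have i: "integrable N f" by (rule N.integrable_bounded[of _ 1]) (use f1 sp in auto)
        have g2: "\<bar>g z\<bar> \<le> 1 + 1 / k" if "z \<in> space N" for z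
          using fg[of z] f1[of z] that by (simp add: sp)
        have i': "integrable N g"
          by (rule N.integrable_bounded[OF _ g2]) auto
        have "\<bar>\<integral>z. f z - g z \<partial>N\<bar> \<le> 1 / k"
          by (rule N.abs_integral_bounded) (use fg in auto)
        then show ?thesis using i i' by simp
      qed
      have lf: "(\<lambda>n. \<integral>z. f z \<partial>m n) \<longlonglongrightarrow> L f"
        using unif(1)[OF f f1] by (simp add: convergent_LIMSEQ_iff L_def)
      have "(\<lambda>n. \<integral>z. g z \<partial>m n) \<longlonglongrightarrow> (\<integral>z. g z \<partial>\<mu>)"
        unfolding int_g[OF mp ms] int_g[OF \<mu> sets]
        by (intro tendsto_sum tendsto_mult tendsto_const) (simp add: me lim)
      then have "(\<lambda>n. \<bar>(\<integral>z. f z \<partial>m n) - (\<integral>z. g z \<partial>m n)\<bar>) \<longlonglongrightarrow> \<bar>L f - (\<integral>z. g z \<partial>\<mu>)\<bar>"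
        by (intro tendsto_intros lf)
      then have "\<bar>L f - (\<integral>z. g z \<partial>\<mu>)\<bar> \<le> 1 / k"
        by (rule LIMSEQ_le_const2) (use close[OF mp ms] in auto)
      then have "\<bar>L f - (\<integral>z. f z \<partial>\<mu>)\<bar> \<le> 2 / k"
        using close[OF \<mu> sets] by linarith
      also have "\<dots> \<le> e" using k e k0 by (simp add: field_simps)
      finally show ?thesis .
    qed
    then show ?thesis
      by (metis abs_le_zero_iff eq_iff_diff_eq_0 field_le_epsilon add_0)
  qed
  have lim1: "(\<lambda>n. (kernel_op K ^^ n) f x) \<longlonglongrightarrow> (\<integral>z. f z \<partial>\<mu>)"
    if f: "f \<in> borel_measurable S" "\<And>z. z \<in> space S \<Longrightarrow> \<bar>f z\<bar> \<le> 1" and x: "x \<in> G" for f x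
  proof -
    have 1: "(\<lambda>n. (kernel_op K ^^ n) f x0) \<longlonglongrightarrow> (\<integral>z. f z \<partial>\<mu>)"
      using unif(1)[OF f] integral_chain_law[OF x0S f]
      by (simp add: convergent_LIMSEQ_iff L[OF f, symmetric] L_def m_def)
    have "(\<lambda>n. (D x + D x0) * \<alpha> ^ n) \<longlonglongrightarrow> (D x + D x0) * 0"
      by (intro tendsto_mult tendsto_const LIMSEQ_power_zero) (use \<alpha> in auto)
    then have bound0: "(\<lambda>n. (D x + D x0) * \<alpha> ^ n) \<longlonglongrightarrow> 0" by simp
    have "\<bar>(kernel_op K ^^ n) f x - (kernel_op K ^^ n) f x0\<bar> \<le> (D x + D x0) * \<alpha> ^ n" for n
      using osc[OF f x x0, of n] osc[OF f x0 x, of n] by (intro abs_leI) (simp_all add: add.commute)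
    then have "(\<lambda>n. (kernel_op K ^^ n) f x - (kernel_op K ^^ n) f x0) \<longlonglongrightarrow> 0"
      by (intro Lim_null_comparison[OF _ bound0] always_eventually) simp
    from tendsto_add[OF this 1] show ?thesis by simp
  qed
  show ?thesis
  proof (rule that[OF \<mu> sets])
    fix f :: "'b \<Rightarrow> real" and C x
    assume f: "f \<in> borel_measurable S" and C: "\<And>z. z \<in> space S \<Longrightarrow> \<bar>f z\<bar> \<le> C" and x: "x \<in> G"
    define C' where "C' = max C 1"
    have C': "0 < C'" "C \<le> C'" by (auto simp: C'_def)
    define g where "g z = f z / C'" for z
    have g: "g \<in> borel_measurable S" "\<And>z. z \<in> space S \<Longrightarrow> \<bar>g z\<bar> \<le> 1"
      using f C C' unfolding g_def by (auto intro: order_trans)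
    have fg: "f = (\<lambda>z. C' * g z)" using C' by (auto simp: g_def)
    have lin: "(kernel_op K ^^ n) (\<lambda>z. C' * h z) = (\<lambda>z. C' * (kernel_op K ^^ n) h z)" for n h
    proof -
      have "kernel_op K (\<lambda>z. C' * h z) = (\<lambda>z. C' * kernel_op K h z)" for h
        by (simp add: kernel_op_def fun_eq_iff)
      then show ?thesis by (induction n) simp_all
    qed
    show "(\<lambda>n. (kernel_op K ^^ n) f x) \<longlonglongrightarrow> (\<integral>z. f z \<partial>\<mu>)"
      unfolding fg lin using tendsto_mult[OF tendsto_const lim1[OF g x], of C'] by simp
  qed
qed

end

section \<open>Finite-dimensional laws of two-sided Brownian motion\<close>

text \<open>Independence makes the joint law a product, and Tonelli's theorem then allows
  \<open>Y\<close> to be sampled afresh while \<open>X\<close> is frozen.\<close>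

lemma (in prob_space) nn_integral_indep_var:
  assumes XY: "indep_var S X T Y" and h[measurable]: "h \<in> borel_measurable (S \<Otimes>\<^sub>M T)"
  shows "(\<integral>\<^sup>+\<omega>. h (X \<omega>, Y \<omega>) \<partial>M) = (\<integral>\<^sup>+\<omega>'. (\<integral>\<^sup>+\<omega>. h (X \<omega>', Y \<omega>) \<partial>M) \<partial>M)"
proof -
  have X[measurable]: "X \<in> M \<rightarrow>\<^sub>M S" and Y[measurable]: "Y \<in> M \<rightarrow>\<^sub>M T"
    and eq: "distr M S X \<Otimes>\<^sub>M distr M T Y = distr M (S \<Otimes>\<^sub>M T) (\<lambda>x. (X x, Y x))"
    using XY by (auto simp: indep_var_distribution_eq)
  interpret Y: prob_space "distr M T Y" by (rule prob_space_distr) simp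
  have "(\<integral>\<^sup>+\<omega>. h (X \<omega>, Y \<omega>) \<partial>M) = (\<integral>\<^sup>+z. h z \<partial>distr M (S \<Otimes>\<^sub>M T) (\<lambda>x. (X x, Y x)))"
    by (simp add: nn_integral_distr)
  also have "\<dots> = (\<integral>\<^sup>+x. (\<integral>\<^sup>+y. h (x, y) \<partial>distr M T Y) \<partial>distr M S X)"
    unfolding eq[symmetric] by (rule Y.nn_integral_fst[symmetric]) simp
  also have "\<dots> = (\<integral>\<^sup>+\<omega>'. (\<integral>\<^sup>+y. h (X \<omega>', y) \<partial>distr M T Y) \<partial>M)"
    by (rule nn_integral_distr) auto
  also have "\<dots> = (\<integral>\<^sup>+\<omega>'. (\<integral>\<^sup>+\<omega>. h (X \<omega>', Y \<omega>) \<partial>M) \<partial>M)"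
  proof (rule nn_integral_cong)
    fix \<omega>' assume "\<omega>' \<in> space M"
    then have [measurable]: "X \<omega>' \<in> space S" using X by (rule measurable_space[rotated])
    show "(\<integral>\<^sup>+y. h (X \<omega>', y) \<partial>distr M T Y) = (\<integral>\<^sup>+\<omega>. h (X \<omega>', Y \<omega>) \<partial>M)"
      by (rule nn_integral_distr) auto
  qed
  finally show ?thesis .
qed

lemma (in prob_space) indep_var_swap:
  assumes "indep_var S X T Y"
  shows "indep_var T Y S X"
proof -
  have X[measurable]: "X \<in> M \<rightarrow>\<^sub>M S" and Y[measurable]: "Y \<in> M \<rightarrow>\<^sub>M T"
    and eq: "distr M S X \<Otimes>\<^sub>M distr M T Y = distr M (S \<Otimes>\<^sub>M T) (\<lambda>x. (X x, Y x))"
    using assms by (auto simp: indep_var_distribution_eq)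
  interpret X: prob_space "distr M S X" by (rule prob_space_distr) simp
  interpret Y: prob_space "distr M T Y" by (rule prob_space_distr) simp
  interpret pair_sigma_finite "distr M T Y" "distr M S X" ..
  have "distr M T Y \<Otimes>\<^sub>M distr M S X = distr (distr M S X \<Otimes>\<^sub>M distr M T Y) (T \<Otimes>\<^sub>M S) (\<lambda>(x, y). (y, x))"
    by (subst distr_pair_swap) (simp cong: distr_cong)
  also have "\<dots> = distr M (T \<Otimes>\<^sub>M S) (\<lambda>x. (Y x, X x))"
    unfolding eq by (subst distr_distr) (auto simp: comp_def)
  finally show ?thesis by (auto simp: indep_var_distribution_eq)
qed

text \<open>The path on \<open>I\<close> is a measurable function of the increments between consecutive points of \<open>I\<close>.\<close>

lemma (in brownian_motion) nn_integral_next_increment: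
  assumes I: "finite I" "0 \<in> I" "I \<subseteq> {0..}" and m: "m \<in> I" "\<And>s. s \<in> I \<Longrightarrow> s \<le> m" "m < t"
    and h[measurable]: "h \<in> borel_measurable (PiM I (\<lambda>_. borel) \<Otimes>\<^sub>M borel)"
  shows "(\<integral>\<^sup>+\<omega>. h (\<lambda>s\<in>I. B s \<omega>, B t \<omega> - B m \<omega>) \<partial>M) =
    (\<integral>\<^sup>+\<omega>'. (\<integral>\<^sup>+\<omega>. h (\<lambda>s\<in>I. B s \<omega>', B t \<omega> - B m \<omega>) \<partial>M) \<partial>M)"
proof -
  define xs where "xs = sorted_list_of_set I"
  define n where "n = length xs"
  have set_xs: "set xs = I" and sorted: "sorted xs" and dist: "distinct xs"
    using I by (auto simp: xs_def)
  have "xs \<noteq> []" using set_xs m by auto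
  then have n: "0 < n" by (simp add: n_def)
  \<comment> \<open>From index \<open>n\<close> on the sequence sits at \<open>t\<close>, so
    \<open>D (n - 1)\<close> is the increment from the last sorted time, which is \<open>m\<close>,
    to \<open>t\<close>.\<close>
  define \<tau> where "\<tau> k = (if k < n then xs ! k else t)" for k
  have mono: "xs ! i \<le> xs ! j" if "i \<le> j" "j < n" for i j
    using sorted that by (simp add: n_def sorted_nth_mono)
  have in_I: "xs ! k \<in> I" if "k < n" for k using that set_xs by (auto simp: n_def)
  have idx: "\<exists>k<n. s = xs ! k" if "s \<in> I" for s
    using that set_xs by (metis in_set_conv_nth n_def)
  have \<tau>0: "\<tau> 0 = 0"
  proof -
    obtain k where k: "k < n" "0 = xs ! k" using idx[OF I(2)] by blast
    have "xs ! 0 \<le> 0" using mono[of 0 k] k by simp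
    moreover have "0 \<le> xs ! 0" using in_I[OF n] I by auto
    ultimately show ?thesis using n by (simp add: \<tau>_def)
  qed
  have last: "xs ! (n - 1) = m"
  proof -
    obtain k where k: "k < n" "m = xs ! k" using idx[OF m(1)] by blast
    have "m \<le> xs ! (n - 1)" using mono[of k "n - 1"] k by simp
    then show ?thesis using m(2)[OF in_I[of "n - 1"]] n by simp
  qed
  have \<tau>_mono: "\<tau> k \<le> \<tau> (Suc k)" if "k < n" for k
    using mono[of k "Suc k"] m(2)[OF in_I[OF that]] m(3) that by (auto simp: \<tau>_def)
  define D where "D k \<omega> = B (\<tau> (Suc k)) \<omega> - B (\<tau> k) \<omega>" for k \<omega>
  have "indep_vars (\<lambda>_. borel) D {..<n}"
    unfolding D_def[abs_def] by (rule indep_increments) (use \<tau>0 \<tau>_mono in auto)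
  from indep_var_restrict[OF this, of "{..<n - 1}" "{n - 1}"]
  have ind: "indep_var (PiM {..<n - 1} (\<lambda>_. borel)) (\<lambda>\<omega>. \<lambda>k\<in>{..<n - 1}. D k \<omega>)
      (PiM {n - 1} (\<lambda>_. borel)) (\<lambda>\<omega>. \<lambda>k\<in>{n - 1}. D k \<omega>)"
    using n by auto
  have Dn: "D (n - 1) \<omega> = B t \<omega> - B m \<omega>" for \<omega>
    using n last by (simp add: D_def \<tau>_def)
  define ix where "ix s = (SOME k. k < n \<and> s = xs ! k)" for s
  have ix: "ix s < n" "s = xs ! ix s" if "s \<in> I" for s
    using someI_ex[of "\<lambda>k. k < n \<and> s = xs ! k"] idx[OF that] by (auto simp: ix_def)
  \<comment> \<open>The first sorted time is 0, where the motion vanishes; the value at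
    \<open>s\<close> is therefore the telescoping sum of the increments before the index of
    \<open>s\<close>. That index is at most \<open>n - 1\<close>, so the last increment never
    enters.\<close>
  define F where "F d = (\<lambda>s\<in>I. \<Sum>k<ix s. d k :: real)" for d
  have F: "F \<in> PiM {..<n - 1} (\<lambda>_. borel) \<rightarrow>\<^sub>M PiM I (\<lambda>_. borel)"
    unfolding F_def
  proof (rule measurable_restrict)
    fix s assume s: "s \<in> I"
    show "(\<lambda>x. \<Sum>k<ix s. x k :: real) \<in> borel_measurable (PiM {..<n - 1} (\<lambda>_. borel))"
    proof (rule borel_measurable_sum[where f="\<lambda>k x. x k"])
      fix k assume "k \<in> {..<ix s}"
      then show "(\<lambda>x. x k) \<in> borel_measurable (PiM {..<n - 1} (\<lambda>_. borel))"
        using ix(1)[OF s] by (intro measurable_component_singleton) auto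
    qed
  qed
  have path: "F (\<lambda>k\<in>{..<n - 1}. D k \<omega>) = (\<lambda>s\<in>I. B s \<omega>)" if \<omega>: "\<omega> \<in> space M" for \<omega>
  proof
    fix s show "F (\<lambda>k\<in>{..<n - 1}. D k \<omega>) s = (\<lambda>s\<in>I. B s \<omega>) s"
    proof (cases "s \<in> I")
      case True
      have "(\<Sum>k<ix s. (\<lambda>k\<in>{..<n - 1}. D k \<omega>) k) = (\<Sum>k<ix s. D k \<omega>)"
        by (rule sum.cong) (use ix[OF True] in auto)
      also have "\<dots> = B (\<tau> (ix s)) \<omega> - B (\<tau> 0) \<omega>"
        unfolding D_def by (rule sum_lessThan_telescope)
      also have "\<dots> = B s \<omega>"
        using ix[OF True] start[OF \<omega>] by (simp add: \<tau>0) (simp add: \<tau>_def)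
      finally show ?thesis using True by (simp add: F_def)
    qed (simp add: F_def)
  qed
  have "(\<integral>\<^sup>+\<omega>. h (F (\<lambda>k\<in>{..<n - 1}. D k \<omega>), (\<lambda>k\<in>{n - 1}. D k \<omega>) (n - 1)) \<partial>M) =
      (\<integral>\<^sup>+\<omega>'. (\<integral>\<^sup>+\<omega>. h (F (\<lambda>k\<in>{..<n - 1}. D k \<omega>'), (\<lambda>k\<in>{n - 1}. D k \<omega>) (n - 1)) \<partial>M) \<partial>M)"
  proof -
    have "(\<lambda>z. (F (fst z), snd z (n - 1))) \<in> PiM {..<n - 1} (\<lambda>_. borel) \<Otimes>\<^sub>M PiM {n - 1} (\<lambda>_. borel :: real measure)
        \<rightarrow>\<^sub>M PiM I (\<lambda>_. borel) \<Otimes>\<^sub>M borel"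
      by (intro measurable_Pair measurable_compose[OF measurable_fst F]
          measurable_compose[OF measurable_snd measurable_component_singleton]) auto
    from nn_integral_indep_var[OF ind measurable_compose[OF this h]] show ?thesis by simp
  qed
  then show ?thesis
    by (simp add: Dn[simplified] path[simplified] cong: nn_integral_cong_simp)
qed

text \<open>Reversing time exchanges the two halves, and independence is symmetric. Extensions to
  the left thereby reduce to extensions to the right.\<close>

lemma two_sided_brownian_motion_reflect:
  assumes "prob_space M" "two_sided_brownian_motion M B"
  shows "two_sided_brownian_motion M (\<lambda>s. B (- s))"
proof -
  interpret prob_space M by fact
  show ?thesis
    using assms(2) unfolding two_sided_brownian_motion_def
    by (smt (verit, ccfv_SIG) indep_var_swap minus_minus neg_0_le_iff_le neg_le_0_iff_le)
qed

text \<open>Beyond the largest time the increment comes from the positive half. With the negative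
  half frozen it is independent of the earlier positive path, and it is normal; hence it is
  independent of everything observed on \<open>I\<close>.\<close>

lemma two_sided_nn_integral_next_increment:
  assumes M: "prob_space M" and B: "two_sided_brownian_motion M B"
    and I: "finite I" "0 \<in> I" and m: "m \<in> I" "\<And>s. s \<in> I \<Longrightarrow> s \<le> m" "m < t"
    and h[measurable]: "h \<in> borel_measurable (PiM I (\<lambda>_. borel) \<Otimes>\<^sub>M borel)"
  shows "(\<integral>\<^sup>+\<omega>. h (\<lambda>s\<in>I. B s \<omega>, B t \<omega> - B m \<omega>) \<partial>M) =
    (\<integral>\<^sup>+x. ennreal (normal_density 0 (sqrt (t - m)) x) * (\<integral>\<^sup>+\<omega>. h (\<lambda>s\<in>I. B s \<omega>, x) \<partial>M) \<partial>lborel)"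
proof -
  interpret prob_space M by (rule M)
  obtain Bp Bm where Bp: "brownian_motion M Bp" and Bm: "brownian_motion M Bm"
    and indep: "indep_var (Pi\<^sub>M {0..} (\<lambda>_. borel)) (\<lambda>\<omega>. \<lambda>t\<in>{0..}. Bp t \<omega>)
        (Pi\<^sub>M {0..} (\<lambda>_. borel)) (\<lambda>\<omega>. \<lambda>t\<in>{0..}. Bm t \<omega>)"
    and Beq: "\<And>\<omega> t. \<omega> \<in> space M \<Longrightarrow> 0 \<le> t \<Longrightarrow> B t \<omega> = Bp t \<omega>"
      "\<And>\<omega> t. \<omega> \<in> space M \<Longrightarrow> t \<le> 0 \<Longrightarrow> B t \<omega> = Bm (- t) \<omega>"
    using B by (auto simp: two_sided_brownian_motion_def)
  interpret Bp: brownian_motion M Bp by fact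
  interpret Bm: brownian_motion M Bm by fact
  \<comment> \<open>This is where \<open>0 \<in> I\<close> enters: it places the maximum on the
    nonnegative side.\<close>
  have m0: "0 \<le> m" using m(2)[OF I(2)] .
  define J where "J = I \<inter> {0..}"
  define N where "N = I \<inter> {..<0}"
  have JN: "J \<union> N = I" "J \<inter> N = {}" by (auto simp: J_def N_def)
  have J: "finite J" "0 \<in> J" "J \<subseteq> {0..}" "m \<in> J" "\<And>s. s \<in> J \<Longrightarrow> s \<le> m"
    using I m m0 by (auto simp: J_def)
  define P where "P \<omega> = (\<lambda>s\<in>J. Bp s \<omega>)" for \<omega>
  define Q where "Q \<omega> = (\<lambda>s\<in>N. Bm (- s) \<omega>)" for \<omega>
  define D where "D \<omega> = Bp t \<omega> - Bp m \<omega>" for \<omega>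
  let ?PJ = "PiM J (\<lambda>_. borel :: real measure)" and ?PN = "PiM N (\<lambda>_. borel :: real measure)"
  have P[measurable]: "P \<in> M \<rightarrow>\<^sub>M ?PJ" unfolding P_def
    by (rule measurable_restrict) (use J(3) Bp.random_variable in auto)
  have Q[measurable]: "Q \<in> M \<rightarrow>\<^sub>M ?PN" unfolding Q_def
    by (rule measurable_restrict) (auto simp: N_def intro!: Bm.random_variable)
  have D[measurable]: "D \<in> borel_measurable M" unfolding D_def
    using m0 m(3) by (intro borel_measurable_diff Bp.random_variable) auto
  have mg[measurable]: "merge J N \<in> ?PJ \<Otimes>\<^sub>M ?PN \<rightarrow>\<^sub>M PiM I (\<lambda>_. borel)"
    using measurable_merge[of J N "\<lambda>_. borel"] by (simp add: JN)
  have path: "(\<lambda>s\<in>I. B s \<omega>) = merge J N (P \<omega>, Q \<omega>)" "B t \<omega> - B m \<omega> = D \<omega>"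
    if "\<omega> \<in> space M" for \<omega>
    using that m0 m(3) Beq by (auto simp: fun_eq_iff merge_def P_def Q_def J_def N_def D_def)
  let ?path = "PiM {0..} (\<lambda>_. borel :: real measure)"
  have [measurable]: "(\<lambda>p. \<lambda>s\<in>N. p (- s)) \<in> ?path \<rightarrow>\<^sub>M ?PN"
    by (rule measurable_restrict, rule measurable_component_singleton) (auto simp: N_def)
  have [measurable]: "(\<lambda>p. \<lambda>s\<in>J. p s) \<in> ?path \<rightarrow>\<^sub>M ?PJ"
    by (rule measurable_restrict, rule measurable_component_singleton) (use J(3) in auto)
  have [measurable]: "(\<lambda>p. p t - p m) \<in> borel_measurable ?path"
    using m0 m(3) by (intro borel_measurable_diff measurable_component_singleton) auto
  have Q_path: "(\<lambda>s\<in>N. (\<lambda>t\<in>{0..}. Bm t \<omega>) (- s)) = Q \<omega>" for \<omega>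
    by (auto simp: Q_def fun_eq_iff N_def)
  have P_path: "(\<lambda>s\<in>J. (\<lambda>t\<in>{0..}. Bp t \<omega>) s) = P \<omega>"
    and D_path: "(\<lambda>t\<in>{0..}. Bp t \<omega>) t - (\<lambda>t\<in>{0..}. Bp t \<omega>) m = D \<omega>" for \<omega>
    using J(3) m0 m(3) by (auto simp: P_def D_def fun_eq_iff)
  \<comment> \<open>Applied forwards to freeze the negative half before the one-sided statement is
    invoked, and backwards once the increment has been replaced by its density.\<close>
  have QPD: "(\<integral>\<^sup>+\<omega>. g (Q \<omega>) (P \<omega>) (D \<omega>) \<partial>M) = (\<integral>\<^sup>+\<omega>. (\<integral>\<^sup>+\<omega>'. g (Q \<omega>) (P \<omega>') (D \<omega>') \<partial>M) \<partial>M)"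
    if g: "(\<lambda>(q, p, d). g q p d) \<in> borel_measurable (?PN \<Otimes>\<^sub>M ?PJ \<Otimes>\<^sub>M borel)" for g
  proof -
    have "(\<lambda>z. (\<lambda>s\<in>N. fst z (- s), \<lambda>s\<in>J. snd z s, snd z t - snd z m)) \<in>
        ?path \<Otimes>\<^sub>M ?path \<rightarrow>\<^sub>M ?PN \<Otimes>\<^sub>M ?PJ \<Otimes>\<^sub>M borel"
      by (intro measurable_Pair measurable_compose[OF measurable_fst, of "\<lambda>p. \<lambda>s\<in>N. p (- s)"]
          measurable_compose[OF measurable_snd, of "\<lambda>p. \<lambda>s\<in>J. p s"]
          measurable_compose[OF measurable_snd, of "\<lambda>p. p t - p m"]) fact+
    from measurable_compose[OF this g]
    have "(\<lambda>(x, y). g (\<lambda>s\<in>N. x (- s)) (\<lambda>s\<in>J. y s) (y t - y m)) \<in> borel_measurable (?path \<Otimes>\<^sub>M ?path)"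
      by (simp add: split_beta)
    from nn_integral_indep_var[OF indep_var_swap[OF indep] this] show ?thesis
      by (simp only: prod.case Q_path P_path D_path)
  qed
  have Dd: "distributed M lborel D (\<lambda>x. ennreal (normal_density 0 (sqrt (t - m)) x))"
    unfolding D_def using m0 m(3) by (intro Bp.normal_increments) auto
  interpret MM: pair_sigma_finite M M ..
  have "(\<integral>\<^sup>+\<omega>. h (\<lambda>s\<in>I. B s \<omega>, B t \<omega> - B m \<omega>) \<partial>M) = (\<integral>\<^sup>+\<omega>. h (merge J N (P \<omega>, Q \<omega>), D \<omega>) \<partial>M)"
    by (simp add: path cong: nn_integral_cong_simp)
  also have "\<dots> = (\<integral>\<^sup>+\<omega>. (\<integral>\<^sup>+\<omega>'. h (merge J N (P \<omega>', Q \<omega>), D \<omega>') \<partial>M) \<partial>M)"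
    by (rule QPD) measurable
  also have "\<dots> = (\<integral>\<^sup>+\<omega>. (\<integral>\<^sup>+\<omega>'. (\<integral>\<^sup>+\<omega>''. h (merge J N (P \<omega>', Q \<omega>), D \<omega>'') \<partial>M) \<partial>M) \<partial>M)"
  proof (rule nn_integral_cong)
    fix \<omega> assume "\<omega> \<in> space M"
    then have [measurable]: "Q \<omega> \<in> space ?PN" using Q by (rule measurable_space[rotated])
    show "(\<integral>\<^sup>+\<omega>'. h (merge J N (P \<omega>', Q \<omega>), D \<omega>') \<partial>M) =
        (\<integral>\<^sup>+\<omega>'. (\<integral>\<^sup>+\<omega>''. h (merge J N (P \<omega>', Q \<omega>), D \<omega>'') \<partial>M) \<partial>M)"
      using Bp.nn_integral_next_increment[OF J m(3), of "\<lambda>(p, d). h (merge J N (p, Q \<omega>), d)"]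
      by (simp add: P_def D_def)
  qed
  also have "\<dots> = (\<integral>\<^sup>+\<omega>. (\<integral>\<^sup>+\<omega>'. (\<integral>\<^sup>+x. ennreal (normal_density 0 (sqrt (t - m)) x) *
      h (merge J N (P \<omega>', Q \<omega>), x) \<partial>lborel) \<partial>M) \<partial>M)"
  proof (intro nn_integral_cong)
    fix \<omega> \<omega>' assume "\<omega> \<in> space M" "\<omega>' \<in> space M"
    then have [measurable]: "Q \<omega> \<in> space ?PN" "P \<omega>' \<in> space ?PJ"
      using measurable_space[OF Q] measurable_space[OF P] by auto
    show "(\<integral>\<^sup>+\<omega>''. h (merge J N (P \<omega>', Q \<omega>), D \<omega>'') \<partial>M) = (\<integral>\<^sup>+x. ennreal (normal_density 0 (sqrt (t - m)) x) *
      h (merge J N (P \<omega>', Q \<omega>), x) \<partial>lborel)"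
      by (rule distributed_nn_integral[OF Dd, symmetric]) measurable
  qed
  also have "\<dots> = (\<integral>\<^sup>+\<omega>. (\<integral>\<^sup>+x. ennreal (normal_density 0 (sqrt (t - m)) x) *
      h (merge J N (P \<omega>, Q \<omega>), x) \<partial>lborel) \<partial>M)"
    by (rule QPD[symmetric]) measurable
  also have "\<dots> = (\<integral>\<^sup>+x. (\<integral>\<^sup>+\<omega>. ennreal (normal_density 0 (sqrt (t - m)) x) *
      h (merge J N (P \<omega>, Q \<omega>), x) \<partial>M) \<partial>lborel)"
  proof -
    interpret pair_sigma_finite M lborel ..
    show ?thesis by (rule Fubini'[symmetric]) measurable
  qed
  also have "\<dots> = (\<integral>\<^sup>+x. ennreal (normal_density 0 (sqrt (t - m)) x) * (\<integral>\<^sup>+\<omega>. h (\<lambda>s\<in>I. B s \<omega>, x) \<partial>M) \<partial>lborel)"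
    by (simp add: nn_integral_cmult path cong: nn_integral_cong_simp)
  finally show ?thesis .
qed


section \<open>Sets of times built outward from 0\<close>

definition outward :: "real set \<Rightarrow> real \<Rightarrow> real \<Rightarrow> bool" where
  "outward I m t \<longleftrightarrow> finite I \<and> 0 \<in> I \<and> m \<in> I \<and> ((\<forall>s\<in>I. s \<le> m) \<and> m < t \<or> (\<forall>s\<in>I. m \<le> s) \<and> t < m)"

lemma outward_notin: "outward I m t \<Longrightarrow> t \<notin> I"
  by (force simp: outward_def)

text \<open>If the maximum of \<open>I\<close> is positive it can be removed, and if the minimum is
  negative it can be removed; in either case 0 stays. A point added between two old ones would need
  a Brownian bridge, while an outer point only needs an independent increment from the neighbouring
  extreme point \<open>m\<close>.\<close>

lemma outward_induct [consumes 2, case_names zero extend]: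
  assumes "finite I" "0 \<in> I" and zero: "P {0}"
    and extend: "\<And>I m t. outward I m t \<Longrightarrow> P I \<Longrightarrow> P (insert t I)"
  shows "P I"
  using assms(1,2)
proof (induction "card I" arbitrary: I rule: less_induct)
  case less
  have step: "P I" if m: "outward (I - {t}) m t" and t: "t \<in> I" for m t
  proof -
    have "card (I - {t}) < card I" using less.prems t by (intro card_Diff1_less) auto
    moreover have "finite (I - {t})" "0 \<in> I - {t}" using m by (auto simp: outward_def)
    ultimately have "P (I - {t})" by (rule less.hyps)
    from extend[OF m this] t show ?thesis by (simp add: insert_absorb)
  qed
  consider "I = {0}" | "0 < Max I" | "Min I < 0"
  proof -
    have "I = {0}" if "\<not> 0 < Max I" "\<not> Min I < 0"
    proof -
      have "x = 0" if "x \<in> I" for x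
        using Max_ge[OF less.prems(1) that] Min_le[OF less.prems(1) that] \<open>\<not> 0 < Max I\<close> \<open>\<not> Min I < 0\<close> by linarith
      then show ?thesis using less.prems by auto
    qed
    then show thesis using that by blast
  qed
  then show ?case
  proof cases
    case 1
    then show ?thesis using zero by simp
  next
    case 2
    define t where "t = Max I"
    have t: "t \<in> I" "\<And>s. s \<in> I \<Longrightarrow> s \<le> t" using less.prems by (auto simp: t_def intro!: Max_in)
    define J where "J = I - {t}"
    have J: "finite J" "0 \<in> J" "J \<noteq> {}" using less.prems 2 by (auto simp: J_def t_def)
    have "Max J \<in> J" "\<And>s. s \<in> J \<Longrightarrow> s \<le> Max J" using J by (auto intro!: Max_in)
    then have "outward J (Max J) t"
      using J t by (force simp: outward_def J_def less_le)
    then show ?thesis using t(1) unfolding J_def by (rule step)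
  next
    case 3
    define t where "t = Min I"
    have t: "t \<in> I" "\<And>s. s \<in> I \<Longrightarrow> t \<le> s" using less.prems by (auto simp: t_def intro!: Min_in)
    define J where "J = I - {t}"
    have J: "finite J" "0 \<in> J" "J \<noteq> {}" using less.prems 3 by (auto simp: J_def t_def)
    have "Min J \<in> J" "\<And>s. s \<in> J \<Longrightarrow> Min J \<le> s" using J by (auto intro!: Min_in)
    then have "outward J (Min J) t"
      using J t by (force simp: outward_def J_def less_le)
    then show ?thesis using t(1) unfolding J_def by (rule step)
  qed
qed

lemma two_sided_random_variable:
  assumes "two_sided_brownian_motion M B"
  shows "B t \<in> borel_measurable M"
proof -
  obtain Bp Bm where Bp: "brownian_motion M Bp" and Bm: "brownian_motion M Bm"
    and Beq: "\<And>\<omega> t. \<omega> \<in> space M \<Longrightarrow> 0 \<le> t \<Longrightarrow> B t \<omega> = Bp t \<omega>"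
      "\<And>\<omega> t. \<omega> \<in> space M \<Longrightarrow> t \<le> 0 \<Longrightarrow> B t \<omega> = Bm (- t) \<omega>"
    using assms by (auto simp: two_sided_brownian_motion_def)
  show ?thesis
  proof (cases "0 \<le> t")
    case True
    then show ?thesis using brownian_motion.random_variable[OF Bp] Beq(1)
      by (subst measurable_cong[where g="Bp t"]) auto
  next
    case False
    then show ?thesis using brownian_motion.random_variable[OF Bm] Beq(2)
      by (subst measurable_cong[where g="Bm (- t)"]) auto
  qed
qed

lemma two_sided_start:
  assumes "two_sided_brownian_motion M B" "\<omega> \<in> space M"
  shows "B 0 \<omega> = 0"
  using assms brownian_motion.start by (fastforce simp: two_sided_brownian_motion_def)

lemma two_sided_nn_integral_extend:
  assumes M: "prob_space M" and B: "two_sided_brownian_motion M B"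
    and out: "outward I m t"
    and h[measurable]: "h \<in> borel_measurable (PiM (insert t I) (\<lambda>_. borel))"
  shows "(\<integral>\<^sup>+\<omega>. h (\<lambda>s\<in>insert t I. B s \<omega>) \<partial>M) =
    (\<integral>\<^sup>+x. ennreal (normal_density 0 (sqrt \<bar>t - m\<bar>) x) *
      (\<integral>\<^sup>+\<omega>. h ((\<lambda>s\<in>I. B s \<omega>)(t := B m \<omega> + x)) \<partial>M) \<partial>lborel)"
proof -
  have I: "finite I" "0 \<in> I" "m \<in> I" using out by (auto simp: outward_def)
  have tI: "t \<notin> I" by (rule outward_notin[OF out])
  have m1[measurable]: "(\<lambda>z. z m) \<in> borel_measurable (PiM I (\<lambda>_. borel))"
    using I by (intro measurable_component_singleton)
  have "(\<lambda>z. (fst z)(t := fst z m + snd z)) \<in> PiM I (\<lambda>_. borel) \<Otimes>\<^sub>M (borel :: real measure)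
      \<rightarrow>\<^sub>M PiM (insert t I) (\<lambda>_. borel)"
    using measurable_compose[OF measurable_fst m1]
    by (intro measurable_fun_upd[where J=I]) auto
  from measurable_compose[OF this h]
  have g: "(\<lambda>z. h ((fst z)(t := fst z m + snd z))) \<in> borel_measurable (PiM I (\<lambda>_. borel) \<Otimes>\<^sub>M borel)" .
  have upd: "(\<lambda>s\<in>insert t I. B s \<omega>) = (\<lambda>s\<in>I. B s \<omega>)(t := (\<lambda>s\<in>I. B s \<omega>) m + (B t \<omega> - B m \<omega>))" for \<omega>
    using I by (auto simp: fun_eq_iff)
  consider "\<forall>s\<in>I. s \<le> m" "m < t" | "\<forall>s\<in>I. m \<le> s" "t < m"
    using out by (auto simp: outward_def)
  then show ?thesis
  proof cases
    case 1
    show ?thesis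
      unfolding upd
      using two_sided_nn_integral_next_increment[OF M B I(1-3) _ 1(2) g] 1 I by simp
  next
    case 2
    \<comment> \<open>The reflected motion turns the extension to the left into one to the right;
      \<open>r\<close> carries its paths on \<open>?I\<close> back to paths on
      \<open>I\<close>.\<close>
    let ?I = "uminus ` I"
    define r where "r z = (\<lambda>s\<in>I. z (- s) :: real)" for z :: "real \<Rightarrow> real"
    have [measurable]: "r \<in> PiM ?I (\<lambda>_. borel) \<rightarrow>\<^sub>M PiM I (\<lambda>_. borel)"
      unfolding r_def by (intro measurable_restrict measurable_component_singleton) auto
    have r: "r (\<lambda>s\<in>?I. B (- s) \<omega>) = (\<lambda>s\<in>I. B s \<omega>)" for \<omega>
      by (auto simp: r_def fun_eq_iff)
    have g': "(\<lambda>z. h ((r (fst z))(t := r (fst z) m + snd z))) \<in> borel_measurable (PiM ?I (\<lambda>_. borel) \<Otimes>\<^sub>M borel)"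
      using measurable_compose[OF _ g, of "\<lambda>z. (r (fst z), snd z)"] by simp
    have I': "finite ?I" "0 \<in> ?I" "- m \<in> ?I" "- m < - t" using I 2 by (auto simp: image_iff)
    have le: "s \<le> - m" if "s \<in> ?I" for s using 2 that by auto
    show ?thesis
      unfolding upd
      using two_sided_nn_integral_next_increment[OF M two_sided_brownian_motion_reflect[OF M B] I'(1-3) le I'(4) g']
        2 I by (simp add: r)
  qed
qed

text \<open>Each outward extension expresses the law on the larger set through the law on the
  smaller one, in a way that involves only the times; at time 0 both motions vanish.\<close>

lemma two_sided_same_law:
  assumes M: "prob_space M"
    and B: "two_sided_brownian_motion M B" and B': "two_sided_brownian_motion M B'"
    and I: "finite I" "0 \<in> I"
    and h: "h \<in> borel_measurable (PiM I (\<lambda>_. borel))"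
  shows "(\<integral>\<^sup>+\<omega>. h (\<lambda>s\<in>I. B s \<omega>) \<partial>M) = (\<integral>\<^sup>+\<omega>. h (\<lambda>s\<in>I. B' s \<omega>) \<partial>M)"
  using I h
proof (induction I arbitrary: h rule: outward_induct)
  case zero
  have "(\<lambda>s\<in>{0}. B s \<omega>) = (\<lambda>s\<in>{0}. B' s \<omega>)" if "\<omega> \<in> space M" for \<omega>
    using two_sided_start[OF B that] two_sided_start[OF B' that] by (auto simp: fun_eq_iff)
  then show ?case by (simp cong: nn_integral_cong_simp)
next
  case (extend I m t)
  have I: "m \<in> I" using extend by (auto simp: outward_def)
  have g: "(\<lambda>z. h (z(t := z m + x))) \<in> borel_measurable (PiM I (\<lambda>_. borel))" for x
  proof -
    have "(\<lambda>z. z(t := z m + x)) \<in> PiM I (\<lambda>_. borel) \<rightarrow>\<^sub>M PiM (insert t I) (\<lambda>_. borel)"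
      using I by (intro measurable_fun_upd[where J=I] borel_measurable_add measurable_component_singleton) auto
    from measurable_compose[OF this extend.prems] show ?thesis .
  qed
  have "(\<integral>\<^sup>+\<omega>. h ((\<lambda>s\<in>I. B s \<omega>)(t := B m \<omega> + x)) \<partial>M) = (\<integral>\<^sup>+\<omega>. h ((\<lambda>s\<in>I. B' s \<omega>)(t := B' m \<omega> + x)) \<partial>M)" for x
  proof -
    have "(\<lambda>s\<in>I. B s \<omega>) m = B m \<omega>" "(\<lambda>s\<in>I. B' s \<omega>) m = B' m \<omega>" for \<omega> using I by auto
    then show ?thesis using extend.IH[OF g[of x]] by (simp only:)
  qed
  then show ?case
    unfolding two_sided_nn_integral_extend[OF M B extend.hyps(1) extend.prems]
      two_sided_nn_integral_extend[OF M B' extend.hyps(1) extend.prems] by simp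
qed

section \<open>Minorization of the finite-dimensional laws\<close>

text \<open>The factors of the minorizing product law: a point mass at time 0, where the motion is
  deterministic, and a uniform variable at every other time. The dependence on \<open>s\<close> is
  only through \<open>s = 0\<close>; this is why one law can serve all starting points.\<close>

definition seed_law :: "real \<Rightarrow> real measure" where
  "seed_law s = (if s = 0 then return borel 0 else uniform_measure lborel {0..1})"

lemma sets_seed_law[measurable_cong]: "sets (seed_law s) = sets borel"
  by (simp add: seed_law_def)

lemma prob_space_seed_law: "prob_space (seed_law s)"
  by (auto simp: seed_law_def intro!: prob_space_return prob_space_uniform_measure)

lemma AE_seed_law: "AE x in seed_law s. 0 \<le> x \<and> x \<le> 1"
proof (cases "s = 0")
  case True
  then have "seed_law s = return borel 0" by (simp add: seed_law_def)
  then show ?thesis by (simp only:) (simp add: AE_return)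
next
  case False
  then have "seed_law s = uniform_measure lborel {0..1}" by (simp add: seed_law_def)
  then show ?thesis by (simp only:) (simp add: AE_uniform_measure)
qed

text \<open>A lower bound on [-1, 1] for the centred normal densities with variance between \<delta>
  and \<Delta>: the largest variance gives the prefactor, the smallest the exponent. Differences of
  two points of [0, 1] lie in that interval.\<close>

definition gauss_bound :: "real \<Rightarrow> real \<Rightarrow> real" where
  "gauss_bound \<delta> \<Delta> = 1 / sqrt (2 * pi * \<Delta>) * exp (- 1 / (2 * \<delta>))"

lemma gauss_bound_pos: "0 < \<Delta> \<Longrightarrow> 0 < gauss_bound \<delta> \<Delta>"
  by (simp add: gauss_bound_def)

lemma gauss_bound_le:
  assumes "0 < \<delta>" "\<delta> \<le> v" "v \<le> \<Delta>" "\<bar>u\<bar> \<le> 1"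
  shows "gauss_bound \<delta> \<Delta> \<le> normal_density 0 (sqrt v) u"
proof -
  have "u\<^sup>2 \<le> 1" using assms by (simp add: abs_square_le_1)
  then have "u\<^sup>2 / (2 * v) \<le> 1 / (2 * v)" using assms by (intro divide_right_mono) auto
  also have "\<dots> \<le> 1 / (2 * \<delta>)" using assms by (intro divide_left_mono) auto
  finally have "exp (- 1 / (2 * \<delta>)) \<le> exp (- u\<^sup>2 / (2 * v))" by simp
  moreover have "1 / sqrt (2 * pi * \<Delta>) \<le> 1 / sqrt (2 * pi * v)"
    using assms by (intro divide_left_mono) auto
  ultimately have "1 / sqrt (2 * pi * \<Delta>) * exp (- 1 / (2 * \<delta>)) \<le> 1 / sqrt (2 * pi * v) * exp (- u\<^sup>2 / (2 * v))"
    using assms by (intro mult_mono) auto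
  then show ?thesis using assms by (simp add: gauss_bound_def normal_density_def)
qed

text \<open>Only paths with all values in [0, 1] are kept. Every outward step then has size at most
  1 over a gap between \<delta> and \<Delta>, so its density is at least \<open>gauss_bound\<close>.
  Each time except 0 costs one such factor, hence the exponent.\<close>

lemma two_sided_minorization:
  assumes M: "prob_space M" and B: "two_sided_brownian_motion M B"
    and I: "finite I" "0 \<in> I" and \<delta>: "0 < \<delta>" "0 < \<Delta>"
    and gaps: "\<And>s t. s \<in> I \<Longrightarrow> t \<in> I \<Longrightarrow> s \<noteq> t \<Longrightarrow> \<delta> \<le> \<bar>s - t\<bar> \<and> \<bar>s - t\<bar> \<le> \<Delta>"
    and h: "h \<in> borel_measurable (PiM I (\<lambda>_. borel))"
  shows "ennreal (gauss_bound \<delta> \<Delta> ^ (card I - 1)) * (\<integral>\<^sup>+z. h z \<partial>PiM I seed_law)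
    \<le> (\<integral>\<^sup>+\<omega>. h (\<lambda>s\<in>I. B s \<omega>) \<partial>M)"
  using I gaps h
proof (induction I arbitrary: h rule: outward_induct)
  interpret prob_space M by (rule M)
  case zero
  interpret P: prob_space "PiM {0::real} seed_law" by (intro prob_space_PiM prob_space_seed_law)
  have "seed_law 0 = return borel 0" by (simp add: seed_law_def)
  then have "AE x in seed_law 0. x = 0" by (simp only:) (simp add: AE_return)
  then have "AE z in PiM {0} seed_law. z 0 = 0"
    by (intro AE_PiM_component[where P="\<lambda>x. x = 0"] prob_space_seed_law) auto
  then have "AE z in PiM {0} seed_law. h z = h (\<lambda>s\<in>{0}. 0)"
    using AE_space[of "PiM {0} seed_law"]
  proof eventually_elim
    case (elim z)
    then have "z = (\<lambda>s\<in>{0}. 0)"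
      by (auto simp: space_PiM PiE_iff extensional_def fun_eq_iff)
    then show ?case by simp
  qed
  then have "(\<integral>\<^sup>+z. h z \<partial>PiM {0} seed_law) = (\<integral>\<^sup>+z. h (\<lambda>s\<in>{0}. 0) \<partial>PiM {0} seed_law)"
    by (rule nn_integral_cong_AE)
  also have "\<dots> = h (\<lambda>s\<in>{0}. 0)" by (simp add: P.emeasure_space_1)
  also have "\<dots> = (\<integral>\<^sup>+\<omega>. h (\<lambda>s\<in>{0}. B s \<omega>) \<partial>M)"
  proof -
    have "(\<lambda>s\<in>{0}. B s \<omega>) = (\<lambda>s\<in>{0}. 0)" if "\<omega> \<in> space M" for \<omega>
      using two_sided_start[OF B that] by (auto simp: fun_eq_iff)
    then show ?thesis by (simp add: emeasure_space_1 cong: nn_integral_cong_simp)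
  qed
  finally have *: "(\<integral>\<^sup>+z. h z \<partial>PiM {0} seed_law) = (\<integral>\<^sup>+\<omega>. h (\<lambda>s\<in>{0}. B s \<omega>) \<partial>M)" .
  have "ennreal (gauss_bound \<delta> \<Delta> ^ (card {0::real} - 1)) = 1" by simp
  then show ?case unfolding * by (simp only: mult_1 order_refl)
next
  interpret prob_space M by (rule M)
  interpret PL: pair_sigma_finite M lborel ..
  interpret PS: product_sigma_finite seed_law
    by (simp add: product_sigma_finite_def prob_space_imp_sigma_finite prob_space_seed_law)
  case (extend I m t)
  note [measurable] = two_sided_random_variable[OF B] extend.prems(2)
  have I: "finite I" "m \<in> I" "0 \<in> I" using extend.hyps by (auto simp: outward_def)
  have tI: "t \<notin> I" by (rule outward_notin[OF extend.hyps])
  have t0: "t \<noteq> 0" using tI I by auto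
  have sets_I[measurable_cong]: "sets (PiM J seed_law) = sets (PiM J (\<lambda>_. borel))" for J
    by (intro sets_PiM_cong) (auto simp: sets_seed_law)
  let ?c = "gauss_bound \<delta> \<Delta>"
  let ?\<phi> = "normal_density 0 (sqrt \<bar>t - m\<bar>)"
  have c0: "0 < ?c" using \<delta> by (intro gauss_bound_pos) auto
  have gap: "\<delta> \<le> \<bar>t - m\<bar>" "\<bar>t - m\<bar> \<le> \<Delta>" using extend.prems(1)[of t m] I tI by auto
  have upd[measurable]: "(\<lambda>(z, y). z(t := y)) \<in> PiM I (\<lambda>_. borel) \<Otimes>\<^sub>M borel \<rightarrow>\<^sub>M PiM (insert t I) (\<lambda>_. borel :: real measure)"
    by (rule measurable_add_dim)
  have hz[measurable]: "(\<lambda>(z, y). h (z(t := y))) \<in> borel_measurable (PiM I (\<lambda>_. borel) \<Otimes>\<^sub>M borel)"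
    using measurable_compose[OF upd extend.prems(2)] by (simp add: split_beta)
  have zm[measurable]: "(\<lambda>z. z m) \<in> borel_measurable (PiM I (\<lambda>_. borel :: real measure))"
    using I by (intro measurable_component_singleton)
  have path[measurable]: "(\<lambda>\<omega>. \<lambda>s\<in>I. B s \<omega>) \<in> M \<rightarrow>\<^sub>M PiM I (\<lambda>_. borel)"
    by measurable
  have hB[measurable]: "(\<lambda>(\<omega>, y). h ((\<lambda>s\<in>I. B s \<omega>)(t := y))) \<in> borel_measurable (M \<Otimes>\<^sub>M borel)"
  proof -
    have "(\<lambda>z. (\<lambda>s\<in>I. B s (fst z), snd z)) \<in> M \<Otimes>\<^sub>M borel \<rightarrow>\<^sub>M PiM I (\<lambda>_. borel) \<Otimes>\<^sub>M (borel :: real measure)"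
      by measurable
    from measurable_compose[OF this hz] show ?thesis by (simp add: split_beta)
  qed
  \<comment> \<open>The indicator is free of charge under the seed law, whose coordinates are almost
    surely in [0, 1]. On the Brownian side it confines the value at the old extreme point, as the
    density bound for the new value requires.\<close>
  define H where "H z = indicator {0..1} (z m) * (\<integral>\<^sup>+y. h (z(t := y)) \<partial>seed_law t)" for z
  have H[measurable]: "H \<in> borel_measurable (PiM I (\<lambda>_. borel))"
  proof -
    interpret sigma_finite_measure "seed_law t"
      by (simp add: prob_space_imp_sigma_finite prob_space_seed_law)
    show ?thesis unfolding H_def by measurable
  qed
  have "ennreal (?c ^ (card (insert t I) - 1)) * (\<integral>\<^sup>+z. h z \<partial>PiM (insert t I) seed_law) =
      ennreal ?c * (ennreal (?c ^ (card I - 1)) * (\<integral>\<^sup>+z. H z \<partial>PiM I seed_law))"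
  proof -
    have "(\<integral>\<^sup>+z. h z \<partial>PiM (insert t I) seed_law) = (\<integral>\<^sup>+z. (\<integral>\<^sup>+y. h (z(t := y)) \<partial>seed_law t) \<partial>PiM I seed_law)"
      by (rule PS.product_nn_integral_insert[OF I(1) tI]) measurable
    also have "\<dots> = (\<integral>\<^sup>+z. H z \<partial>PiM I seed_law)"
    proof (rule nn_integral_cong_AE)
      have "AE z in PiM I seed_law. 0 \<le> z m \<and> z m \<le> 1"
        using I by (intro AE_PiM_component[where P="\<lambda>x. 0 \<le> x \<and> x \<le> 1"] prob_space_seed_law AE_seed_law)
      then show "AE z in PiM I seed_law. (\<integral>\<^sup>+y. h (z(t := y)) \<partial>seed_law t) = H z"
        by eventually_elim (simp add: H_def)
    qed
    moreover have "card (insert t I) - 1 = Suc (card I - 1)"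
      using I tI by (cases "card I") auto
    ultimately show ?thesis using c0 by (simp add: ennreal_mult mult.assoc)
  qed
  also have "\<dots> \<le> ennreal ?c * (\<integral>\<^sup>+\<omega>. H (\<lambda>s\<in>I. B s \<omega>) \<partial>M)"
    by (intro mult_left_mono extend.IH[OF _ H] extend.prems(1)) simp_all
  also have "\<dots> = (\<integral>\<^sup>+\<omega>. ennreal ?c * H (\<lambda>s\<in>I. B s \<omega>) \<partial>M)"
    by (rule nn_integral_cmult[symmetric]) measurable
  also have "\<dots> \<le> (\<integral>\<^sup>+\<omega>. (\<integral>\<^sup>+y. ennreal (?\<phi> (y - B m \<omega>)) * h ((\<lambda>s\<in>I. B s \<omega>)(t := y)) \<partial>lborel) \<partial>M)"
  proof (rule nn_integral_mono)
    fix \<omega> assume \<omega>: "\<omega> \<in> space M"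
    have hy[measurable]: "(\<lambda>y. h ((\<lambda>s\<in>I. B s \<omega>)(t := y))) \<in> borel_measurable borel"
      using measurable_compose[OF measurable_Pair1'[OF \<omega>] hB] by simp
    show "ennreal ?c * H (\<lambda>s\<in>I. B s \<omega>) \<le> (\<integral>\<^sup>+y. ennreal (?\<phi> (y - B m \<omega>)) * h ((\<lambda>s\<in>I. B s \<omega>)(t := y)) \<partial>lborel)"
    proof (cases "B m \<omega> \<in> {0..1}")
      case True
      have "ennreal ?c * H (\<lambda>s\<in>I. B s \<omega>) = ennreal ?c * (\<integral>\<^sup>+y. h ((\<lambda>s\<in>I. B s \<omega>)(t := y)) * indicator {0..1} y \<partial>lborel)"
        using t0 I True by (simp add: H_def seed_law_def nn_integral_uniform_measure divide_ennreal_def)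
      also have "\<dots> = (\<integral>\<^sup>+y. ennreal ?c * (h ((\<lambda>s\<in>I. B s \<omega>)(t := y)) * indicator {0..1} y) \<partial>lborel)"
        using borel_measurable_times_ennreal[OF hy borel_measurable_indicator[of "{0..1}"]]
        by (intro nn_integral_cmult[symmetric]) simp
      also have "\<dots> \<le> (\<integral>\<^sup>+y. ennreal (?\<phi> (y - B m \<omega>)) * h ((\<lambda>s\<in>I. B s \<omega>)(t := y)) \<partial>lborel)"
      proof (rule nn_integral_mono)
        fix y :: real
        show "ennreal ?c * (h ((\<lambda>s\<in>I. B s \<omega>)(t := y)) * indicator {0..1} y) \<le>
          ennreal (?\<phi> (y - B m \<omega>)) * h ((\<lambda>s\<in>I. B s \<omega>)(t := y))"
        proof (cases "y \<in> {0..1}")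
          case y: True
          have "?c \<le> ?\<phi> (y - B m \<omega>)"
            using y True gap \<delta> by (intro gauss_bound_le) (auto simp: abs_le_iff)
          then show ?thesis using y by (auto intro!: mult_right_mono ennreal_leI)
        qed simp
      qed
      finally show ?thesis .
    qed (use I in \<open>simp add: H_def\<close>)
  qed
  also have "\<dots> = (\<integral>\<^sup>+\<omega>. (\<integral>\<^sup>+x. ennreal (?\<phi> x) * h ((\<lambda>s\<in>I. B s \<omega>)(t := B m \<omega> + x)) \<partial>lborel) \<partial>M)"
  proof (rule nn_integral_cong)
    fix \<omega> assume \<omega>: "\<omega> \<in> space M"
    have hy[measurable]: "(\<lambda>y. h ((\<lambda>s\<in>I. B s \<omega>)(t := y))) \<in> borel_measurable borel"
      using measurable_compose[OF measurable_Pair1'[OF \<omega>] hB] by simp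
    show "(\<integral>\<^sup>+y. ennreal (?\<phi> (y - B m \<omega>)) * h ((\<lambda>s\<in>I. B s \<omega>)(t := y)) \<partial>lborel) =
        (\<integral>\<^sup>+x. ennreal (?\<phi> x) * h ((\<lambda>s\<in>I. B s \<omega>)(t := B m \<omega> + x)) \<partial>lborel)"
    proof -
      define k where "k y = h ((\<lambda>s\<in>I. B s \<omega>)(t := y))" for y
      have [measurable]: "k \<in> borel_measurable borel" using hy by (simp add: k_def[abs_def])
      have "(\<integral>\<^sup>+y. ennreal (?\<phi> (y - B m \<omega>)) * k y \<partial>lborel) = (\<integral>\<^sup>+x. ennreal (?\<phi> x) * k (B m \<omega> + x) \<partial>lborel)"
        by (subst nn_integral_real_affine[where c=1 and t="B m \<omega>"]) simp_all
      then show ?thesis by (simp only: k_def)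
    qed
  qed
  also have "\<dots> = (\<integral>\<^sup>+x. (\<integral>\<^sup>+\<omega>. ennreal (?\<phi> x) * h ((\<lambda>s\<in>I. B s \<omega>)(t := B m \<omega> + x)) \<partial>M) \<partial>lborel)"
  proof (rule PL.Fubini'[symmetric])
    have "(\<lambda>z. (fst z, B m (fst z) + snd z)) \<in> M \<Otimes>\<^sub>M lborel \<rightarrow>\<^sub>M M \<Otimes>\<^sub>M borel" by measurable
    from measurable_compose[OF this hB]
    have [measurable]: "(\<lambda>z. h ((\<lambda>s\<in>I. B s (fst z))(t := B m (fst z) + snd z))) \<in> borel_measurable (M \<Otimes>\<^sub>M lborel)"
      by simp
    show "(\<lambda>(\<omega>, x). ennreal (?\<phi> x) * h ((\<lambda>s\<in>I. B s \<omega>)(t := B m \<omega> + x))) \<in> borel_measurable (M \<Otimes>\<^sub>M lborel)"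
      unfolding split_beta by measurable
  qed
  also have "\<dots> = (\<integral>\<^sup>+x. ennreal (?\<phi> x) * (\<integral>\<^sup>+\<omega>. h ((\<lambda>s\<in>I. B s \<omega>)(t := B m \<omega> + x)) \<partial>M) \<partial>lborel)"
  proof (intro nn_integral_cong nn_integral_cmult)
    fix x :: real
    have "(\<lambda>\<omega>. (\<omega>, B m \<omega> + x)) \<in> M \<rightarrow>\<^sub>M M \<Otimes>\<^sub>M borel" by measurable
    from measurable_compose[OF this hB]
    show "(\<lambda>\<omega>. h ((\<lambda>s\<in>I. B s \<omega>)(t := B m \<omega> + x))) \<in> borel_measurable M" by simp
  qed
  also have "\<dots> = (\<integral>\<^sup>+\<omega>. h (\<lambda>s\<in>insert t I. B s \<omega>) \<partial>M)"
    by (rule two_sided_nn_integral_extend[OF M B extend.hyps extend.prems(2), symmetric])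
  finally show ?case .
qed

section \<open>Increments and logarithmic moments\<close>

lemma (in prob_space) normal_uminus:
  assumes "distributed M lborel X (normal_density 0 \<sigma>)" "0 < \<sigma>"
  shows "distributed M lborel (\<lambda>x. - X x) (normal_density 0 \<sigma>)"
  using normal_density_affine[OF assms, of "-1" 0] by simp

lemma distributed_cong_space:
  assumes "distributed M N X f" "\<And>x. x \<in> space M \<Longrightarrow> X x = Y x"
  shows "distributed M N Y f"
proof -
  have "distr M N X = distr M N Y" by (rule distr_cong) (use assms(2) in auto)
  moreover have "X \<in> M \<rightarrow>\<^sub>M N \<longleftrightarrow> Y \<in> M \<rightarrow>\<^sub>M N" by (rule measurable_cong) (use assms(2) in auto)
  ultimately show ?thesis using assms(1) by (simp add: distributed_def)
qed

text \<open>Times of the same sign use the increments of one half. For t < 0 < s the halves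
  contribute independent normal variables with variances \<open>s\<close> and \<open>- t\<close>,
  whose sum is the distance.\<close>

lemma two_sided_diff_distributed:
  assumes M: "prob_space M" and B: "two_sided_brownian_motion M B" and st: "s \<noteq> t"
  shows "distributed M lborel (\<lambda>\<omega>. B s \<omega> - B t \<omega>) (normal_density 0 (sqrt \<bar>s - t\<bar>))"
proof -
  interpret prob_space M by (rule M)
  obtain Bp Bm where Bp: "brownian_motion M Bp" and Bm: "brownian_motion M Bm"
    and indep: "indep_var (Pi\<^sub>M {0..} (\<lambda>_. borel)) (\<lambda>\<omega>. \<lambda>t\<in>{0..}. Bp t \<omega>)
        (Pi\<^sub>M {0..} (\<lambda>_. borel)) (\<lambda>\<omega>. \<lambda>t\<in>{0..}. Bm t \<omega>)"
    and Beq: "\<And>\<omega> t. \<omega> \<in> space M \<Longrightarrow> 0 \<le> t \<Longrightarrow> B t \<omega> = Bp t \<omega>"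
      "\<And>\<omega> t. \<omega> \<in> space M \<Longrightarrow> t \<le> 0 \<Longrightarrow> B t \<omega> = Bm (- t) \<omega>"
    using B by (auto simp: two_sided_brownian_motion_def)
  interpret Bp: brownian_motion M Bp by fact
  interpret Bm: brownian_motion M Bm by fact
  have less: "distributed M lborel (\<lambda>\<omega>. B s \<omega> - B t \<omega>) (normal_density 0 (sqrt (s - t)))"
    if st: "t < s" for s t
  proof -
    consider "0 \<le> t" | "s \<le> 0" | "t < 0" "0 < s" by linarith
    then show ?thesis
    proof cases
      case 1
      then have "distributed M lborel (\<lambda>\<omega>. Bp s \<omega> - Bp t \<omega>) (normal_density 0 (sqrt (s - t)))"
        using st by (intro Bp.normal_increments)
      then show ?thesis by (rule distributed_cong_space) (use 1 st Beq in auto)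
    next
      case 2
      then have "distributed M lborel (\<lambda>\<omega>. Bm (- t) \<omega> - Bm (- s) \<omega>) (normal_density 0 (sqrt (- t - (- s))))"
        using st by (intro Bm.normal_increments) auto
      from normal_uminus[OF this] st
      have "distributed M lborel (\<lambda>\<omega>. Bm (- s) \<omega> - Bm (- t) \<omega>) (normal_density 0 (sqrt (s - t)))" by simp
      then show ?thesis by (rule distributed_cong_space) (use 2 st Beq in auto)
    next
      case 3
      have p: "distributed M lborel (\<lambda>\<omega>. Bp s \<omega>) (normal_density 0 (sqrt s))"
        using Bp.normal_increments[of 0 s] 3
        by (auto elim!: distributed_cong_space simp: Bp.start)
      have m: "distributed M lborel (\<lambda>\<omega>. Bm (- t) \<omega>) (normal_density 0 (sqrt (- t)))"
        using Bm.normal_increments[of 0 "- t"] 3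
        by (auto elim!: distributed_cong_space simp: Bm.start)
      have "indep_var borel ((\<lambda>p. p s) \<circ> (\<lambda>\<omega>. \<lambda>t\<in>{0..}. Bp t \<omega>)) borel ((\<lambda>p. p (- t)) \<circ> (\<lambda>\<omega>. \<lambda>t\<in>{0..}. Bm t \<omega>))"
        using 3 by (intro indep_var_compose[OF indep] measurable_component_singleton) auto
      then have "indep_var borel (\<lambda>\<omega>. Bp s \<omega>) borel (\<lambda>\<omega>. Bm (- t) \<omega>)"
        using 3 by (simp add: comp_def)
      from diff_indep_normal[OF this _ _ p m] 3
      have "distributed M lborel (\<lambda>\<omega>. Bp s \<omega> - Bm (- t) \<omega>) (normal_density 0 (sqrt (s - t)))"
        by simp
      then show ?thesis by (rule distributed_cong_space) (use 3 st Beq in auto)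
    qed
  qed
  consider "t < s" | "s < t" using st by linarith
  then show ?thesis
  proof cases
    case 1
    then show ?thesis using less[of t s] by simp
  next
    case 2
    from normal_uminus[OF less[OF 2]] 2 show ?thesis by (simp add: abs_minus_commute)
  qed
qed

section \<open>Logarithmic moments of the normal law\<close>

lemma abs_ln_le:
  fixes z :: real
  shows "\<bar>ln \<bar>z\<bar>\<bar> \<le> \<bar>z\<bar> + 2 * (indicator {-1..1} z * \<bar>z\<bar> powr (-1/2))"
proof (cases "z = 0")
  case False
  define w where "w = \<bar>z\<bar>"
  have w: "0 < w" using False by (simp add: w_def)
  show ?thesis
  proof (cases "w \<le> 1")
    case True
    \<comment> \<open>The inequality \<open>ln u \<le> u - 1\<close>, taken at a negative power of
      \<open>w\<close>, trades the logarithmic singularity at 0 for an integrable power.\<close>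
    have "ln (w powr (-1/2)) \<le> w powr (-1/2) - 1" using w by (intro ln_le_minus_one) auto
    then have "- ln w \<le> 2 * w powr (-1/2)" using w by (simp add: ln_powr)
    moreover have "ln w \<le> 0" using w True by simp
    ultimately have "\<bar>ln w\<bar> \<le> w + 2 * w powr (-1/2)" using w by linarith
    then show ?thesis using True by (simp add: w_def indicator_def abs_le_iff)
  next
    case False
    then have "0 \<le> ln w" "ln w \<le> w - 1" using w ln_le_minus_one[of w] by auto
    then have "\<bar>ln w\<bar> \<le> w" "0 \<le> 2 * (indicator {-1..1} z * \<bar>z\<bar> powr (-1/2))" using w by auto
    then show ?thesis unfolding w_def by linarith
  qed
qed simp

lemma integrable_inverse_sqrt:
  "integrable lborel (\<lambda>z::real. indicator {-1..1} z * \<bar>z\<bar> powr (-1/2))"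
proof -
  define f :: "real \<Rightarrow> real" where "f z = indicator {0..1} z * z powr (-1/2)" for z
  have [measurable]: "f \<in> borel_measurable borel" unfolding f_def by measurable
  have "((\<lambda>x. x powr (-1/2)) has_integral (1 powr (-1/2+1) / (-1/2+1))) {0..1::real}"
    by (rule has_integral_powr_from_0) auto
  moreover have "f = (\<lambda>x. if x \<in> {0..1} then x powr (-1/2) else 0)" by (auto simp: f_def)
  ultimately have "(f has_integral 2) UNIV"
    using has_integral_restrict_UNIV[of "{0..1::real}" "\<lambda>x. x powr (-1/2)" 2] by simp
  then have "(\<integral>\<^sup>+x. ennreal (f x) \<partial>lborel) = ennreal 2"
    by (intro nn_integral_has_integral_lborel) (simp_all, simp add: f_def)
  then have f: "integrable lborel f"
    by (intro integrableI_nonneg) (simp_all, simp add: f_def)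
  have "integrable lborel (\<lambda>z. f (0 + (-1) * z))"
    using f by (intro lborel_integrable_real_affine) auto
  with f have "integrable lborel (\<lambda>z. f z + f (- z))" by simp
  then show ?thesis
    by (rule Bochner_Integration.integrable_bound) (auto simp: f_def indicator_def)
qed

definition log_moment :: real where
  "log_moment = (\<integral>z. std_normal_density z * \<bar>ln \<bar>z\<bar>\<bar> \<partial>lborel)"

lemma integrable_log_moment: "integrable lborel (\<lambda>z. std_normal_density z * \<bar>ln \<bar>z\<bar>\<bar>)"
proof -
  have "integrable lborel (\<lambda>z. std_normal_density z * \<bar>z\<bar> ^ 1 +
      2 * (indicator {-1..1} z * \<bar>z\<bar> powr (-1/2)))"
    using integrable_std_normal_moment_abs[of 1] integrable_inverse_sqrt
    by (intro Bochner_Integration.integrable_add integrable_mult_right)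
  then show ?thesis
  proof (rule Bochner_Integration.integrable_bound)
    show "AE z in lborel. norm (std_normal_density z * \<bar>ln \<bar>z\<bar>\<bar>) \<le>
      norm (std_normal_density z * \<bar>z\<bar> ^ 1 + 2 * (indicator {-1..1} z * \<bar>z\<bar> powr (-1/2)))"
    proof (rule AE_I2)
      fix z :: real
      let ?r = "2 * (indicator {-1..1} z * \<bar>z\<bar> powr (-1/2)) :: real"
      have r: "0 \<le> ?r" by (auto simp: indicator_def)
      have "1 \<le> sqrt (2 * pi)" using pi_gt3 by (simp add: real_le_rsqrt)
      then have d: "std_normal_density z \<le> 1"
        unfolding std_normal_density_def by (intro mult_le_one) (auto simp: divide_le_eq_1)
      have "std_normal_density z * \<bar>ln \<bar>z\<bar>\<bar> \<le> std_normal_density z * (\<bar>z\<bar> + ?r)"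
        by (rule mult_left_mono[OF abs_ln_le]) simp
      also have "\<dots> \<le> std_normal_density z * \<bar>z\<bar> ^ 1 + 1 * ?r"
        unfolding distrib_left using r d by (intro add_mono mult_right_mono) auto
      finally show "norm (std_normal_density z * \<bar>ln \<bar>z\<bar>\<bar>) \<le> norm (std_normal_density z * \<bar>z\<bar> ^ 1 + ?r)"
        using r by simp
    qed
  qed measurable
qed

lemma log_moment_nonneg: "0 \<le> log_moment"
  unfolding log_moment_def by (intro integral_nonneg_AE) auto

lemma two_sided_log_drift:
  assumes M: "prob_space M" and B: "two_sided_brownian_motion M B" and st: "s \<noteq> t"
  shows "integrable M (\<lambda>\<omega>. \<bar>ln \<bar>B s \<omega> - B t \<omega>\<bar>\<bar>)"
    "(\<integral>\<omega>. \<bar>ln \<bar>B s \<omega> - B t \<omega>\<bar>\<bar> \<partial>M) \<le> \<bar>ln \<bar>s - t\<bar>\<bar> / 2 + log_moment"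
proof -
  interpret prob_space M by (rule M)
  note [measurable] = two_sided_random_variable[OF B]
  define \<sigma> where "\<sigma> = sqrt \<bar>s - t\<bar>"
  have \<sigma>: "0 < \<sigma>" "ln \<sigma> = ln \<bar>s - t\<bar> / 2" using st by (auto simp: \<sigma>_def ln_sqrt)
  define Z where "Z \<omega> = (B s \<omega> - B t \<omega>) / \<sigma>" for \<omega>
  have Z: "distributed M lborel Z std_normal_density"
    using normal_standard_normal_convert[OF \<sigma>(1), of "\<lambda>\<omega>. B s \<omega> - B t \<omega>" 0]
      two_sided_diff_distributed[OF M B st] by (simp add: Z_def[abs_def] \<sigma>_def)
  have i: "integrable M (\<lambda>\<omega>. \<bar>ln \<bar>Z \<omega>\<bar>\<bar>)"
    using distributed_integrable[OF Z, of "\<lambda>z. \<bar>ln \<bar>z\<bar>\<bar>"] integrable_log_moment by simp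
  have e: "(\<integral>\<omega>. \<bar>ln \<bar>Z \<omega>\<bar>\<bar> \<partial>M) = log_moment"
    unfolding log_moment_def by (rule distributed_integral[OF Z, symmetric]) auto
  have le: "\<bar>ln \<bar>B s \<omega> - B t \<omega>\<bar>\<bar> \<le> \<bar>ln \<bar>s - t\<bar>\<bar> / 2 + \<bar>ln \<bar>Z \<omega>\<bar>\<bar>" for \<omega>
  \<comment> \<open>When the values coincide the left-hand side is \<open>ln 0 = 0\<close>, so the
    bound holds for every outcome and not just almost surely.\<close>
  proof (cases "B s \<omega> = B t \<omega>")
    case False
    then have "ln \<bar>Z \<omega>\<bar> = ln \<bar>B s \<omega> - B t \<omega>\<bar> - ln \<bar>s - t\<bar> / 2"
      using \<sigma> by (simp add: Z_def abs_divide ln_div)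
    then show ?thesis by linarith
  qed simp
  have int: "integrable M (\<lambda>\<omega>. \<bar>ln \<bar>s - t\<bar>\<bar> / 2 + \<bar>ln \<bar>Z \<omega>\<bar>\<bar>)" using i by simp
  show 1: "integrable M (\<lambda>\<omega>. \<bar>ln \<bar>B s \<omega> - B t \<omega>\<bar>\<bar>)"
    by (rule Bochner_Integration.integrable_bound[OF int]) (use le in \<open>auto simp: abs_of_nonneg\<close>)
  have "(\<integral>\<omega>. \<bar>ln \<bar>B s \<omega> - B t \<omega>\<bar>\<bar> \<partial>M) \<le> (\<integral>\<omega>. \<bar>ln \<bar>s - t\<bar>\<bar> / 2 + \<bar>ln \<bar>Z \<omega>\<bar>\<bar> \<partial>M)"
    by (rule integral_mono[OF 1 int le])
  also have "\<dots> = \<bar>ln \<bar>s - t\<bar>\<bar> / 2 + log_moment"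
    using i by (simp add: e prob_space)
  finally show "(\<integral>\<omega>. \<bar>ln \<bar>B s \<omega> - B t \<omega>\<bar>\<bar> \<partial>M) \<le> \<bar>ln \<bar>s - t\<bar>\<bar> / 2 + log_moment" .
qed

section \<open>The transition kernel\<close>

lemma borel_measurable_vec_lambda:
  fixes f :: "'p::finite \<Rightarrow> 'a \<Rightarrow> real"
  assumes "\<And>i. f i \<in> borel_measurable M"
  shows "(\<lambda>\<omega>. \<chi> i. f i \<omega>) \<in> borel_measurable M"
  using assms by (subst borel_measurable_euclidean_space) (auto simp: Basis_vec_def inner_axis)

lemma borel_measurable_vec_nth[measurable]: "(\<lambda>y::real^'p::finite. y $ i) \<in> borel_measurable borel"
  by (intro borel_measurable_continuous_onI continuous_intros)

text \<open>Evaluation of a path is not jointly measurable for the product \<open>\<sigma>\<close>-algebra on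
  \<open>\<real> \<Rightarrow> \<real>\<close>.  This measurable substitute agrees with it on continuous paths.\<close>

definition path_eval :: "(real \<Rightarrow> real) \<Rightarrow> real \<Rightarrow> real" where
  "path_eval p w = lim (\<lambda>k. p (real_of_int \<lfloor>real (Suc k) * w\<rfloor> / real (Suc k)))"

lemma measurable_path_eval:
  "(\<lambda>(p, w). path_eval p w) \<in> borel_measurable (PiM UNIV (\<lambda>_. borel) \<Otimes>\<^sub>M borel)"
  unfolding path_eval_def split_beta
proof (rule borel_measurable_lim_metric)
  fix k
  show "(\<lambda>z. fst z (real_of_int \<lfloor>real (Suc k) * snd z\<rfloor> / real (Suc k))) \<in>
    borel_measurable (PiM UNIV (\<lambda>_. borel :: real measure) \<Otimes>\<^sub>M borel)"
  proof (rule measurable_compose_countable[where f="\<lambda>i z. fst z (real_of_int i / real (Suc k))"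
        and g="\<lambda>z. \<lfloor>real (Suc k) * snd z\<rfloor>"])
    fix i :: int
    show "(\<lambda>z. fst z (real_of_int i / real (Suc k))) \<in>
      borel_measurable (PiM UNIV (\<lambda>_. borel :: real measure) \<Otimes>\<^sub>M borel)"
      by (rule measurable_compose[OF measurable_fst measurable_component_singleton]) simp
  qed measurable
qed

lemma path_eval_continuous:
  assumes "continuous_on UNIV p"
  shows "path_eval p w = p w"
proof -
  have "(\<lambda>k. real_of_int \<lfloor>real (Suc k) * w\<rfloor> / real (Suc k)) \<longlonglongrightarrow> w"
  proof (rule LIMSEQ_I)
    fix r :: real assume r: "0 < r"
    obtain N where N: "inverse (real (Suc N)) < r" using reals_Archimedean[OF r] by auto
    have "norm (real_of_int \<lfloor>real (Suc k) * w\<rfloor> / real (Suc k) - w) < r" if "N \<le> k" for k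
    proof -
      have "\<bar>real_of_int \<lfloor>real (Suc k) * w\<rfloor> - real (Suc k) * w\<bar> \<le> 1" by linarith
      then have "\<bar>real_of_int \<lfloor>real (Suc k) * w\<rfloor> - real (Suc k) * w\<bar> / real (Suc k) \<le> 1 / real (Suc k)"
        by (intro divide_right_mono) auto
      moreover have "norm (real_of_int \<lfloor>real (Suc k) * w\<rfloor> / real (Suc k) - w) =
          \<bar>real_of_int \<lfloor>real (Suc k) * w\<rfloor> - real (Suc k) * w\<bar> / real (Suc k)"
      proof -
        have "real_of_int \<lfloor>real (Suc k) * w\<rfloor> / real (Suc k) - w =
            (real_of_int \<lfloor>real (Suc k) * w\<rfloor> - real (Suc k) * w) / real (Suc k)"
          by (simp add: field_simps)
        then show ?thesis by (simp only: real_norm_def abs_divide abs_of_nat)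
      qed
      moreover have "1 / real (Suc k) \<le> inverse (real (Suc N))"
        using that by (simp add: field_simps)
      ultimately show ?thesis using N by linarith
    qed
    then show "\<exists>N. \<forall>k\<ge>N. norm (real_of_int \<lfloor>real (Suc k) * w\<rfloor> / real (Suc k) - w) < r" by blast
  qed
  then have "(\<lambda>k. p (real_of_int \<lfloor>real (Suc k) * w\<rfloor> / real (Suc k))) \<longlonglongrightarrow> p w"
    using assms by (intro isCont_tendsto_compose[where g=p]) (auto simp: continuous_on_eq_continuous_at)
  then show ?thesis unfolding path_eval_def by (rule limI)
qed

lemma two_sided_continuous:
  assumes "two_sided_brownian_motion M B" "\<omega> \<in> space M"
  shows "continuous_on UNIV (\<lambda>t. B t \<omega>)"
proof -
  obtain Bp Bm where Bp: "brownian_motion M Bp" and Bm: "brownian_motion M Bm"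
    and Beq: "\<And>t. 0 \<le> t \<Longrightarrow> B t \<omega> = Bp t \<omega>" "\<And>t. t \<le> 0 \<Longrightarrow> B t \<omega> = Bm (- t) \<omega>"
    using assms by (auto simp: two_sided_brownian_motion_def)
  have "continuous_on {0..} (\<lambda>t. B t \<omega>)"
    using brownian_motion.continuous_paths[OF Bp assms(2)] Beq(1)
    by (subst continuous_on_cong[OF refl, of _ _ "\<lambda>t. Bp t \<omega>"]) auto
  moreover have "continuous_on {..0} (\<lambda>t. B t \<omega>)"
  proof (subst continuous_on_cong[OF refl, of _ _ "\<lambda>t. Bm (- t) \<omega>"])
    show "continuous_on {..0} (\<lambda>t. Bm (- t) \<omega>)"
      by (rule continuous_on_compose2[OF brownian_motion.continuous_paths[OF Bm assms(2)]])
        (auto intro!: continuous_intros)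
  qed (use Beq(2) in auto)
  ultimately have "continuous_on ({0..} \<union> {..0}) (\<lambda>t. B t \<omega>)"
    by (intro continuous_on_closed_Un) auto
  moreover have "{0..} \<union> {..0::real} = UNIV" by auto
  ultimately show ?thesis by simp
qed

lemma path_eval_two_sided:
  "two_sided_brownian_motion M B \<Longrightarrow> \<omega> \<in> space M \<Longrightarrow> path_eval (\<lambda>t. B t \<omega>) w = B w \<omega>"
  by (intro path_eval_continuous two_sided_continuous)

lemma measurable_two_sided_path:
  assumes "two_sided_brownian_motion M B"
  shows "(\<lambda>\<omega> t. B t \<omega>) \<in> M \<rightarrow>\<^sub>M PiM UNIV (\<lambda>_. borel)"
  using measurable_restrict[of UNIV "\<lambda>t \<omega>. B t \<omega>" M "\<lambda>_. borel"] two_sided_random_variable[OF assms]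
  by (simp add: restrict_UNIV)

text \<open>The next motion is evaluated at a random point, the current state; this requires
  measurability in time and outcome together.\<close>

lemma measurable_two_sided_joint:
  assumes B: "two_sided_brownian_motion M B"
  shows "(\<lambda>(y, \<omega>). B y \<omega>) \<in> borel_measurable (borel \<Otimes>\<^sub>M M)"
proof -
  note [measurable] = measurable_two_sided_path[OF B] measurable_path_eval
  have "(\<lambda>z. ((\<lambda>t. B t (snd z)), fst z)) \<in> borel \<Otimes>\<^sub>M M \<rightarrow>\<^sub>M PiM UNIV (\<lambda>_. borel) \<Otimes>\<^sub>M borel"
    by measurable
  from measurable_compose[OF this measurable_path_eval]
  have "(\<lambda>z. path_eval (\<lambda>t. B t (snd z)) (fst z)) \<in> borel_measurable (borel \<Otimes>\<^sub>M M)" by simp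
  then show ?thesis
    by (rule measurable_cong[THEN iffD1, rotated])
      (auto simp: space_pair_measure path_eval_two_sided[OF B])
qed

section \<open>The transition kernel on vectors of points\<close>

definition brownian_vec :: "(real \<Rightarrow> 'a \<Rightarrow> real) \<Rightarrow> real^'p::finite \<Rightarrow> 'a \<Rightarrow> real^'p" where
  "brownian_vec B y \<omega> = (\<chi> i. B (y $ i) \<omega>)"

lemma measurable_brownian_vec_joint:
  assumes B: "two_sided_brownian_motion M B"
  shows "(\<lambda>(y :: real^'p::finite, \<omega>). brownian_vec B y \<omega>) \<in> borel_measurable (borel \<Otimes>\<^sub>M M)"
  unfolding brownian_vec_def split_beta
proof (rule borel_measurable_vec_lambda)
  fix i
  have "(\<lambda>z. ((fst z :: real^'p) $ i, snd z)) \<in> borel \<Otimes>\<^sub>M M \<rightarrow>\<^sub>M borel \<Otimes>\<^sub>M M" by measurable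
  from measurable_compose[OF this measurable_two_sided_joint[OF B]]
  show "(\<lambda>z. B (fst z $ i) (snd z)) \<in> borel_measurable (borel \<Otimes>\<^sub>M M)" by simp
qed

lemma measurable_brownian_vec:
  "two_sided_brownian_motion M B \<Longrightarrow> brownian_vec B y \<in> borel_measurable M"
  unfolding brownian_vec_def[abs_def]
  by (intro borel_measurable_vec_lambda two_sided_random_variable)

definition brownian_kernel :: "'a measure \<Rightarrow> (real \<Rightarrow> 'a \<Rightarrow> real) \<Rightarrow> real^'p::finite \<Rightarrow> (real^'p) measure" where
  "brownian_kernel M B y = distr M borel (brownian_vec B y)"

lemma measurable_brownian_kernel:
  assumes M: "prob_space M" and B: "two_sided_brownian_motion M B"
  shows "brownian_kernel M B \<in> borel \<rightarrow>\<^sub>M prob_algebra borel"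
proof (rule measurable_prob_algebraI)
  interpret prob_space M by (rule M)
  show "prob_space (brownian_kernel M B y)" for y
    unfolding brownian_kernel_def by (rule prob_space_distr) (rule measurable_brownian_vec[OF B])
  show "brownian_kernel M B \<in> borel \<rightarrow>\<^sub>M subprob_algebra borel"
    unfolding brownian_kernel_def[abs_def]
    by (rule measurable_distr2[where M=M, OF measurable_brownian_vec_joint[OF B]])
      (simp add: space_subprob_algebra subprob_space_axioms)
qed

text \<open>The set of times receives the extra point 0, from which the outward construction starts.
  Equal coordinates of \<open>y\<close> share one time.\<close>

lemma brownian_vec_as_path:
  fixes y :: "real^'p::finite"
  shows "h (brownian_vec B y \<omega>) = h (\<chi> i. (\<lambda>s\<in>insert 0 (range (($) y)). B s \<omega>) (y $ i))"
  by (simp add: brownian_vec_def)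

lemma measurable_select_vec:
  fixes y :: "real^'p::finite"
  assumes "range (($) y) \<subseteq> I"
  shows "(\<lambda>z. \<chi> i. (z (y $ i) :: real)) \<in> borel_measurable (PiM I (\<lambda>_. borel))"
  by (intro borel_measurable_vec_lambda measurable_component_singleton) (use assms in auto)

text \<open>This makes the chain time-homogeneous: every step uses another motion, but the
  transition law remains the same.\<close>

lemma brownian_kernel_unique:
  fixes y :: "real^'p::finite"
  assumes M: "prob_space M" and B: "two_sided_brownian_motion M B" "two_sided_brownian_motion M B'"
  shows "brownian_kernel M B y = brownian_kernel M B' y"
proof (rule measure_eqI)
  fix A assume "A \<in> sets (brownian_kernel M B y)"
  then have A[measurable]: "A \<in> sets borel" by (simp add: brownian_kernel_def)
  let ?I = "insert 0 (range (($) y))"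
  let ?h = "\<lambda>z. indicator A (\<chi> i. z (y $ i)) :: ennreal"
  have em: "emeasure (brownian_kernel M b y) A = (\<integral>\<^sup>+\<omega>. ?h (\<lambda>s\<in>?I. b s \<omega>) \<partial>M)"
    if "two_sided_brownian_motion M b" for b
  proof -
    note [measurable] = measurable_brownian_vec[OF that]
    have "emeasure (brownian_kernel M b y) A = (\<integral>\<^sup>+z. indicator A z \<partial>brownian_kernel M b y)"
      by (rule nn_integral_indicator[symmetric]) (simp add: brownian_kernel_def)
    also have "\<dots> = (\<integral>\<^sup>+\<omega>. indicator A (brownian_vec b y \<omega>) \<partial>M)"
      unfolding brownian_kernel_def by (rule nn_integral_distr) measurable
    finally show ?thesis by (simp only: brownian_vec_as_path)
  qed
  have "?h \<in> borel_measurable (PiM ?I (\<lambda>_. borel))"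
    by (rule measurable_compose[OF measurable_select_vec]) auto
  from two_sided_same_law[OF M B _ _ this]
  show "emeasure (brownian_kernel M B y) A = emeasure (brownian_kernel M B' y) A"
    unfolding em[OF B(1)] em[OF B(2)] by simp
qed (simp add: brownian_kernel_def)

text \<open>Distinct nonzero coordinates correspond to CARD('p) distinct times with uniform seeds.
  Relabelled by the index of the coordinate they form the uniform law on the unit cube, whatever
  \<open>y\<close> is. The time 0 explains the step from \<open>card ?I - 1\<close> to
  CARD('p).\<close>

lemma brownian_kernel_minorization:
  fixes y :: "real^'p::finite"
  assumes M: "prob_space M" and B: "two_sided_brownian_motion M B" and \<delta>: "0 < \<delta>" "0 < \<Delta>"
    and y: "inj (($) y)" "\<And>i. y $ i \<noteq> 0"
    and gap: "\<And>i. \<delta> \<le> \<bar>y $ i\<bar> \<and> \<bar>y $ i\<bar> \<le> \<Delta>"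
      "\<And>i j. i \<noteq> j \<Longrightarrow> \<delta> \<le> \<bar>y $ i - y $ j\<bar> \<and> \<bar>y $ i - y $ j\<bar> \<le> \<Delta>"
    and h[measurable]: "h \<in> borel_measurable borel"
  shows "ennreal (gauss_bound \<delta> \<Delta> ^ CARD('p)) *
      (\<integral>\<^sup>+z. h z \<partial>distr (PiM UNIV (\<lambda>_::'p. uniform_measure lborel {0..1})) borel (\<lambda>z. \<chi> i. z i))
    \<le> (\<integral>\<^sup>+z. h z \<partial>brownian_kernel M B y)"
proof -
  let ?I = "insert 0 (range (($) y))"
  let ?U = "uniform_measure lborel {0..1::real}"
  have card: "card ?I - 1 = CARD('p)"
    using y by (subst card_insert_disjoint) (auto simp: card_image)
  have hI: "(\<lambda>z. h (\<chi> i. z (y $ i))) \<in> borel_measurable (PiM ?I (\<lambda>_. borel))"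
    by (rule measurable_compose[OF measurable_select_vec h]) auto
  have sU[measurable_cong]: "sets ?U = sets borel" by simp
  have vec: "(\<lambda>z. \<chi> i. z i) \<in> borel_measurable (PiM UNIV (\<lambda>_::'p. ?U))"
    by (rule borel_measurable_vec_lambda, rule measurable_compose[OF measurable_component_singleton]) auto
  have seed: "seed_law (y $ i) = ?U" for i using y(2) by (simp add: seed_law_def)
  have "distr (PiM ?I seed_law) (PiM UNIV (\<lambda>i. seed_law (y $ i))) (\<lambda>\<omega>. \<lambda>n\<in>UNIV. \<omega> (y $ n)) =
      PiM UNIV (\<lambda>i. seed_law (y $ i))"
    by (rule distr_PiM_reindex) (use y(1) prob_space_seed_law in auto)
  then have reindex: "PiM UNIV (\<lambda>_. ?U) = distr (PiM ?I seed_law) (PiM UNIV (\<lambda>_::'p. ?U)) (\<lambda>\<omega> n. \<omega> (y $ n))"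
    by (simp add: seed restrict_UNIV)
  have sel: "(\<lambda>\<omega> n. \<omega> (y $ n)) \<in> PiM ?I seed_law \<rightarrow>\<^sub>M PiM UNIV (\<lambda>_::'p. ?U)"
  proof (rule measurable_PiM_single')
    fix i :: 'p
    show "(\<lambda>\<omega>. \<omega> (y $ i)) \<in> PiM ?I seed_law \<rightarrow>\<^sub>M ?U"
      using measurable_component_singleton[of "y $ i" ?I seed_law] by (simp add: seed)
  qed auto
  have "(\<integral>\<^sup>+z. h z \<partial>distr (PiM UNIV (\<lambda>_::'p. ?U)) borel (\<lambda>z. \<chi> i. z i)) =
      (\<integral>\<^sup>+z. h (\<chi> i. z i) \<partial>PiM UNIV (\<lambda>_::'p. ?U))"
    by (rule nn_integral_distr[OF vec]) measurable
  also have "\<dots> = (\<integral>\<^sup>+z. h (\<chi> i. z (y $ i)) \<partial>PiM ?I seed_law)"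
    by (subst reindex, rule nn_integral_distr[OF sel]) (simp add: measurable_compose[OF vec h])
  finally have "ennreal (gauss_bound \<delta> \<Delta> ^ CARD('p)) *
      (\<integral>\<^sup>+z. h z \<partial>distr (PiM UNIV (\<lambda>_::'p. ?U)) borel (\<lambda>z. \<chi> i. z i)) =
      ennreal (gauss_bound \<delta> \<Delta> ^ (card ?I - 1)) * (\<integral>\<^sup>+z. h (\<chi> i. z (y $ i)) \<partial>PiM ?I seed_law)"
    by (simp only: card)
  also have "\<dots> \<le> (\<integral>\<^sup>+\<omega>. h (\<chi> i. (\<lambda>s\<in>?I. B s \<omega>) (y $ i)) \<partial>M)"
  proof (rule two_sided_minorization[OF M B _ _ \<delta> _ hI])
    fix s t assume st: "s \<in> ?I" "t \<in> ?I" "s \<noteq> t"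
    then show "\<delta> \<le> \<bar>s - t\<bar> \<and> \<bar>s - t\<bar> \<le> \<Delta>"
      using gap by (auto, metis+)
  qed auto
  also have "\<dots> = (\<integral>\<^sup>+\<omega>. h (brownian_vec B y \<omega>) \<partial>M)"
    by (simp only: brownian_vec_as_path)
  also have "\<dots> = (\<integral>\<^sup>+z. h z \<partial>brownian_kernel M B y)"
    unfolding brownian_kernel_def using h by (subst nn_integral_distr[OF measurable_brownian_vec[OF B]]) simp_all
  finally show ?thesis .
qed

section \<open>The Markov chain of iterated Brownian motions\<close>

text \<open>The iteration as a functional of the paths instead of the outcome. In this form the n-th
  iterate visibly depends on the paths 1 to n only, so that independence of the next path can be
  used; \<open>path_eval\<close> makes the functional measurable.\<close>

primrec path_iterate :: "nat \<Rightarrow> real \<Rightarrow> (nat \<Rightarrow> real \<Rightarrow> real) \<Rightarrow> real" where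
  "path_iterate 0 t u = t"
| "path_iterate (Suc n) t u = path_eval (u (Suc n)) (path_iterate n t u)"

lemma measurable_path_iterate:
  "n \<le> m \<Longrightarrow> path_iterate n t \<in> borel_measurable (PiM {1..m} (\<lambda>_. PiM UNIV (\<lambda>_. borel)))"
proof (induction n)
  case 0
  have "path_iterate 0 t = (\<lambda>_. t)" by auto
  then show ?case by simp
next
  case (Suc n)
  then have "(\<lambda>u. (u (Suc n), path_iterate n t u)) \<in> PiM {1..m} (\<lambda>_. PiM UNIV (\<lambda>_. borel)) \<rightarrow>\<^sub>M
      PiM UNIV (\<lambda>_. borel :: real measure) \<Otimes>\<^sub>M borel"
    by (intro measurable_Pair measurable_component_singleton) auto
  from measurable_compose[OF this measurable_path_eval] show ?case by simp
qed

section \<open>The energy of a configuration and the conditions of Harris' theorem\<close>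

definition separated :: "(real^'p::finite) set" where
  "separated = {y. (\<forall>i. y $ i \<noteq> 0) \<and> (\<forall>i j. i \<noteq> j \<longrightarrow> y $ i \<noteq> y $ j)}"

text \<open>Since \<open>ln 0 = 0\<close>, the diagonal of the double sum vanishes and the indices
  can range over all pairs.\<close>

definition log_energy :: "real^'p::finite \<Rightarrow> real" where
  "log_energy y = (\<Sum>i\<in>UNIV. \<bar>ln \<bar>y $ i\<bar>\<bar>) + (\<Sum>i\<in>UNIV. \<Sum>j\<in>UNIV. \<bar>ln \<bar>y $ i - y $ j\<bar>\<bar>)"

lemma log_energy_nonneg: "0 \<le> log_energy y"
  by (simp add: log_energy_def sum_nonneg)

lemma log_energy_ge:
  "\<bar>ln \<bar>y $ i\<bar>\<bar> \<le> log_energy y" "\<bar>ln \<bar>y $ i - y $ j\<bar>\<bar> \<le> log_energy y"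
proof -
  have 1: "\<bar>ln \<bar>y $ i\<bar>\<bar> \<le> (\<Sum>i\<in>UNIV. \<bar>ln \<bar>y $ i\<bar>\<bar>)"
    by (rule member_le_sum) auto
  have "\<bar>ln \<bar>y $ i - y $ j\<bar>\<bar> \<le> (\<Sum>j\<in>UNIV. \<bar>ln \<bar>y $ i - y $ j\<bar>\<bar>)"
    by (rule member_le_sum) auto
  also have "\<dots> \<le> (\<Sum>i\<in>UNIV. \<Sum>j\<in>UNIV. \<bar>ln \<bar>y $ i - y $ j\<bar>\<bar>)"
    by (rule member_le_sum[where f="\<lambda>i. \<Sum>j\<in>UNIV. \<bar>ln \<bar>y $ i - y $ j\<bar>\<bar>"]) (auto simp: sum_nonneg)
  finally have 2: "\<bar>ln \<bar>y $ i - y $ j\<bar>\<bar> \<le> (\<Sum>i\<in>UNIV. \<Sum>j\<in>UNIV. \<bar>ln \<bar>y $ i - y $ j\<bar>\<bar>)" .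
  have "0 \<le> (\<Sum>i\<in>UNIV. \<bar>ln \<bar>y $ i\<bar>\<bar>)" "0 \<le> (\<Sum>i\<in>UNIV. \<Sum>j\<in>UNIV. \<bar>ln \<bar>y $ i - y $ j\<bar>\<bar>)"
    by (auto intro!: sum_nonneg)
  with 1 2 show "\<bar>ln \<bar>y $ i\<bar>\<bar> \<le> log_energy y" "\<bar>ln \<bar>y $ i - y $ j\<bar>\<bar> \<le> log_energy y"
    unfolding log_energy_def by linarith+
qed

lemma exp_bounds_of_ln:
  fixes w :: real
  assumes "0 < w" "\<bar>ln w\<bar> \<le> R"
  shows "exp (- R) \<le> w \<and> w \<le> exp R"
  using assms by (metis abs_le_D1 abs_le_D2 exp_ln exp_le_cancel_iff minus_le_iff)

lemma two_sided_AE_neq: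
  assumes M: "prob_space M" and B: "two_sided_brownian_motion M B" and st: "s \<noteq> t"
  shows "AE \<omega> in M. B s \<omega> \<noteq> B t \<omega>"
proof -
  let ?X = "\<lambda>\<omega>. B s \<omega> - B t \<omega>"
  note X = two_sided_diff_distributed[OF assms]
  have "AE x in lborel. x \<noteq> (0::real)" by (rule AE_lborel_singleton)
  then have "AE x in distr M lborel ?X. x \<noteq> 0"
    unfolding distributed_distr_eq_density[OF X] by (subst AE_density) (auto elim: eventually_mono)
  from AE_distrD[OF distributed_measurable[OF X] this]
  show ?thesis by eventually_elim auto
qed

lemma separated_measurable: "separated \<in> sets (borel :: (real^'p::finite) measure)"
  unfolding separated_def by measurable

text \<open>The additive constant counts one \<open>log_moment\<close> for each of the p + p * p
  summands of the energy, where p = CARD('p).\<close>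

lemma brownian_kernel_harris:
  assumes M: "prob_space M" and B: "two_sided_brownian_motion M B"
  shows "harris_kernel borel (brownian_kernel M B) (separated :: (real^'p::finite) set) log_energy
    ((real CARD('p) + real CARD('p) * real CARD('p)) * log_moment)"
proof
  interpret prob_space M by (rule M)
  note bv = measurable_brownian_vec[OF B]
  show "brownian_kernel M B \<in> borel \<rightarrow>\<^sub>M prob_algebra borel" by (rule measurable_brownian_kernel[OF assms])
  show "separated \<subseteq> space borel" by simp
  show "separated \<noteq> ({} :: (real^'p) set)"
  proof -
    obtain f :: "'p \<Rightarrow> nat" where f: "inj f" using finite_imp_inj_to_nat_seg[of "UNIV::'p set"] by auto
    then have "(\<chi> i. real (Suc (f i))) \<in> (separated :: (real^'p) set)"
      by (auto simp: separated_def inj_def)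
    then show ?thesis by blast
  qed
  show V[measurable]: "log_energy \<in> borel_measurable (borel :: (real^'p) measure)"
    unfolding log_energy_def[abs_def] by measurable
  show "0 \<le> log_energy y" for y :: "real^'p" by (rule log_energy_nonneg)
  show "0 \<le> (real CARD('p) + real CARD('p) * real CARD('p)) * log_moment"
    using log_moment_nonneg by simp
  show "AE z in brownian_kernel M B y. z \<in> separated" if y: "y \<in> separated" for y :: "real^'p"
  proof -
    have "AE \<omega> in M. \<forall>i. B (y $ i) \<omega> \<noteq> B 0 \<omega>"
      using y two_sided_AE_neq[OF M B] by (simp add: AE_all_countable separated_def)
    moreover have "AE \<omega> in M. \<forall>i j. i \<noteq> j \<longrightarrow> B (y $ i) \<omega> \<noteq> B (y $ j) \<omega>"
    proof -
      have "AE \<omega> in M. i \<noteq> j \<longrightarrow> B (y $ i) \<omega> \<noteq> B (y $ j) \<omega>" for i j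
        using y two_sided_AE_neq[OF M B, of "y $ i" "y $ j"] by (cases "i = j") (auto simp: separated_def)
      then show ?thesis by (simp add: AE_all_countable)
    qed
    ultimately have "AE \<omega> in M. brownian_vec B y \<omega> \<in> separated"
      using AE_space
      by eventually_elim (auto simp: separated_def brownian_vec_def two_sided_start[OF B])
    then show ?thesis
      unfolding brownian_kernel_def using separated_measurable by (subst AE_distr_iff[OF bv]) auto
  qed
  fix y :: "real^'p" assume y: "y \<in> separated"
  have y0: "y $ i \<noteq> 0" "i \<noteq> j \<Longrightarrow> y $ i \<noteq> y $ j" for i j using y by (auto simp: separated_def)
  let ?X = "\<lambda>i \<omega>. \<bar>ln \<bar>B (y $ i) \<omega>\<bar>\<bar>" and ?D = "\<lambda>i j \<omega>. \<bar>ln \<bar>B (y $ i) \<omega> - B (y $ j) \<omega>\<bar>\<bar>"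
  have X: "integrable M (?X i)" "(\<integral>\<omega>. ?X i \<omega> \<partial>M) \<le> \<bar>ln \<bar>y $ i\<bar>\<bar> / 2 + log_moment" for i
  proof -
    have eq: "?X i \<omega> = \<bar>ln \<bar>B (y $ i) \<omega> - B 0 \<omega>\<bar>\<bar>" if "\<omega> \<in> space M" for \<omega>
      using two_sided_start[OF B that] by simp
    show "integrable M (?X i)"
      by (subst Bochner_Integration.integrable_cong[OF refl eq])
        (use two_sided_log_drift(1)[OF M B, of "y $ i" 0] y0 in auto)
    show "(\<integral>\<omega>. ?X i \<omega> \<partial>M) \<le> \<bar>ln \<bar>y $ i\<bar>\<bar> / 2 + log_moment"
      by (subst Bochner_Integration.integral_cong[OF refl eq])
        (use two_sided_log_drift(2)[OF M B, of "y $ i" 0] y0 in auto)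
  qed
  \<comment> \<open>On the diagonal all logarithms are \<open>ln 0 = 0\<close>, and the bound
    reduces to \<open>log_moment_nonneg\<close>.\<close>
  have D: "integrable M (?D i j)" "(\<integral>\<omega>. ?D i j \<omega> \<partial>M) \<le> \<bar>ln \<bar>y $ i - y $ j\<bar>\<bar> / 2 + log_moment" for i j
    using two_sided_log_drift[OF M B, of "y $ i" "y $ j"] y0(2)[of i j] log_moment_nonneg
    by (cases "i = j"; simp)+
  have V_eq: "log_energy (brownian_vec B y \<omega>) = (\<Sum>i\<in>UNIV. ?X i \<omega>) + (\<Sum>i\<in>UNIV. \<Sum>j\<in>UNIV. ?D i j \<omega>)" for \<omega>
    by (simp add: log_energy_def brownian_vec_def)
  have int: "integrable M (\<lambda>\<omega>. log_energy (brownian_vec B y \<omega>))"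
    unfolding V_eq using X D by (intro Bochner_Integration.integrable_add Bochner_Integration.integrable_sum)
  then show "integrable (brownian_kernel M B y) log_energy"
    unfolding brownian_kernel_def by (subst integrable_distr_eq[OF bv V])
  have "(\<integral>z. log_energy z \<partial>brownian_kernel M B y) = (\<integral>\<omega>. log_energy (brownian_vec B y \<omega>) \<partial>M)"
    unfolding brownian_kernel_def by (rule integral_distr[OF bv V])
  also have "\<dots> = (\<Sum>i\<in>UNIV. \<integral>\<omega>. ?X i \<omega> \<partial>M) + (\<Sum>i\<in>UNIV. \<Sum>j\<in>UNIV. \<integral>\<omega>. ?D i j \<omega> \<partial>M)"
    unfolding V_eq using X(1) D(1)
    by (subst Bochner_Integration.integral_add)
      (auto simp: Bochner_Integration.integral_sum intro!: Bochner_Integration.integrable_sum)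
  also have "\<dots> \<le> (\<Sum>i\<in>(UNIV::'p set). \<bar>ln \<bar>y $ i\<bar>\<bar> / 2 + log_moment) +
      (\<Sum>i\<in>(UNIV::'p set). \<Sum>j\<in>(UNIV::'p set). \<bar>ln \<bar>y $ i - y $ j\<bar>\<bar> / 2 + log_moment)"
    using X(2) D(2) by (intro add_mono sum_mono)
  also have "\<dots> = log_energy y / 2 + (real CARD('p) + real CARD('p) * real CARD('p)) * log_moment"
    by (simp add: log_energy_def sum.distrib sum_divide_distrib add_divide_distrib algebra_simps)
  finally show "(\<integral>z. log_energy z \<partial>brownian_kernel M B y) \<le>
    log_energy y / 2 + (real CARD('p) + real CARD('p) * real CARD('p)) * log_moment" .
next
  fix R :: real
  let ?\<nu> = "distr (PiM UNIV (\<lambda>_::'p. uniform_measure lborel {0..1})) borel (\<lambda>z. (\<chi> i. z i) :: real^'p)"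
  \<comment> \<open>Energy at most \<open>R\<close> forces all mutual distances and all distances to
    0 into the interval from \<open>exp (- R)\<close> to \<open>exp R\<close>; these ends are the
    \<delta> and \<Delta> of the density bound.\<close>
  let ?\<epsilon> = "gauss_bound (exp (- R)) (exp R) ^ CARD('p)"
  have "0 < ?\<epsilon>" by (intro zero_less_power gauss_bound_pos) simp
  moreover have "prob_space ?\<nu>"
  proof (rule prob_space.prob_space_distr)
    show "prob_space (PiM UNIV (\<lambda>_::'p. uniform_measure lborel {0..1::real}))"
      by (intro prob_space_PiM prob_space_uniform_measure) auto
    show "(\<lambda>z. \<chi> i. z i) \<in> borel_measurable (PiM UNIV (\<lambda>_::'p. uniform_measure lborel {0..1::real}))"
      by (rule borel_measurable_vec_lambda, rule measurable_compose[OF measurable_component_singleton]) auto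
  qed
  moreover have "sets ?\<nu> = sets borel" by simp
  moreover have "ennreal ?\<epsilon> * (\<integral>\<^sup>+z. h z \<partial>?\<nu>) \<le> (\<integral>\<^sup>+z. h z \<partial>brownian_kernel M B y)"
    if y: "y \<in> separated" "log_energy y \<le> R" and h: "h \<in> borel_measurable borel" for h and y :: "real^'p"
  proof (rule brownian_kernel_minorization[OF M B _ _ _ _ _ _ h])
    have ne: "y $ i \<noteq> 0" "i \<noteq> j \<Longrightarrow> y $ i \<noteq> y $ j" for i j using y by (auto simp: separated_def)
    show "inj (($) y)" using ne by (auto simp: inj_def)
    show "y $ i \<noteq> 0" for i by (rule ne)
    show "exp (- R) \<le> \<bar>y $ i\<bar> \<and> \<bar>y $ i\<bar> \<le> exp R" for i
      using log_energy_ge(1)[of y i] y(2) ne(1)[of i] by (intro exp_bounds_of_ln) auto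
    show "exp (- R) \<le> \<bar>y $ i - y $ j\<bar> \<and> \<bar>y $ i - y $ j\<bar> \<le> exp R" if "i \<noteq> j" for i j
      using log_energy_ge(2)[of y i j] y(2) ne(2)[OF that] by (intro exp_bounds_of_ln) auto
  qed auto
  ultimately show "\<exists>\<epsilon>>0. \<exists>\<nu>. prob_space \<nu> \<and> sets \<nu> = sets (borel :: (real^'p) measure) \<and>
      (\<forall>y\<in>separated. log_energy y \<le> R \<longrightarrow> (\<forall>h\<in>borel_measurable borel.
        ennreal \<epsilon> * (\<integral>\<^sup>+z. h z \<partial>\<nu>) \<le> (\<integral>\<^sup>+z. h z \<partial>brownian_kernel M B y)))"
    by blast
qed

section \<open>The Markov property of the iterates\<close>

locale iterated_brownian = prob_space M for M :: "'a measure" +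
  fixes B :: "nat \<Rightarrow> real \<Rightarrow> 'a \<Rightarrow> real"
  assumes indep: "indep_two_sided_brownian_motions M B"
begin

declare One_nat_def [simp del]

lemma two_sided: "1 \<le> n \<Longrightarrow> two_sided_brownian_motion M (B n)"
  using indep by (auto simp: indep_two_sided_brownian_motions_def)

lemma two_sided_1: "two_sided_brownian_motion M (B 1)"
  by (rule two_sided) simp

abbreviation path :: "nat \<Rightarrow> 'a \<Rightarrow> real \<Rightarrow> real" where
  "path n \<omega> \<equiv> (\<lambda>t. B n t \<omega>)"

lemma iterated_process_as_path_iterate:
  assumes "\<omega> \<in> space M" "n \<le> m"
  shows "iterated_process B n t \<omega> = path_iterate n t (\<lambda>k\<in>{1..m}. path k \<omega>)"
  using assms(2)
proof (induction n)
  case (Suc n)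
  then show ?case
    using path_eval_two_sided[OF two_sided[of "Suc n"] assms(1)] by simp
qed simp

definition iterated_vec :: "nat \<Rightarrow> real^'p::finite \<Rightarrow> 'a \<Rightarrow> real^'p" where
  "iterated_vec n x \<omega> = (\<chi> i. iterated_process B n (x $ i) \<omega>)"

lemma iterated_vec_Suc: "iterated_vec (Suc n) x \<omega> = brownian_vec (B (Suc n)) (iterated_vec n x \<omega>) \<omega>"
  by (simp add: iterated_vec_def brownian_vec_def)

lemma measurable_iterated_vec: "iterated_vec n x \<in> borel_measurable M"
proof (induction n)
  case 0
  then show ?case by (simp add: iterated_vec_def[abs_def])
next
  case (Suc n)
  then have "(\<lambda>\<omega>. (iterated_vec n x \<omega>, \<omega>)) \<in> M \<rightarrow>\<^sub>M borel \<Otimes>\<^sub>M M" by measurable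
  from measurable_compose[OF this measurable_brownian_vec_joint[OF two_sided[of "Suc n"]]]
  show ?case by (simp add: iterated_vec_Suc[abs_def])
qed

text \<open>The state after n steps is a functional of the paths 1 to n, which are independent of
  path n + 1; that path may be sampled afresh with the state frozen. Its transition law is then
  replaced by the one of \<open>B 1\<close>.\<close>

lemma nn_integral_iterated_vec_Suc:
  fixes x :: "real^'p::finite"
  assumes h[measurable]: "h \<in> borel_measurable borel"
  shows "(\<integral>\<^sup>+\<omega>. h (iterated_vec (Suc n) x \<omega>) \<partial>M) =
    (\<integral>\<^sup>+\<omega>'. (\<integral>\<^sup>+z. h z \<partial>brownian_kernel M (B 1) (iterated_vec n x \<omega>')) \<partial>M)"
proof -
  let ?P = "PiM UNIV (\<lambda>_. borel) :: (real \<Rightarrow> real) measure"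
  have "indep_vars (\<lambda>_. ?P) path {1..}"
    using indep by (simp add: indep_two_sided_brownian_motions_def)
  from indep_var_restrict[OF this, of "{1..n}" "{Suc n}"]
  have ind: "indep_var (PiM {1..n} (\<lambda>_. ?P)) (\<lambda>\<omega>. \<lambda>k\<in>{1..n}. path k \<omega>)
      (PiM {Suc n} (\<lambda>_. ?P)) (\<lambda>\<omega>. \<lambda>k\<in>{Suc n}. path k \<omega>)"
    by auto
  define g where "g z = h (\<chi> i. path_eval (snd z (Suc n)) (path_iterate n (x $ i) (fst z)))"
    for z :: "(nat \<Rightarrow> real \<Rightarrow> real) \<times> (nat \<Rightarrow> real \<Rightarrow> real)"
  have "(\<lambda>z. (\<chi> i. path_eval (snd z (Suc n)) (path_iterate n (x $ i) (fst z))) :: real^'p)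
      \<in> borel_measurable (PiM {1..n} (\<lambda>_. ?P) \<Otimes>\<^sub>M PiM {Suc n} (\<lambda>_. ?P))"
  proof (rule borel_measurable_vec_lambda)
    fix i
    have "(\<lambda>z. (snd z (Suc n), path_iterate n (x $ i) (fst z))) \<in>
        PiM {1..n} (\<lambda>_. ?P) \<Otimes>\<^sub>M PiM {Suc n} (\<lambda>_. ?P) \<rightarrow>\<^sub>M ?P \<Otimes>\<^sub>M borel"
      by (intro measurable_Pair measurable_compose[OF measurable_snd measurable_component_singleton]
          measurable_compose[OF measurable_fst measurable_path_iterate]) auto
    from measurable_compose[OF this measurable_path_eval]
    show "(\<lambda>z. path_eval (snd z (Suc n)) (path_iterate n (x $ i) (fst z))) \<in>
      borel_measurable (PiM {1..n} (\<lambda>_. ?P) \<Otimes>\<^sub>M PiM {Suc n} (\<lambda>_. ?P))" by simp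
  qed
  from measurable_compose[OF this h]
  have g: "g \<in> borel_measurable (PiM {1..n} (\<lambda>_. ?P) \<Otimes>\<^sub>M PiM {Suc n} (\<lambda>_. ?P))"
    by (simp add: g_def[abs_def])
  have g_eq: "g (\<lambda>k\<in>{1..n}. path k \<omega>', \<lambda>k\<in>{Suc n}. path k \<omega>) = h (brownian_vec (B (Suc n)) (iterated_vec n x \<omega>') \<omega>)"
    if "\<omega> \<in> space M" "\<omega>' \<in> space M" for \<omega> \<omega>'
    using that path_eval_two_sided[OF two_sided[of "Suc n"]]
      iterated_process_as_path_iterate[OF that(2) order_refl, of n]
    by (simp add: g_def brownian_vec_def iterated_vec_def)
  have "(\<integral>\<^sup>+\<omega>. h (iterated_vec (Suc n) x \<omega>) \<partial>M) = (\<integral>\<^sup>+\<omega>. g (\<lambda>k\<in>{1..n}. path k \<omega>, \<lambda>k\<in>{Suc n}. path k \<omega>) \<partial>M)"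
    by (rule nn_integral_cong) (simp only: g_eq iterated_vec_Suc)
  also have "\<dots> = (\<integral>\<^sup>+\<omega>'. (\<integral>\<^sup>+\<omega>. g (\<lambda>k\<in>{1..n}. path k \<omega>', \<lambda>k\<in>{Suc n}. path k \<omega>) \<partial>M) \<partial>M)"
    by (rule nn_integral_indep_var[OF ind g])
  also have "\<dots> = (\<integral>\<^sup>+\<omega>'. (\<integral>\<^sup>+\<omega>. h (brownian_vec (B (Suc n)) (iterated_vec n x \<omega>') \<omega>) \<partial>M) \<partial>M)"
    by (intro nn_integral_cong) (simp only: g_eq)
  also have "\<dots> = (\<integral>\<^sup>+\<omega>'. (\<integral>\<^sup>+z. h z \<partial>brownian_kernel M (B (Suc n)) (iterated_vec n x \<omega>')) \<partial>M)"
    unfolding brownian_kernel_def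
    by (subst nn_integral_distr[OF measurable_brownian_vec[OF two_sided]]) auto
  also have "\<dots> = (\<integral>\<^sup>+\<omega>'. (\<integral>\<^sup>+z. h z \<partial>brownian_kernel M (B 1) (iterated_vec n x \<omega>')) \<partial>M)"
    by (subst brownian_kernel_unique[OF prob_space_axioms two_sided[of "Suc n"] two_sided_1]) auto
  finally show ?thesis .
qed

abbreviation kernel :: "real^'p::finite \<Rightarrow> (real^'p) measure" where
  "kernel \<equiv> brownian_kernel M (B 1)"

lemma measurable_kernel: "kernel \<in> borel \<rightarrow>\<^sub>M prob_algebra borel"
  by (rule measurable_brownian_kernel[OF prob_space_axioms two_sided_1])

lemma law_iterated_vec_Suc:
  fixes x :: "real^'p::finite"
  shows "distr M borel (iterated_vec (Suc n) x) = distr M borel (iterated_vec n x) \<bind> kernel"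
proof (rule measure_eqI)
  let ?N = "distr M borel (iterated_vec n x)"
  have N: "?N \<in> space (prob_algebra borel)"
    by (simp add: space_prob_algebra prob_space_distr measurable_iterated_vec)
  show s: "sets (distr M borel (iterated_vec (Suc n) x)) = sets (?N \<bind> kernel)"
    unfolding sets_bind'[OF N measurable_kernel] by simp
  fix A assume "A \<in> sets (distr M borel (iterated_vec (Suc n) x))"
  then have A[measurable]: "A \<in> sets borel" by simp
  note [measurable] = measurable_prob_algebraD[OF measurable_kernel]
  have "emeasure (distr M borel (iterated_vec (Suc n) x)) A = (\<integral>\<^sup>+z. indicator A z \<partial>distr M borel (iterated_vec (Suc n) x))"
    by simp
  also have "\<dots> = (\<integral>\<^sup>+\<omega>. indicator A (iterated_vec (Suc n) x \<omega>) \<partial>M)"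
    by (rule nn_integral_distr[OF measurable_iterated_vec]) simp
  also have "\<dots> = (\<integral>\<^sup>+\<omega>'. (\<integral>\<^sup>+z. indicator A z \<partial>kernel (iterated_vec n x \<omega>')) \<partial>M)"
    by (rule nn_integral_iterated_vec_Suc) simp
  also have "\<dots> = (\<integral>\<^sup>+y. (\<integral>\<^sup>+z. indicator A z \<partial>kernel y) \<partial>?N)"
    by (rule nn_integral_distr[OF measurable_iterated_vec, symmetric]) measurable
  also have "\<dots> = (\<integral>\<^sup>+z. indicator A z \<partial>(?N \<bind> kernel))"
    by (rule nn_integral_bind[symmetric, where B=borel]) measurable
  also have "\<dots> = emeasure (?N \<bind> kernel) A"
    by (intro nn_integral_indicator) (simp add: sets_bind'[OF N measurable_kernel])
  finally show "emeasure (distr M borel (iterated_vec (Suc n) x)) A = emeasure (?N \<bind> kernel) A" .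
qed

text \<open>Laws grow by appending a transition at the end, which acts first on the test function;
  the induction therefore runs over all bounded \<open>f\<close> simultaneously.\<close>

lemma integral_iterated_vec:
  fixes x :: "real^'p::finite"
  assumes "f \<in> borel_measurable borel" "\<And>z. \<bar>f z\<bar> \<le> C"
  shows "(\<integral>\<omega>. f (iterated_vec n x \<omega>) \<partial>M) = (kernel_op kernel ^^ n) f x"
  using assms
proof (induction n arbitrary: f)
  case 0
  then show ?case by (simp add: iterated_vec_def prob_space)
next
  case (Suc n)
  let ?N = "distr M borel (iterated_vec n x)"
  have N: "?N \<in> space (prob_algebra borel)"
    by (simp add: space_prob_algebra prob_space_distr measurable_iterated_vec)
  have m: "kernel_op kernel f \<in> borel_measurable borel"
    by (rule kernel_op_measurable[OF measurable_kernel Suc.prems(1)])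
  have "(\<integral>\<omega>. f (iterated_vec (Suc n) x \<omega>) \<partial>M) = (\<integral>z. f z \<partial>distr M borel (iterated_vec (Suc n) x))"
    by (rule integral_distr[OF measurable_iterated_vec Suc.prems(1), symmetric])
  also have "\<dots> = (\<integral>y. kernel_op kernel f y \<partial>?N)"
    unfolding law_iterated_vec_Suc kernel_op_def[abs_def]
    by (rule integral_bind_bounded[OF N measurable_kernel Suc.prems])
  also have "\<dots> = (\<integral>\<omega>. kernel_op kernel f (iterated_vec n x \<omega>) \<partial>M)"
    by (rule integral_distr[OF measurable_iterated_vec m])
  also have "\<dots> = (kernel_op kernel ^^ n) (kernel_op kernel f) x"
    using kernel_op_bounded[OF measurable_kernel Suc.prems] by (intro Suc.IH m) auto
  finally show ?case by (simp add: funpow_Suc_right del: funpow.simps)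
qed

theorem iterated_vec_limit:
  obtains \<mu> :: "(real^'p::finite) measure" where "prob_space \<mu>" "sets \<mu> = sets borel"
    "\<And>(f :: real^'p \<Rightarrow> real) C x. f \<in> borel_measurable borel \<Longrightarrow> (\<And>z. \<bar>f z\<bar> \<le> C) \<Longrightarrow> x \<in> separated \<Longrightarrow>
      (\<lambda>n. \<integral>\<omega>. f (iterated_vec n x \<omega>) \<partial>M) \<longlonglongrightarrow> (\<integral>z. f z \<partial>\<mu>)"
proof -
  interpret harris_kernel borel kernel "separated :: (real^'p) set" log_energy
    "(real CARD('p) + real CARD('p) * real CARD('p)) * log_moment"
    by (rule brownian_kernel_harris[OF prob_space_axioms two_sided_1])
  obtain \<mu> where \<mu>: "prob_space \<mu>" "sets \<mu> = sets (borel :: (real^'p) measure)"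
    "\<And>f C x. f \<in> borel_measurable borel \<Longrightarrow> (\<And>z. z \<in> space borel \<Longrightarrow> \<bar>f z\<bar> \<le> C) \<Longrightarrow> x \<in> separated \<Longrightarrow>
      (\<lambda>n. (kernel_op kernel ^^ n) f x) \<longlonglongrightarrow> (\<integral>z. f z \<partial>\<mu>)"
    using limit_law_exists by blast
  show ?thesis
  proof (rule that[OF \<mu>(1,2)])
    fix f :: "real^'p \<Rightarrow> real" and C and x :: "real^'p"
    assume f: "f \<in> borel_measurable borel" "\<And>z. \<bar>f z\<bar> \<le> C" and x: "x \<in> separated"
    show "(\<lambda>n. \<integral>\<omega>. f (iterated_vec n x \<omega>) \<partial>M) \<longlonglongrightarrow> (\<integral>z. f z \<partial>\<mu>)"
      unfolding integral_iterated_vec[OF f] using f(2) by (intro \<mu>(3)[OF f(1) _ x])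
  qed
qed

end

section \<open>The invariant law of a single point\<close>

lemma has_bochner_integral_exp_cos_half:
  fixes a b :: real
  assumes a: "0 < a"
  shows "has_bochner_integral lborel (\<lambda>x. indicator {0<..} x * (exp (- a * x) * cos (b * x))) (a / (a\<^sup>2 + b\<^sup>2))"
proof -
  let ?f = "\<lambda>x. exp (- a * x) * cos (b * x)"
  \<comment> \<open>An antiderivative of the integrand that takes the value
    \<open>- a / (a\<^sup>2 + b\<^sup>2)\<close> at 0 and tends to 0 at infinity.\<close>
  define F where "F x = exp (- a * x) * (b * sin (b * x) - a * cos (b * x)) / (a\<^sup>2 + b\<^sup>2)" for x
  have ab: "0 < a\<^sup>2 + b\<^sup>2" using a by (simp add: add_pos_nonneg)
  have "(\<integral>\<^sup>+x. ennreal (exp (- a * x)) * indicator {0..} x \<partial>lborel) = ennreal (0 - (- exp (- a * 0) / a))"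
  proof (rule nn_integral_FTC_atLeast)
    show "((\<lambda>x. - exp (- a * x) / a) has_real_derivative exp (- a * x)) (at x)" for x
      using a by (auto intro!: derivative_eq_intros)
    show "((\<lambda>x. - exp (- a * x) / a) \<longlongrightarrow> 0) at_top"
      using a by real_asymp
  qed auto
  then have "(\<integral>\<^sup>+x. ennreal (indicator {0..} x * exp (- a * x)) \<partial>lborel) < \<infinity>"
    by (subst nn_integral_cong[where v="\<lambda>x. ennreal (exp (- a * x)) * indicator {0..} x"])
      (auto simp: indicator_def)
  then have "integrable lborel (\<lambda>x. indicator {0..} x * exp (- a * x))"
    by (intro integrableI_nonneg) auto
  then have int: "integrable lborel (\<lambda>x. indicator {0<..} x * ?f x)"
    by (rule Bochner_Integration.integrable_bound)
      (auto simp: indicator_def abs_mult intro!: AE_I2 mult_left_le)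
  have "(LBINT x=ereal 0..\<infinity>. ?f x) = 0 - (- a / (a\<^sup>2 + b\<^sup>2))"
  proof (rule interval_integral_FTC_integrable[where F=F])
    show "(F has_vector_derivative ?f x) (at x)" for x
    proof -
      have "(F has_real_derivative (- a * exp (- a * x) * (b * sin (b * x) - a * cos (b * x)) +
          exp (- a * x) * (b * (b * cos (b * x)) + a * (b * sin (b * x)))) / (a\<^sup>2 + b\<^sup>2)) (at x)"
        unfolding F_def using ab by (auto intro!: derivative_eq_intros)
      moreover have "(- a * exp (- a * x) * (b * sin (b * x) - a * cos (b * x)) +
          exp (- a * x) * (b * (b * cos (b * x)) + a * (b * sin (b * x)))) / (a\<^sup>2 + b\<^sup>2) = ?f x"
      proof -
        have "- a * exp (- a * x) * (b * sin (b * x) - a * cos (b * x)) +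
            exp (- a * x) * (b * (b * cos (b * x)) + a * (b * sin (b * x))) = ?f x * (a\<^sup>2 + b\<^sup>2)"
          by (simp add: algebra_simps power2_eq_square)
        then show ?thesis using a by simp
      qed
      ultimately show ?thesis by (simp add: has_real_derivative_iff_has_vector_derivative)
    qed
    show "set_integrable lborel (einterval (ereal 0) \<infinity>) ?f"
      using int by (simp add: set_integrable_def)
    have "(F \<longlongrightarrow> F 0) (at_right 0)"
      unfolding F_def using ab by (intro tendsto_intros) auto
    then show "((F \<circ> real_of_ereal) \<longlongrightarrow> - a / (a\<^sup>2 + b\<^sup>2)) (at_right (ereal 0))"
      by (simp add: ereal_tendsto_simps F_def)
    have "(F \<longlongrightarrow> 0) at_top"
    proof (rule Lim_null_comparison[where g="\<lambda>x. (\<bar>b\<bar> + a) / (a\<^sup>2 + b\<^sup>2) * exp (- a * x)"])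
      show "\<forall>\<^sub>F x in at_top. norm (F x) \<le> (\<bar>b\<bar> + a) / (a\<^sup>2 + b\<^sup>2) * exp (- a * x)"
      proof (rule always_eventually, rule allI)
        fix x
        have "\<bar>b * sin (b * x) - a * cos (b * x)\<bar> \<le> \<bar>b * sin (b * x)\<bar> + \<bar>a * cos (b * x)\<bar>"
          by (rule abs_triangle_ineq4)
        also have "\<dots> \<le> \<bar>b\<bar> + a"
          using a by (auto simp: abs_mult intro!: add_mono mult_left_le)
        finally have "\<bar>b * sin (b * x) - a * cos (b * x)\<bar> * exp (- a * x) / (a\<^sup>2 + b\<^sup>2)
            \<le> (\<bar>b\<bar> + a) * exp (- a * x) / (a\<^sup>2 + b\<^sup>2)"
          using ab by (intro divide_right_mono mult_right_mono) auto
        then show "norm (F x) \<le> (\<bar>b\<bar> + a) / (a\<^sup>2 + b\<^sup>2) * exp (- a * x)"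
          using ab by (simp add: F_def abs_mult mult.commute)
      qed
      show "((\<lambda>x. (\<bar>b\<bar> + a) / (a\<^sup>2 + b\<^sup>2) * exp (- a * x)) \<longlongrightarrow> 0) at_top"
        using a ab by real_asymp
    qed
    then show "((F \<circ> real_of_ereal) \<longlongrightarrow> 0) (at_left \<infinity>)"
      by (simp add: ereal_tendsto_simps)
  qed (auto intro!: continuous_intros)
  moreover have "(LBINT x=ereal 0..\<infinity>. ?f x) = (\<integral>x. indicator {0<..} x * ?f x \<partial>lborel)"
    by (simp add: interval_integral_to_infinity_eq set_lebesgue_integral_def)
  ultimately show ?thesis using int by (simp add: has_bochner_integral_iff)
qed

text \<open>One formula with three uses for the density with rate 2: its characteristic function,
  its total mass (\<open>b = 0\<close>), and, with \<open>b = 0\<close> and a larger rate, its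
  exponential moments.\<close>

lemma has_bochner_integral_exp_abs_cos:
  fixes a b :: real
  assumes a: "0 < a"
  shows "has_bochner_integral lborel (\<lambda>x. exp (- a * \<bar>x\<bar>) * cos (b * x)) (2 * a / (a\<^sup>2 + b\<^sup>2))"
proof -
  define g where "g x = indicator {0<..} x * (exp (- a * x) * cos (b * x))" for x :: real
  have g: "has_bochner_integral lborel g (a / (a\<^sup>2 + b\<^sup>2))"
    using has_bochner_integral_exp_cos_half[OF a, of b] by (simp add: g_def[abs_def])
  have g': "has_bochner_integral lborel (\<lambda>x. g (- x)) (a / (a\<^sup>2 + b\<^sup>2))"
    using lborel_has_bochner_integral_real_affine_iff[of "-1" g "a / (a\<^sup>2 + b\<^sup>2)" 0] g by simp
  have "has_bochner_integral lborel (\<lambda>x. g x + g (- x)) (2 * a / (a\<^sup>2 + b\<^sup>2))"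
    using has_bochner_integral_add[OF g g'] by simp
  \<comment> \<open>The two open half-lines miss the point 0, where the identity fails.\<close>
  moreover have "AE x in lborel. g x + g (- x) = exp (- a * \<bar>x\<bar>) * cos (b * x)"
    using AE_lborel_singleton[of "0::real"]
    by eventually_elim (auto simp: g_def indicator_def)
  ultimately show ?thesis
    by (subst (asm) has_bochner_integral_cong_AE) (auto simp: g_def[abs_def])
qed

text \<open>Rate 2 is the only one that can be invariant. For rate \<lambda> the characteristic
  function is \<open>\<lambda>\<^sup>2 / (\<lambda>\<^sup>2 + t\<^sup>2)\<close>, while one Brownian
  step produces the mean of \<open>exp (- (t\<^sup>2 * \<bar>x\<bar> / 2))\<close>, which is
  \<open>2 * \<lambda> / (2 * \<lambda> + t\<^sup>2)\<close>; these agree exactly for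
  \<open>\<lambda>\<^sup>2 = 2 * \<lambda>\<close>.\<close>

definition laplace :: "real measure" where
  "laplace = density lborel (\<lambda>y. ennreal (exp (- 2 * \<bar>y\<bar>)))"

lemma sets_laplace[measurable_cong]: "sets laplace = sets borel"
  by (simp add: laplace_def)

lemma prob_space_laplace: "prob_space laplace"
proof
  have h: "has_bochner_integral lborel (\<lambda>x. exp (- 2 * \<bar>x\<bar>)) (1::real)"
    using has_bochner_integral_exp_abs_cos[of 2 0] by (simp add: power2_eq_square)
  have "emeasure laplace (space laplace) = (\<integral>\<^sup>+y. ennreal (exp (- 2 * \<bar>y\<bar>)) \<partial>lborel)"
    by (simp add: laplace_def emeasure_density)
  also have "\<dots> = ennreal 1"
    using h by (subst nn_integral_eq_integral) (auto simp: has_bochner_integral_iff)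
  finally show "emeasure laplace (space laplace) = 1" by simp
qed

lemma integral_laplace:
  fixes f :: "real \<Rightarrow> real"
  assumes "f \<in> borel_measurable borel"
  shows "(\<integral>x. f x \<partial>laplace) = (\<integral>x. exp (- 2 * \<bar>x\<bar>) * f x \<partial>lborel)"
  unfolding laplace_def using assms by (subst integral_density) auto

lemma integral_laplace_cos: "(\<integral>x. cos (t * x) \<partial>laplace) = 4 / (4 + t\<^sup>2)"
  using has_bochner_integral_exp_abs_cos[of 2 t]
  by (subst integral_laplace) (auto simp: has_bochner_integral_iff power2_eq_square)

lemma integral_laplace_sin: "(\<integral>x. sin (t * x) \<partial>laplace) = 0"
proof -
  let ?f = "\<lambda>x. exp (- 2 * \<bar>x\<bar>) * sin (t * x) :: real"
  have "(\<integral>x. ?f x \<partial>lborel) = (\<integral>x. ?f (- x) \<partial>lborel)"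
    using lborel_integral_real_affine[of "-1" ?f 0] by simp
  then show ?thesis by (subst integral_laplace) auto
qed

lemma integral_laplace_exp: "(\<integral>x. exp (- (t\<^sup>2 * \<bar>x\<bar> / 2)) \<partial>laplace) = 4 / (4 + t\<^sup>2)"
proof -
  let ?a = "2 + t\<^sup>2 / 2"
  have a: "0 < ?a" by (simp add: add_pos_nonneg)
  have "(\<integral>x. exp (- (t\<^sup>2 * \<bar>x\<bar> / 2)) \<partial>laplace) = (\<integral>x. exp (- ?a * \<bar>x\<bar>) * cos (0 * x) \<partial>lborel)"
    by (subst integral_laplace)
      (auto simp: exp_add[symmetric] algebra_simps intro!: Bochner_Integration.integral_cong)
  also have "\<dots> = 2 * ?a / (?a\<^sup>2 + 0\<^sup>2)"
    using has_bochner_integral_exp_abs_cos[OF a, of 0] unfolding has_bochner_integral_iff by blast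
  also have "\<dots> = 4 / (4 + t\<^sup>2)"
  proof -
    have "2 * r / (r\<^sup>2 + 0\<^sup>2) = 2 / r" for r :: real by (simp add: power2_eq_square)
    then have "2 * ?a / (?a\<^sup>2 + 0\<^sup>2) = 2 / ?a" .
    also have "\<dots> = 4 / (4 + t\<^sup>2)"
    proof -
      have "2 / r = 4 / (2 * r)" for r :: real by simp
      from this[of ?a] show ?thesis by (simp add: distrib_left)
    qed
    finally show ?thesis .
  qed
  finally show ?thesis .
qed

text \<open>Cosine and sine parts are kept apart because \<open>kernel_op\<close> acts on
  real-valued functions.\<close>

lemma (in real_distribution) char_cos_sin:
  "char M t = Complex (\<integral>x. cos (t * x) \<partial>M) (\<integral>x. sin (t * x) \<partial>M)"
proof -
  have i: "integrable M (\<lambda>x. iexp (t * x))"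
    using integrable_iexp[of "\<lambda>x. complex_of_real (t * x)"] by simp
  show ?thesis
    unfolding char_def
    by (rule complex_eqI) (simp_all only: integral_Re[OF i, symmetric] integral_Im[OF i, symmetric], simp_all add: Re_exp Im_exp)
qed

lemma std_normal_cos_sin:
  "(\<integral>x. cos (t * x) \<partial>std_normal_distribution) = exp (- (t\<^sup>2) / 2)"
  "(\<integral>x. sin (t * x) \<partial>std_normal_distribution) = 0"
  using real_distribution.char_cos_sin[OF real_dist_normal_dist, of t]
  by (auto simp: char_std_normal_distribution complex_eq_iff)

section \<open>The chain of a single point\<close>

context iterated_brownian
begin

definition kernel1 :: "real \<Rightarrow> real measure" where
  "kernel1 u = distr M borel (B 1 u)"

lemma random_variable_1[measurable]: "B 1 u \<in> borel_measurable M"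
  by (rule two_sided_random_variable[OF two_sided_1])

lemma measurable_kernel1: "kernel1 \<in> borel \<rightarrow>\<^sub>M prob_algebra borel"
proof (rule measurable_prob_algebraI)
  show "prob_space (kernel1 u)" for u
    unfolding kernel1_def by (rule prob_space_distr) simp
  show "kernel1 \<in> borel \<rightarrow>\<^sub>M subprob_algebra borel"
    unfolding kernel1_def[abs_def]
    by (rule measurable_distr2[where M=M, OF measurable_two_sided_joint[OF two_sided_1]])
      (simp add: space_subprob_algebra subprob_space_axioms)
qed

lemma kernel_op_kernel1:
  assumes "g \<in> borel_measurable borel"
  shows "kernel_op kernel1 g u = (\<integral>\<omega>. g (B 1 u \<omega>) \<partial>M)"
  unfolding kernel_op_def kernel1_def by (rule integral_distr[OF random_variable_1 assms])

text \<open>By stationarity of increments, \<open>B 1 s - B 1 t\<close> and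
  \<open>B 1 (s - t)\<close> are both centred normal with variance \<bar>s - t\<bar>. Hence the
  difference of two coordinates moves by the same transition law as one coordinate.\<close>

lemma integral_diff_eq_kernel1:
  fixes g :: "real \<Rightarrow> real"
  assumes g: "g \<in> borel_measurable borel"
  shows "(\<integral>\<omega>. g (B 1 s \<omega> - B 1 t \<omega>) \<partial>M) = kernel_op kernel1 g (s - t)"
proof (cases "s = t")
  case True
  then show ?thesis
    using two_sided_start[OF two_sided_1]
    by (simp add: kernel_op_kernel1[OF g] cong: Bochner_Integration.integral_cong)
next
  case False
  note X = two_sided_diff_distributed[OF prob_space_axioms two_sided_1 False]
  have "distributed M lborel (\<lambda>\<omega>. B 1 (s - t) \<omega> - B 1 0 \<omega>) (normal_density 0 (sqrt \<bar>s - t - 0\<bar>))"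
    using False by (intro two_sided_diff_distributed[OF prob_space_axioms two_sided_1]) simp
  then have Y: "distributed M lborel (B 1 (s - t)) (normal_density 0 (sqrt \<bar>s - t\<bar>))"
    using two_sided_start[OF two_sided_1] by (auto elim!: distributed_cong_space)
  show ?thesis
    unfolding kernel_op_kernel1[OF g]
    using distributed_integral[OF X, of g] distributed_integral[OF Y, of g] g by simp
qed

lemma kernel1_cos_sin:
  "kernel_op kernel1 (\<lambda>x. cos (t * x)) u = exp (- (t\<^sup>2 * \<bar>u\<bar> / 2))"
  "kernel_op kernel1 (\<lambda>x. sin (t * x)) u = 0"
proof -
  have "kernel_op kernel1 (\<lambda>x. cos (t * x)) u = exp (- (t\<^sup>2 * \<bar>u\<bar> / 2)) \<and>
    kernel_op kernel1 (\<lambda>x. sin (t * x)) u = 0"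
  proof (cases "u = 0")
    case True
    then show ?thesis
      using two_sided_start[OF two_sided_1]
      by (simp add: kernel_op_kernel1 prob_space cong: Bochner_Integration.integral_cong)
  next
    case False
    define \<sigma> where "\<sigma> = sqrt \<bar>u\<bar>"
    have \<sigma>: "0 < \<sigma>" "\<sigma>\<^sup>2 = \<bar>u\<bar>" using False by (auto simp: \<sigma>_def)
    have "distributed M lborel (\<lambda>\<omega>. B 1 u \<omega> - B 1 0 \<omega>) (normal_density 0 (sqrt \<bar>u - 0\<bar>))"
      by (rule two_sided_diff_distributed[OF prob_space_axioms two_sided_1 False])
    then have "distributed M lborel (B 1 u) (normal_density 0 \<sigma>)"
      using two_sided_start[OF two_sided_1] by (auto elim!: distributed_cong_space simp: \<sigma>_def)
    then have Z: "distributed M lborel (\<lambda>\<omega>. B 1 u \<omega> / \<sigma>) std_normal_density"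
      using normal_standard_normal_convert[OF \<sigma>(1), of "B 1 u" 0] by simp
    have eq: "kernel_op kernel1 (\<lambda>x. g (t * x)) u = (\<integral>z. g (t * \<sigma> * z) \<partial>std_normal_distribution)"
      if [measurable]: "g \<in> borel_measurable borel" for g :: "real \<Rightarrow> real"
    proof -
      have "kernel_op kernel1 (\<lambda>x. g (t * x)) u = (\<integral>\<omega>. g (t * \<sigma> * (B 1 u \<omega> / \<sigma>)) \<partial>M)"
        using \<sigma> by (subst kernel_op_kernel1) auto
      also have "\<dots> = (\<integral>z. std_normal_density z * g (t * \<sigma> * z) \<partial>lborel)"
        by (rule distributed_integral[OF Z, symmetric]) auto
      also have "\<dots> = (\<integral>z. g (t * \<sigma> * z) \<partial>std_normal_distribution)"
        by (subst integral_density) auto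
      finally show ?thesis .
    qed
    show ?thesis
      using eq[of cos] eq[of sin] std_normal_cos_sin[of "t * \<sigma>"] \<sigma>
      by (simp add: power_mult_distrib)
  qed
  then show "kernel_op kernel1 (\<lambda>x. cos (t * x)) u = exp (- (t\<^sup>2 * \<bar>u\<bar> / 2))"
    "kernel_op kernel1 (\<lambda>x. sin (t * x)) u = 0" by auto
qed

lemma laplace_in_space: "laplace \<in> space (prob_algebra borel)"
  by (simp add: space_prob_algebra prob_space_laplace sets_laplace)

text \<open>A step turns the cosine into \<open>exp (- (t\<^sup>2 * \<bar>u\<bar> / 2))\<close>,
  whose Laplace mean equals that of the cosine; the sine parts vanish on both sides. Equal
  characteristic functions give equal laws.\<close>

lemma laplace_invariant: "laplace \<bind> kernel1 = laplace"
proof (rule Levy_uniqueness)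
  note bind = integral_bind_bounded[OF laplace_in_space measurable_kernel1]
  have p: "prob_space (laplace \<bind> kernel1)" and s: "sets (laplace \<bind> kernel1) = sets borel"
    by (rule prob_space_bind'[OF laplace_in_space measurable_kernel1],
        rule sets_bind'[OF laplace_in_space measurable_kernel1])
  show 1: "real_distribution (laplace \<bind> kernel1)"
    using p s sets_eq_imp_space_eq[OF s] by (simp add: real_distribution_def real_distribution_axioms_def)
  show 2: "real_distribution laplace"
    using prob_space_laplace sets_laplace sets_eq_imp_space_eq[OF sets_laplace]
    by (simp add: real_distribution_def real_distribution_axioms_def)
  have "(\<integral>x. cos (t * x) \<partial>(laplace \<bind> kernel1)) = 4 / (4 + t\<^sup>2)" for t
    using bind[of "\<lambda>x. cos (t * x)" 1] kernel1_cos_sin(1)[of t]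
    by (simp add: kernel_op_def integral_laplace_exp)
  moreover have "(\<integral>x. sin (t * x) \<partial>(laplace \<bind> kernel1)) = 0" for t
    using bind[of "\<lambda>x. sin (t * x)" 1] kernel1_cos_sin(2)[of t]
    by (simp add: kernel_op_def)
  ultimately show "char (laplace \<bind> kernel1) = char laplace"
    unfolding real_distribution.char_cos_sin[OF 1] real_distribution.char_cos_sin[OF 2]
      fun_eq_iff integral_laplace_cos integral_laplace_sin by simp
qed

lemma kernel1_iterates:
  assumes g: "g \<in> borel_measurable borel" "\<And>u. \<bar>g u\<bar> \<le> C"
  shows "(kernel_op kernel1 ^^ n) g \<in> borel_measurable borel"
    and "\<bar>(kernel_op kernel1 ^^ n) g u\<bar> \<le> C"
proof -
  have "(kernel_op kernel1 ^^ n) g \<in> borel_measurable borel \<and> (\<forall>u. \<bar>(kernel_op kernel1 ^^ n) g u\<bar> \<le> C)"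
  proof (induction n)
    case (Suc n)
    then show ?case
      using kernel_op_measurable[OF measurable_kernel1] kernel_op_bounded[OF measurable_kernel1] by simp
  qed (use g in auto)
  then show "(kernel_op kernel1 ^^ n) g \<in> borel_measurable borel"
    and "\<bar>(kernel_op kernel1 ^^ n) g u\<bar> \<le> C" by auto
qed

lemma integral_laplace_iterates:
  assumes g: "g \<in> borel_measurable borel" "\<And>u. \<bar>g u\<bar> \<le> C"
  shows "(\<integral>u. (kernel_op kernel1 ^^ n) g u \<partial>laplace) = (\<integral>u. g u \<partial>laplace)"
proof (induction n)
  case (Suc n)
  have "(\<integral>u. kernel_op kernel1 ((kernel_op kernel1 ^^ n) g) u \<partial>laplace) =
      (\<integral>u. (kernel_op kernel1 ^^ n) g u \<partial>(laplace \<bind> kernel1))"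
    unfolding kernel_op_def[of kernel1 "(kernel_op kernel1 ^^ n) g"]
    using kernel1_iterates[OF g]
    by (intro integral_bind_bounded[OF laplace_in_space measurable_kernel1, symmetric]) auto
  then show ?case using Suc by (simp add: laplace_invariant)
qed simp

text \<open>Functions of a single coordinate, or of a single difference, are mapped by the vector
  kernel to functions of the same kind, with \<open>kernel1\<close> acting on the real variable. So
  the iterates of the two operators correspond.\<close>

lemma iterates_component:
  fixes x :: "real^'p::finite"
  assumes g: "g \<in> borel_measurable borel" "\<And>u. \<bar>g u\<bar> \<le> C"
  shows "(\<integral>\<omega>. g (iterated_vec n x \<omega> $ i) \<partial>M) = (kernel_op kernel1 ^^ n) g (x $ i)"
    and "(\<integral>\<omega>. g (iterated_vec n x \<omega> $ i - iterated_vec n x \<omega> $ j) \<partial>M) = (kernel_op kernel1 ^^ n) g (x $ i - x $ j)"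
proof -
  have 1: "kernel_op kernel (\<lambda>z::real^'p. h (z $ i)) = (\<lambda>y. kernel_op kernel1 h (y $ i))"
    "kernel_op kernel (\<lambda>z::real^'p. h (z $ i - z $ j)) = (\<lambda>y. kernel_op kernel1 h (y $ i - y $ j))"
    if [measurable]: "h \<in> borel_measurable borel" for h
  proof -
    note bv = measurable_brownian_vec[OF two_sided_1]
    have "kernel_op kernel (\<lambda>z::real^'p. h (z $ i)) y = kernel_op kernel1 h (y $ i)" for y
      unfolding kernel_op_kernel1[OF that] unfolding kernel_op_def brownian_kernel_def
      by (subst integral_distr[OF bv]) (auto simp: brownian_vec_def)
    then show "kernel_op kernel (\<lambda>z::real^'p. h (z $ i)) = (\<lambda>y. kernel_op kernel1 h (y $ i))" by auto
    have "kernel_op kernel (\<lambda>z::real^'p. h (z $ i - z $ j)) y = kernel_op kernel1 h (y $ i - y $ j)" for y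
      unfolding integral_diff_eq_kernel1[OF that, symmetric] unfolding kernel_op_def brownian_kernel_def
      by (subst integral_distr[OF bv]) (auto simp: brownian_vec_def)
    then show "kernel_op kernel (\<lambda>z::real^'p. h (z $ i - z $ j)) = (\<lambda>y. kernel_op kernel1 h (y $ i - y $ j))" by auto
  qed
  have 2: "(kernel_op kernel ^^ n) (\<lambda>z::real^'p. g (z $ i)) = (\<lambda>y. (kernel_op kernel1 ^^ n) g (y $ i))"
    by (induction n) (simp_all add: 1 kernel1_iterates[OF g])
  have 3: "(kernel_op kernel ^^ n) (\<lambda>z::real^'p. g (z $ i - z $ j)) = (\<lambda>y. (kernel_op kernel1 ^^ n) g (y $ i - y $ j))"
    by (induction n) (simp_all add: 1 kernel1_iterates[OF g])
  note [measurable] = g(1)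
  show "(\<integral>\<omega>. g (iterated_vec n x \<omega> $ i) \<partial>M) = (kernel_op kernel1 ^^ n) g (x $ i)"
    using integral_iterated_vec[of "\<lambda>z. g (z $ i)" C n x] g(2) by (simp add: 2)
  show "(\<integral>\<omega>. g (iterated_vec n x \<omega> $ i - iterated_vec n x \<omega> $ j) \<partial>M) = (kernel_op kernel1 ^^ n) g (x $ i - x $ j)"
    using integral_iterated_vec[of "\<lambda>z. g (z $ i - z $ j)" C n x] g(2) by (simp add: 3)
qed

text \<open>The case of one coordinate of the vector limit yields a value \<open>c\<close> common to
  all starts other than 0. Averaging the start over the Laplace law, which does not charge 0, gives
  \<open>c\<close> in the limit by dominated convergence; by invariance the averages are all equal
  to the Laplace mean of \<open>g\<close>.\<close>

lemma one_point_limit: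
  fixes g :: "real \<Rightarrow> real"
  assumes g: "g \<in> borel_measurable borel" "\<And>u. \<bar>g u\<bar> \<le> C" and u: "u \<noteq> 0"
  shows "(\<lambda>n. (kernel_op kernel1 ^^ n) g u) \<longlonglongrightarrow> (\<integral>v. g v \<partial>laplace)"
proof (rule iterated_vec_limit[where 'p=1])
  interpret L: prob_space laplace by (rule prob_space_laplace)
  fix \<mu> :: "(real^1) measure"
  assume lim: "\<And>(f :: real^1 \<Rightarrow> real) C x. f \<in> borel_measurable borel \<Longrightarrow> (\<And>z. \<bar>f z\<bar> \<le> C) \<Longrightarrow> x \<in> separated \<Longrightarrow>
      (\<lambda>n. \<integral>\<omega>. f (iterated_vec n x \<omega>) \<partial>M) \<longlonglongrightarrow> (\<integral>z. f z \<partial>\<mu>)"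
  note [measurable] = g(1)
  define c where "c = (\<integral>z. g (z $ 1) \<partial>\<mu>)"
  have c: "(\<lambda>n. (kernel_op kernel1 ^^ n) g v) \<longlonglongrightarrow> c" if "v \<noteq> 0" for v
  proof -
    have "(\<chi> i. v) \<in> (separated :: (real^1) set)"
      using that by (auto simp: separated_def)
    from lim[of "\<lambda>z. g (z $ 1)" C, OF _ _ this] g(2)
    have "(\<lambda>n. \<integral>\<omega>. g (iterated_vec n (\<chi> i. v) \<omega> $ (1::1)) \<partial>M) \<longlonglongrightarrow> c" by (simp add: c_def)
    then show ?thesis unfolding iterates_component(1)[OF g] by simp
  qed
  have AE0: "AE v in laplace. v \<noteq> 0"
    unfolding laplace_def by (subst AE_density) (auto intro: eventually_mono[OF AE_lborel_singleton[of "0::real"]])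
  have "(\<lambda>n. \<integral>v. (kernel_op kernel1 ^^ n) g v \<partial>laplace) \<longlonglongrightarrow> (\<integral>v. c \<partial>laplace)"
  proof (rule integral_dominated_convergence[where w="\<lambda>_. C"])
    show "(kernel_op kernel1 ^^ n) g \<in> borel_measurable laplace" for n
      using kernel1_iterates(1)[OF g] measurable_cong_sets[OF sets_laplace refl] by auto
    show "AE v in laplace. (\<lambda>n. (kernel_op kernel1 ^^ n) g v) \<longlonglongrightarrow> c"
      using AE0 by eventually_elim (rule c)
  qed (use kernel1_iterates(2)[OF g] in auto)
  then have "(\<integral>v. g v \<partial>laplace) = c"
    unfolding integral_laplace_iterates[OF g] by (simp add: LIMSEQ_const_iff L.prob_space)
  then show ?thesis using c[OF u] by simp
qed

end

text \<open>The form in which the marginals are identified: the limits are known for bounded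
  measurable test functions, in particular for indicators.\<close>

lemma distributed_laplaceI:
  fixes \<mu> :: "'b measure"
  assumes \<mu>: "prob_space \<mu>" and Y[measurable]: "Y \<in> borel_measurable \<mu>"
    and eq: "\<And>A. A \<in> sets borel \<Longrightarrow> (\<integral>z. indicator A (Y z) \<partial>\<mu>) = (\<integral>v. indicator A v \<partial>laplace :: real)"
  shows "distributed \<mu> lborel Y (\<lambda>y. ennreal (exp (- 2 * \<bar>y\<bar>)))"
proof -
  interpret prob_space \<mu> by (rule \<mu>)
  interpret L: prob_space laplace by (rule prob_space_laplace)
  interpret D: prob_space "distr \<mu> lborel Y" by (rule prob_space_distr) simp
  have "distr \<mu> lborel Y = laplace"
  proof (rule measure_eqI)
    fix A assume "A \<in> sets (distr \<mu> lborel Y)"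
    then have A[measurable]: "A \<in> sets borel" by simp
    have "measure (distr \<mu> lborel Y) A = (\<integral>z. indicator A z \<partial>distr \<mu> lborel Y)" by simp
    also have "\<dots> = (\<integral>z. indicator A (Y z) \<partial>\<mu>)" by (rule integral_distr) auto
    also have "\<dots> = (\<integral>v. indicator A v \<partial>laplace)" by (rule eq[OF A])
    also have "\<dots> = measure laplace A"
      using sets_eq_imp_space_eq[OF sets_laplace] by simp
    finally show "emeasure (distr \<mu> lborel Y) A = emeasure laplace A"
      by (simp add: D.emeasure_eq_measure L.emeasure_eq_measure)
  qed (simp add: sets_laplace)
  then show ?thesis
    unfolding distributed_def laplace_def by simp
qed

text \<open>The probability space carrying \<open>X\<close> is the limit law itself, with
  \<open>X\<close> the identity. A finite type is nonempty, so \<open>'p\<close> stands for an index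
  set with p \<ge> 1 elements.\<close>

theorem theorem2:
  fixes M :: "'a measure" and B :: "nat \<Rightarrow> real \<Rightarrow> 'a \<Rightarrow> real"
  assumes "prob_space M" and "indep_two_sided_brownian_motions M B"
  shows "\<exists>(N :: (real ^ 'p) measure) (X :: real ^ 'p \<Rightarrow> real ^ 'p).
    prob_space N \<and> X \<in> borel_measurable N \<and>
    (\<forall>x :: real ^ 'p. (\<forall>i. x $ i \<noteq> 0) \<and> (\<forall>i j. i \<noteq> j \<longrightarrow> x $ i \<noteq> x $ j) \<longrightarrow>
      converges_in_distribution M (\<lambda>n \<omega>. \<chi> i. iterated_process B n (x $ i) \<omega>) N X) \<and>
    (\<forall>i. distributed N lborel (\<lambda>\<omega>. X \<omega> $ i) (\<lambda>y. ennreal (exp (- 2 * \<bar>y\<bar>)))) \<and>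
    (\<forall>i j. i \<noteq> j \<longrightarrow>
      distributed N lborel (\<lambda>\<omega>. X \<omega> $ i - X \<omega> $ j) (\<lambda>y. ennreal (exp (- 2 * \<bar>y\<bar>))))"
proof -
  interpret iterated_brownian M B
    using assms by (simp add: iterated_brownian_def iterated_brownian_axioms_def)
  obtain \<mu> :: "(real^'p) measure" where \<mu>: "prob_space \<mu>" and s[measurable_cong]: "sets \<mu> = sets borel"
    and lim: "\<And>(f :: real^'p \<Rightarrow> real) C x. f \<in> borel_measurable borel \<Longrightarrow> (\<And>z. \<bar>f z\<bar> \<le> C) \<Longrightarrow> x \<in> separated \<Longrightarrow>
      (\<lambda>n. \<integral>\<omega>. f (iterated_vec n x \<omega>) \<partial>M) \<longlonglongrightarrow> (\<integral>z. f z \<partial>\<mu>)"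
    using iterated_vec_limit by blast
  \<comment> \<open>The limit law is the same for all separated starts, so its marginals can be read
    off along the chain from any one of them.\<close>
  obtain x0 :: "real^'p" where x0: "x0 \<in> separated"
    using harris_kernel.G(2)[OF brownian_kernel_harris[OF prob_space_axioms two_sided_1, where 'p='p]] by blast
  have x0': "x0 $ i \<noteq> 0" "i \<noteq> j \<Longrightarrow> x0 $ i - x0 $ j \<noteq> 0" for i j
    using x0 by (auto simp: separated_def)
  have "converges_in_distribution M (\<lambda>n \<omega>. \<chi> i. iterated_process B n (x $ i) \<omega>) \<mu> (\<lambda>z. z)"
    if "(\<forall>i. x $ i \<noteq> 0) \<and> (\<forall>i j. i \<noteq> j \<longrightarrow> x $ i \<noteq> x $ j)" for x :: "real^'p"
    unfolding converges_in_distribution_def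
  proof (intro conjI allI impI)
    have x: "x \<in> separated" using that by (simp add: separated_def)
    show "(\<lambda>\<omega>. \<chi> i. iterated_process B n (x $ i) \<omega>) \<in> borel_measurable M" for n
      using measurable_iterated_vec[of n x] by (simp add: iterated_vec_def[abs_def])
    show "(\<lambda>z. z) \<in> borel_measurable \<mu>" by measurable
    fix f :: "real^'p \<Rightarrow> real" assume "continuous_on UNIV f" and "bounded (range f)"
    then obtain C where f: "f \<in> borel_measurable borel" "\<And>z. \<bar>f z\<bar> \<le> C"
      by (auto simp: bounded_iff intro: borel_measurable_continuous_onI)
    show "(\<lambda>n. \<integral>\<omega>. f (\<chi> i. iterated_process B n (x $ i) \<omega>) \<partial>M) \<longlonglongrightarrow> (\<integral>z. f z \<partial>\<mu>)"
      using lim[OF f x] by (simp add: iterated_vec_def)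
  qed
  moreover have "distributed \<mu> lborel (\<lambda>z. z $ i) (\<lambda>y. ennreal (exp (- 2 * \<bar>y\<bar>)))" for i
  proof (rule distributed_laplaceI[OF \<mu>])
    fix A :: "real set" assume [measurable]: "A \<in> sets borel"
    have g: "(indicator A :: real \<Rightarrow> real) \<in> borel_measurable borel" "\<And>u. \<bar>indicator A u :: real\<bar> \<le> 1"
      by auto
    have "(\<lambda>n. \<integral>\<omega>. indicator A (iterated_vec n x0 \<omega> $ i) \<partial>M) \<longlonglongrightarrow> (\<integral>z. indicator A (z $ i) \<partial>\<mu> :: real)"
      by (rule lim[OF _ _ x0, of "\<lambda>z. indicator A (z $ i)" 1]) auto
    then show "(\<integral>z. indicator A (z $ i) \<partial>\<mu>) = (\<integral>v. indicator A v \<partial>laplace :: real)"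
      unfolding iterates_component(1)[OF g] using one_point_limit[OF g x0'(1)] by (rule LIMSEQ_unique)
  qed measurable
  moreover have "distributed \<mu> lborel (\<lambda>z. z $ i - z $ j) (\<lambda>y. ennreal (exp (- 2 * \<bar>y\<bar>)))" if ij: "i \<noteq> j" for i j
  proof (rule distributed_laplaceI[OF \<mu>])
    fix A :: "real set" assume [measurable]: "A \<in> sets borel"
    have g: "(indicator A :: real \<Rightarrow> real) \<in> borel_measurable borel" "\<And>u. \<bar>indicator A u :: real\<bar> \<le> 1"
      by auto
    have "(\<lambda>n. \<integral>\<omega>. indicator A (iterated_vec n x0 \<omega> $ i - iterated_vec n x0 \<omega> $ j) \<partial>M) \<longlonglongrightarrow>
        (\<integral>z. indicator A (z $ i - z $ j) \<partial>\<mu> :: real)"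
      by (rule lim[OF _ _ x0, of "\<lambda>z. indicator A (z $ i - z $ j)" 1]) auto
    then show "(\<integral>z. indicator A (z $ i - z $ j) \<partial>\<mu>) = (\<integral>v. indicator A v \<partial>laplace :: real)"
      unfolding iterates_component(2)[OF g] using one_point_limit[OF g x0'(2)[OF ij]] by (rule LIMSEQ_unique)
  qed measurable
  ultimately show ?thesis
    using \<mu> by (intro exI[of _ \<mu>] exI[of _ "\<lambda>z. z"]) (auto simp: measurable_cong_sets[OF s refl])
qed

end
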